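(* Let $B$ be a finitely generated commutative ring with nilradical $N$, and suppose that $\operatorname{ann}_{\mathbb Z}(N)\neq 0$. Then the rings $B_{\operatorname{red}}=B/N$ and $B$ are bi-interpretable.
   Context: Rings are commutative with unit, viewed as first-order structures in the language $\{+,\times\}$; "finitely generated" means finitely generated as a ring. "Definable" always means definable with parameters. $\operatorname{ann}_{\mathbb Z}(N)=\{d\in\mathbb Z: dN=0\}$. Bi-interpretability: Let $\mathbf A,\mathbf B$ be first-order structures with universes $A,B$. An interpretation of $\mathbf B$ in $\mathbf A$, written $f\colon\mathbf A\leadsto\mathbf B$, is a surjective map $f\colon M\to B$ with $M\subseteq A^m$ for some $m$, such that for every $n$ and every set $S\subseteq B^n$ definable in $\mathbf B$, the preimage $f^{-1}(S)\subseteq M^n\subseteq A^{mn}$ of $S$ under the map $M^n\to B^n$ induced coordinatewise by $f$ is definable in $\mathbf A$. If $f\colon\mathbf A\leadsto\mathbf B$ (with $f\colon M\to B$) and $g\colon\mathbf B\leadsto\mathbf C$ (with $g\colon N\to C$, $N\subseteq B^n$), the composition $g\circ f\colon \mathbf A\leadsto\mathbf C$ is the map $f^{-1}(N)\to C$. Two interpretations $f\colon M\to B$ and $f'\colon M'\to B$ of $\mathbf B$ in $\mathbf A$ are homotopic, $f\simeq f'$, if $\{(x,x')\in M\times M': f(x)=f'(x')\}$ is definable in $\mathbf A$. A bi-interpretation between $\mathbf A$ and $\mathbf B$ is a pair $(f,g)$ with $f\colon\mathbf A\leadsto\mathbf B$, $g\colon\mathbf B\leadsto\mathbf A$, $g\circ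 f\simeq\operatorname{id}_{\mathbf A}$ and $f\circ g\simeq\operatorname{id}_{\mathbf B}$. $\mathbf A$ and $\mathbf B$ are bi-interpretable if there is a bi-interpretation between them. *)

theory Defs
  imports "HOL-Algebra.Algebra"
begin

section \<open>First-order definability in rings\<close>

text \<open>
  A ring is viewed as a structure in the language with the two binary function symbols for
  addition and multiplication. Variables are de Bruijn indices: \<open>Ex\<close> binds index 0.
\<close>

datatype rterm = Var nat | Plus rterm rterm | Times rterm rterm

datatype rformula = Eq rterm rterm | Neg rformula | Conj rformula rformula | Ex rformula

primrec rterm_val :: "('a, 'x) ring_scheme \<Rightarrow> (nat \<Rightarrow> 'a) \<Rightarrow> rterm \<Rightarrow> 'a" where
  "rterm_val R e (Var i) = e i"
| "rterm_val R e (Plus s t) = rterm_val R e s \<oplus>\<^bsub>R\<^esub> rterm_val R e t"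
| "rterm_val R e (Times s t) = rterm_val R e s \<otimes>\<^bsub>R\<^esub> rterm_val R e t"

primrec rsat :: "('a, 'x) ring_scheme \<Rightarrow> (nat \<Rightarrow> 'a) \<Rightarrow> rformula \<Rightarrow> bool" where
  "rsat R e (Eq s t) \<longleftrightarrow> rterm_val R e s = rterm_val R e t"
| "rsat R e (Neg p) \<longleftrightarrow> \<not> rsat R e p"
| "rsat R e (Conj p q) \<longleftrightarrow> rsat R e p \<and> rsat R e q"
| "rsat R e (Ex p) \<longleftrightarrow> (\<exists>a\<in>carrier R. rsat R (case_nat a e) p)"

definition tuples :: "('a, 'x) ring_scheme \<Rightarrow> nat \<Rightarrow> 'a list set" where
  "tuples R n = {xs. length xs = n \<and> set xs \<subseteq> carrier R}"

text \<open>
  Definability is with parameters: the variables \<open>0, \<dots>, n - 1\<close> range over the tuple, all further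
  free variables are interpreted by parameters \<open>e i\<close> from the ring (only finitely many of
  which occur in the formula).
\<close>

definition definable :: "('a, 'x) ring_scheme \<Rightarrow> nat \<Rightarrow> 'a list set \<Rightarrow> bool" where
  "definable R n S \<longleftrightarrow>
     (\<exists>p e. (\<forall>i. e i \<in> carrier R) \<and>
        S = {xs \<in> tuples R n. rsat R (\<lambda>i. if i < n then xs ! i else e i) p})"


section \<open>Interpretations and bi-interpretability\<close>

text \<open>
  A map \<open>f: M \<rightarrow> B\<close> with \<open>M \<subseteq> A\<^sup>m\<close>; here \<open>m = arity f\<close>, \<open>M = source f\<close>, and the
  values of \<open>to_fun f\<close> outside \<open>M\<close> are irrelevant.
\<close>

record ('a, 'b) tuple_map =
  arity :: nat
  source :: "'a list set"
  to_fun :: "'a list \<Rightarrow> 'b"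

text \<open>
  The preimage in \<open>M\<^sup>n \<subseteq> A\<^bsup>mn\<^esup>\<close> of \<open>S \<subseteq> B\<^sup>n\<close>; an \<open>n\<close>-tuple of \<open>m\<close>-tuples is identified with its
  concatenation.
\<close>

definition tuple_preimage :: "('a, 'b) tuple_map \<Rightarrow> nat \<Rightarrow> 'b list set \<Rightarrow> 'a list set" where
  "tuple_preimage f n S =
     {concat xss | xss. length xss = n \<and> set xss \<subseteq> source f \<and> map (to_fun f) xss \<in> S}"

definition interpretation_of ::
  "('a, 'x) ring_scheme \<Rightarrow> ('b, 'y) ring_scheme \<Rightarrow> ('a, 'b) tuple_map \<Rightarrow> bool" where
  "interpretation_of A B f \<longleftrightarrow>
     source f \<subseteq> tuples A (arity f) \<and>
     to_fun f ` source f = carrier B \<and>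
     (\<forall>n S. definable B n S \<longrightarrow> definable A (arity f * n) (tuple_preimage f n S))"

text \<open>\<open>blocks m n xs\<close> cuts a list of length \<open>m * n\<close> into its \<open>n\<close> consecutive blocks of length \<open>m\<close>.\<close>

definition blocks :: "nat \<Rightarrow> nat \<Rightarrow> 'a list \<Rightarrow> 'a list list" where
  "blocks m n xs = map (\<lambda>i. take m (drop (m * i) xs)) [0..<n]"

lemma blocks_concat:
  assumes "length xss = n" and "\<And>xs. xs \<in> set xss \<Longrightarrow> length xs = m"
  shows "blocks m n (concat xss) = xss"
  using assms
proof (induction xss arbitrary: n)
  case Nil
  then show ?case by (simp add: blocks_def)
next
  case (Cons xs xss)
  have len: "length xs = m" using Cons.prems(2) by simp
  have "blocks m (length xss) (concat xss) = xss" using Cons by simp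
  moreover have "blocks m (Suc k) (xs @ ys) = xs # blocks m k ys" for k ys
    using len by (simp add: blocks_def upt_conv_Cons map_Suc_upt[symmetric] comp_def del: upt_Suc)
  ultimately show ?case using Cons.prems(1) by auto
qed

text \<open>The composition \<open>g \<circ> f\<close>, a map on \<open>f\<^bsup>-1\<^esup>(N)\<close> for \<open>N\<close> the source of \<open>g\<close>.\<close>

definition tuple_map_comp ::
  "('b, 'c) tuple_map \<Rightarrow> ('a, 'b) tuple_map \<Rightarrow> ('a, 'c) tuple_map" where
  "tuple_map_comp g f =
     \<lparr> arity = arity f * arity g,
       source = tuple_preimage f (arity g) (source g),
       to_fun = (\<lambda>xs. to_fun g (map (to_fun f) (blocks (arity f) (arity g) xs))) \<rparr>"

definition tuple_map_id :: "('a, 'x) ring_scheme \<Rightarrow> ('a, 'a) tuple_map" where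
  "tuple_map_id A = \<lparr> arity = 1, source = tuples A 1, to_fun = hd \<rparr>"

definition homotopic ::
  "('a, 'x) ring_scheme \<Rightarrow> ('a, 'b) tuple_map \<Rightarrow> ('a, 'b) tuple_map \<Rightarrow> bool" where
  "homotopic A f f' \<longleftrightarrow>
     definable A (arity f + arity f')
       {x @ x' | x x'. x \<in> source f \<and> x' \<in> source f' \<and> to_fun f x = to_fun f' x'}"

definition bi_interpretation ::
  "('a, 'x) ring_scheme \<Rightarrow> ('b, 'y) ring_scheme \<Rightarrow>
     ('a, 'b) tuple_map \<Rightarrow> ('b, 'a) tuple_map \<Rightarrow> bool" where
  "bi_interpretation A B f g \<longleftrightarrow>
     interpretation_of A B f \<and> interpretation_of B A g \<and>
     homotopic A (tuple_map_comp g f) (tuple_map_id A) \<and>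
     homotopic B (tuple_map_comp f g) (tuple_map_id B)"

definition bi_interpretable ::
  "('a, 'x) ring_scheme \<Rightarrow> ('b, 'y) ring_scheme \<Rightarrow> bool" where
  "bi_interpretable A B \<longleftrightarrow> (\<exists>f g. bi_interpretation A B f g)"


section \<open>Notions from commutative algebra\<close>

definition finitely_generated_ring :: "('a, 'x) ring_scheme \<Rightarrow> bool" where
  "finitely_generated_ring R \<longleftrightarrow>
     (\<exists>H. finite H \<and> H \<subseteq> carrier R \<and> generate_ring R H = carrier R)"

definition nilradical :: "('a, 'x) ring_scheme \<Rightarrow> 'a set" where
  "nilradical R = {x \<in> carrier R. \<exists>n::nat. x [^]\<^bsub>R\<^esub> n = \<zero>\<^bsub>R\<^esub>}"

definition ann_int :: "('a, 'x) ring_scheme \<Rightarrow> 'a set \<Rightarrow> int set" where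
  "ann_int R N = {d. \<forall>x\<in>N. [d] \<cdot>\<^bsub>R\<^esub> x = \<zero>\<^bsub>R\<^esub>}"

end

theory Submission
  imports Defs
begin

text \<open>
  Write \<open>N\<close> for the nilradical. The quotient map \<open>B \<rightarrow> B/N\<close> is itself an interpretation of \<open>B/N\<close> in
  \<open>B\<close>; the work lies in coding \<open>B\<close> inside \<open>B/N\<close>. Call a surjection \<open>h: B \<rightarrow> A\<close> tame if preimages of
  definable sets and images of definable sets are definable, and if there is a surjective partial
  map \<open>f\<close> from a power of \<open>A\<close> onto \<open>B\<close> whose composition with \<open>h\<close> in every coordinate is definable
  in \<open>B\<close>. Then \<open>f\<close> and \<open>h\<close> form a bi-interpretation, because the preimage of a definable set \<open>S\<close>
  under \<open>f\<close> is the image under \<open>h\<close> of a set that is definable in \<open>B\<close>, and the two homotopies are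
  equally direct (\<open>bi_interpretable_image\<close>). Tame surjections compose
  (\<open>tame_surjection_comp\<close>), so it suffices to climb from \<open>0\<close> to \<open>N\<close> through a chain of ideals.

  As \<open>B\<close> is noetherian, the chain comes from noetherian induction. If \<open>J\<close> is an ideal strictly
  inside \<open>N\<close>, then, since the elements of \<open>N\<close> are nilpotent and annihilated by a fixed positive
  integer, some \<open>v \<in> N - J\<close> satisfies \<open>v\<^sup>2 \<in> J\<close> and \<open>p v \<in> J\<close> for a prime \<open>p\<close>
  (\<open>exists_small_element\<close>). This reduces everything to surjections \<open>h: B \<rightarrow> A\<close> whose kernel is
  generated by one element \<open>\<epsilon>\<close> with \<open>\<epsilon>\<^sup>2 = 0\<close> and \<open>p \<epsilon> = 0\<close>.

  For such \<open>h\<close> both \<open>x\<^sup>p\<close> and \<open>p x\<close> depend on \<open>h x\<close> only, because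
  \<open>(x + b \<epsilon>)\<^sup>p = x\<^sup>p + p x\<^bsup>p-1\<^esup> b \<epsilon>\<close>. Hence \<open>ghost a b = x\<^sup>p + p z\<close>, for lifts \<open>x\<close>, \<open>z\<close> of \<open>a\<close>, \<open>b\<close>,
  is a well-defined map \<open>A \<times> A \<rightarrow> B\<close>; it is the ghost map on Witt vectors of length two. Its image
  is a subring, in which addition and multiplication are polynomial in the coordinates \<open>a\<close>, \<open>b\<close>.
  The subring contains all \<open>p\<close>-th powers, so \<open>B\<close> is a finitely generated module over it, and every
  element of \<open>B\<close> has the form \<open>\<Sum>\<^sub>j y\<^sub>j ghost a\<^sub>j b\<^sub>j\<close>. In these coordinates polynomial maps on \<open>B\<close>
  become polynomial maps over \<open>A\<close>, and first-order formulas over \<open>B\<close> turn into formulas over \<open>A\<close> as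
  soon as the relation \<open>\<Sum>\<^sub>j y\<^sub>j ghost a\<^sub>j b\<^sub>j = 0\<close> is definable in \<open>A\<close>. It is: the projection of
  this set to the \<open>a\<close>-coordinates and its fibre over \<open>a = 0\<close> are submodules of \<open>A\<^sup>m\<close>, hence finitely
  generated, and finitely many generators of both, used as parameters, describe the whole set
  (\<open>zero_set_definable\<close>).
\<close>

section \<open>Definable predicates on assignments\<close>

primrec rename_term :: "rterm \<Rightarrow> (nat \<Rightarrow> nat) \<Rightarrow> rterm" where
  "rename_term (Var i) r = Var (r i)"
| "rename_term (Plus s t) r = Plus (rename_term s r) (rename_term t r)"
| "rename_term (Times s t) r = Times (rename_term s r) (rename_term t r)"

primrec rename_formula :: "rformula \<Rightarrow> (nat \<Rightarrow> nat) \<Rightarrow> rformula" where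
  "rename_formula (Eq s t) r = Eq (rename_term s r) (rename_term t r)"
| "rename_formula (Neg p) r = Neg (rename_formula p r)"
| "rename_formula (Conj p q) r = Conj (rename_formula p r) (rename_formula q r)"
| "rename_formula (Ex p) r = Ex (rename_formula p (case_nat 0 (\<lambda>i. Suc (r i))))"

lemma rterm_val_rename: "rterm_val R e (rename_term t r) = rterm_val R (\<lambda>i. e (r i)) t"
  by (induction t) auto

lemma rsat_rename: "rsat R e (rename_formula p r) \<longleftrightarrow> rsat R (\<lambda>i. e (r i)) p"
proof (induction p arbitrary: e r)
  case (Ex p)
  have "(\<lambda>i. case_nat a e (case_nat 0 (\<lambda>i. Suc (r i)) i)) = case_nat a (\<lambda>i. e (r i))" for a
    by (auto simp: fun_eq_iff split: nat.split)
  then show ?case by (simp add: Ex)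
qed (auto simp: rterm_val_rename)

lemma finite_support_combine:
  fixes f :: "(nat \<Rightarrow> 'a) \<Rightarrow> 'b" and g :: "(nat \<Rightarrow> 'a) \<Rightarrow> 'c"
  assumes "\<exists>n. \<forall>e e'. (\<forall>i<n. e i = e' i) \<longrightarrow> f e = f e'"
    and "\<exists>n. \<forall>e e'. (\<forall>i<n. e i = e' i) \<longrightarrow> g e = g e'"
  shows "\<exists>n::nat. \<forall>e e'. (\<forall>i<n. e i = e' i) \<longrightarrow> F (f e) (g e) = F (f e') (g e')"
proof -
  from assms obtain m n where m: "\<And>e e'. (\<forall>i<m. e i = e' i) \<Longrightarrow> f e = f e'"
    and n: "\<And>e e'. (\<forall>i<n. e i = e' i) \<Longrightarrow> g e = g e'" by blast
  show ?thesis
  proof (intro exI[of _ "max m n"] allI impI)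
    fix e e' :: "nat \<Rightarrow> 'a" assume "\<forall>i<max m n. e i = e' i"
    then have "f e = f e'" "g e = g e'" by (auto intro: m n)
    then show "F (f e) (g e) = F (f e') (g e')" by simp
  qed
qed

lemma rterm_val_finite_support:
  "\<exists>n. \<forall>e e'. (\<forall>i<n. e i = e' i) \<longrightarrow> rterm_val R e t = rterm_val R e' t"
proof (induction t)
  case (Var i)
  then show ?case by (auto intro!: exI[of _ "Suc i"])
next
  case (Plus s t)
  from finite_support_combine[where F = "ring.add R", OF Plus] show ?case by simp
next
  case (Times s t)
  from finite_support_combine[where F = "monoid.mult R", OF Times] show ?case by simp
qed

lemma rsat_finite_support:
  "\<exists>n. \<forall>e e'. (\<forall>i<n. e i = e' i) \<longrightarrow> rsat R e p = rsat R e' p"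
proof (induction p)
  case (Eq s t)
  from finite_support_combine[where F = "(=)", OF rterm_val_finite_support rterm_val_finite_support]
  show ?case by simp
next
  case (Conj p q)
  from finite_support_combine[where F = "(\<and>)", OF Conj] show ?case by simp
next
  case (Ex p)
  then obtain n where n: "\<forall>e e'. (\<forall>i<n. e i = e' i) \<longrightarrow> rsat R e p = rsat R e' p" by blast
  show ?case
  proof (intro exI[of _ n] allI impI)
    fix e e' :: "nat \<Rightarrow> 'a" assume "\<forall>i<n. e i = e' i"
    then have "\<forall>i<n. case_nat a e i = case_nat a e' i" for a by (auto split: nat.split)
    then have "rsat R (case_nat a e) p = rsat R (case_nat a e') p" for a using n by blast
    then show "rsat R e (Ex p) = rsat R e' (Ex p)" by simp
  qed
qed auto

abbreviation valuation :: "('a, 'x) ring_scheme \<Rightarrow> ('v \<Rightarrow> 'a) \<Rightarrow> bool" where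
  "valuation R e \<equiv> \<forall>v. e v \<in> carrier R"

text \<open>
  Variables are indexed by an arbitrary type \<open>'v\<close>, so that blocks of variables can be kept apart by
  sum types. The map \<open>\<rho>\<close> says which variables of a formula are genuine; the others are parameters,
  with values \<open>c\<close>. As the indices of the variables carry no meaning, two formulas are brought
  together by moving them to even and odd indices.
\<close>

definition assign :: "(nat \<Rightarrow> 'v option) \<Rightarrow> (nat \<Rightarrow> 'a) \<Rightarrow> ('v \<Rightarrow> 'a) \<Rightarrow> nat \<Rightarrow> 'a" where
  "assign \<rho> c e i = (case \<rho> i of None \<Rightarrow> c i | Some v \<Rightarrow> e v)"

definition dpred :: "('a, 'x) ring_scheme \<Rightarrow> (('v \<Rightarrow> 'a) \<Rightarrow> bool) \<Rightarrow> bool" where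
  "dpred R P \<longleftrightarrow> (\<exists>p \<rho> c. valuation R c \<and>
     (\<forall>e. valuation R e \<longrightarrow> P e = rsat R (assign \<rho> c e) p))"

definition polyfun :: "('a, 'x) ring_scheme \<Rightarrow> (('v \<Rightarrow> 'a) \<Rightarrow> 'a) \<Rightarrow> bool" where
  "polyfun R f \<longleftrightarrow> (\<exists>t \<rho> c. valuation R c \<and>
     (\<forall>e. valuation R e \<longrightarrow> f e = rterm_val R (assign \<rho> c e) t))"

definition interleave :: "(nat \<Rightarrow> 'c) \<Rightarrow> (nat \<Rightarrow> 'c) \<Rightarrow> nat \<Rightarrow> 'c" where
  "interleave f g i = (if even i then f (i div 2) else g (i div 2))"

lemma interleave_simps [simp]:
  "interleave f g (2 * i) = f i" "interleave f g (Suc (2 * i)) = g i"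
  by (auto simp: interleave_def)

lemma assign_interleave:
  "assign (interleave \<rho> \<sigma>) (interleave c d) e (2 * i) = assign \<rho> c e i"
  "assign (interleave \<rho> \<sigma>) (interleave c d) e (Suc (2 * i)) = assign \<sigma> d e i"
  by (auto simp: assign_def split: option.split)

lemma interleave_carrier: "(\<forall>i. c i \<in> S) \<Longrightarrow> (\<forall>i. d i \<in> S) \<Longrightarrow> (\<forall>i. interleave c d i \<in> S)"
  by (auto simp: interleave_def)

lemma dpredE:
  assumes "dpred R P"
  obtains p \<rho> c where "valuation R c"
    "\<And>e. valuation R e \<Longrightarrow> P e = rsat R (assign \<rho> c e) p"
  using assms unfolding dpred_def by blast

lemma polyfunE:
  assumes "polyfun R f"
  obtains t \<rho> c where "valuation R c"
    "\<And>e. valuation R e \<Longrightarrow> f e = rterm_val R (assign \<rho> c e) t"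
  using assms unfolding polyfun_def by blast

lemma dpredI:
  assumes "valuation R c"
    "\<And>e. valuation R e \<Longrightarrow> P e = rsat R (assign \<rho> c e) p"
  shows "dpred R P"
  using assms unfolding dpred_def by blast

lemma polyfunI:
  assumes "valuation R c"
    "\<And>e. valuation R e \<Longrightarrow> f e = rterm_val R (assign \<rho> c e) t"
  shows "polyfun R f"
  using assms unfolding polyfun_def by blast

lemma dpred_cong:
  assumes "dpred R P" "\<And>e. valuation R e \<Longrightarrow> P e = Q e"
  shows "dpred R Q"
  using assms unfolding dpred_def by metis

lemma polyfun_cong:
  assumes "polyfun R f" "\<And>e. valuation R e \<Longrightarrow> f e = g e"
  shows "polyfun R g"
  using assms unfolding polyfun_def by metis

lemma polyfun_const: "a \<in> carrier R \<Longrightarrow> polyfun R (\<lambda>e. a)"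
  by (rule polyfunI[of "\<lambda>i. a" _ _ "\<lambda>i. None" "Var 0"]) (auto simp: assign_def)

lemma polyfun_var:
  assumes "ring R"
  shows "polyfun R (\<lambda>e. e v)"
proof -
  interpret ring R by fact
  show ?thesis
    by (rule polyfunI[of "\<lambda>i. \<zero>\<^bsub>R\<^esub>" _ _ "\<lambda>i. Some v" "Var 0"]) (auto simp: assign_def)
qed

lemma polyfun_binary:
  assumes "polyfun R f" "polyfun R g"
    and op: "\<And>e s t. rterm_val R e (F s t) = op (rterm_val R e s) (rterm_val R e t)"
  shows "polyfun R (\<lambda>e. op (f e) (g e))"
proof -
  obtain s \<rho> c where 1: "valuation R c"
    "\<And>e. valuation R e \<Longrightarrow> f e = rterm_val R (assign \<rho> c e) s"
    using assms(1) by (rule polyfunE) blast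
  obtain t \<sigma> d where 2: "valuation R d"
    "\<And>e. valuation R e \<Longrightarrow> g e = rterm_val R (assign \<sigma> d e) t"
    using assms(2) by (rule polyfunE) blast
  show ?thesis
    by (rule polyfunI[of "interleave c d" _ _ "interleave \<rho> \<sigma>"
          "F (rename_term s (\<lambda>i. 2 * i)) (rename_term t (\<lambda>i. Suc (2 * i)))"])
      (use 1 2 in \<open>auto simp: interleave_carrier op rterm_val_rename assign_interleave\<close>)
qed

lemma polyfun_add: "polyfun R f \<Longrightarrow> polyfun R g \<Longrightarrow> polyfun R (\<lambda>e. f e \<oplus>\<^bsub>R\<^esub> g e)"
  by (rule polyfun_binary[where F = Plus]) auto

lemma polyfun_mult: "polyfun R f \<Longrightarrow> polyfun R g \<Longrightarrow> polyfun R (\<lambda>e. f e \<otimes>\<^bsub>R\<^esub> g e)"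
  by (rule polyfun_binary[where F = Times]) auto

lemma rterm_val_closed:
  assumes "ring R" "\<And>i. e i \<in> carrier R"
  shows "rterm_val R e t \<in> carrier R"
proof -
  interpret ring R by fact
  show ?thesis by (induction t) (auto simp: assms(2))
qed

lemma polyfun_closed:
  assumes "ring R" "polyfun R f" "\<And>v. e v \<in> carrier R"
  shows "f e \<in> carrier R"
proof -
  obtain s \<rho> c where 1: "valuation R c"
    "\<And>e. valuation R e \<Longrightarrow> f e = rterm_val R (assign \<rho> c e) s"
    using assms(2) by (rule polyfunE) blast
  then show ?thesis using assms
    by (auto intro!: rterm_val_closed simp: assign_def split: option.split)
qed

lemma polyfun_subst: 
  assumes "polyfun R f"
  shows "polyfun R (\<lambda>e. f (\<lambda>v. e (\<sigma> v)))"
proof -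
  obtain s \<rho> c where 1: "valuation R c"
    "\<And>e. valuation R e \<Longrightarrow> f e = rterm_val R (assign \<rho> c e) s"
    using assms by (rule polyfunE) blast
  have "assign (\<lambda>i. map_option \<sigma> (\<rho> i)) c e = assign \<rho> c (\<lambda>v. e (\<sigma> v))" for e
    by (auto simp: assign_def fun_eq_iff split: option.split)
  with 1 show ?thesis by (intro polyfunI[of c _ _ "\<lambda>i. map_option \<sigma> (\<rho> i)" s]) auto
qed

context ring
begin

lemma polyfun_uminus: 
  assumes "polyfun R f" shows "polyfun R (\<lambda>e. \<ominus> f e)"
proof (rule polyfun_cong)
  show "polyfun R (\<lambda>e. (\<ominus> \<one>) \<otimes> f e)"
    by (intro polyfun_mult polyfun_const assms) auto
  show "(\<ominus> \<one>) \<otimes> f e = \<ominus> f e" if "valuation R e" for e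
    using polyfun_closed[OF local.ring_axioms assms] that by (simp add: l_minus)
qed

lemma polyfun_minus: "polyfun R f \<Longrightarrow> polyfun R g \<Longrightarrow> polyfun R (\<lambda>e. f e \<ominus> g e)"
  unfolding a_minus_def by (intro polyfun_add polyfun_uminus)

lemma polyfun_pow:
  assumes "polyfun R f" shows "polyfun R (\<lambda>e. f e [^] (n::nat))"
  by (induction n) (auto intro!: polyfun_const polyfun_mult assms)

lemma polyfun_finsum:
  fixes f :: "'i \<Rightarrow> ('v \<Rightarrow> 'a) \<Rightarrow> 'a"
  assumes "finite I" "\<And>i. i \<in> I \<Longrightarrow> polyfun R (f i)"
  shows "polyfun R (\<lambda>e. \<Oplus>i\<in>I. f i e)"
  using assms
proof (induction I rule: finite_induct)
  case (insert i I)
  then have "polyfun R (\<lambda>e. f i e \<oplus> (\<Oplus>i\<in>I. f i e))" by (auto intro!: polyfun_add)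
  then show ?case
  proof (rule polyfun_cong)
    fix e :: "'v \<Rightarrow> 'a" assume "valuation R e"
    then have "f j e \<in> carrier R" if "j \<in> insert i I" for j
      using that insert polyfun_closed[OF local.ring_axioms] by blast
    then show "f i e \<oplus> (\<Oplus>i\<in>I. f i e) = (\<Oplus>i\<in>insert i I. f i e)"
      using insert by (subst finsum_insert) auto
  qed
qed (auto intro: polyfun_const)

end

lemma dpred_eq:
  assumes "polyfun R f" "polyfun R g"
  shows "dpred R (\<lambda>e. f e = g e)"
proof -
  obtain s \<rho> c where 1: "valuation R c"
    "\<And>e. valuation R e \<Longrightarrow> f e = rterm_val R (assign \<rho> c e) s"
    using assms(1) by (rule polyfunE) blast
  obtain t \<sigma> d where 2: "valuation R d"
    "\<And>e. valuation R e \<Longrightarrow> g e = rterm_val R (assign \<sigma> d e) t"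
    using assms(2) by (rule polyfunE) blast
  show ?thesis
    by (rule dpredI[of "interleave c d" _ _ "interleave \<rho> \<sigma>"
          "Eq (rename_term s (\<lambda>i. 2 * i)) (rename_term t (\<lambda>i. Suc (2 * i)))"])
      (use 1 2 in \<open>auto simp: interleave_carrier rterm_val_rename assign_interleave\<close>)
qed

lemma dpred_not:
  assumes "dpred R P" shows "dpred R (\<lambda>e. \<not> P e)"
proof -
  obtain p \<rho> c where 1: "valuation R c"
    "\<And>e. valuation R e \<Longrightarrow> P e = rsat R (assign \<rho> c e) p"
    using assms by (rule dpredE) blast
  show ?thesis by (rule dpredI[of c _ _ \<rho> "Neg p"]) (use 1 in auto)
qed

lemma dpred_conj:
  assumes "dpred R P" "dpred R Q" shows "dpred R (\<lambda>e. P e \<and> Q e)"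
proof -
  obtain p \<rho> c where 1: "valuation R c"
    "\<And>e. valuation R e \<Longrightarrow> P e = rsat R (assign \<rho> c e) p"
    using assms(1) by (rule dpredE) blast
  obtain q \<sigma> d where 2: "valuation R d"
    "\<And>e. valuation R e \<Longrightarrow> Q e = rsat R (assign \<sigma> d e) q"
    using assms(2) by (rule dpredE) blast
  show ?thesis
    by (rule dpredI[of "interleave c d" _ _ "interleave \<rho> \<sigma>"
          "Conj (rename_formula p (\<lambda>i. 2 * i)) (rename_formula q (\<lambda>i. Suc (2 * i)))"])
      (use 1 2 in \<open>auto simp: interleave_carrier rsat_rename assign_interleave\<close>)
qed

lemma dpred_ball:
  fixes P :: "'i \<Rightarrow> ('v \<Rightarrow> 'a) \<Rightarrow> bool"
  assumes "ring R" "finite I" "\<And>i. i \<in> I \<Longrightarrow> dpred R (P i)"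
  shows "dpred R (\<lambda>e. \<forall>i\<in>I. P i e)"
  using assms(2,3)
proof (induction I rule: finite_induct)
  case empty
  interpret ring R by fact
  have "dpred R (\<lambda>e::'v \<Rightarrow> 'a. \<zero>\<^bsub>R\<^esub> = \<zero>\<^bsub>R\<^esub>)" by (intro dpred_eq polyfun_const) auto
  then show ?case by simp
qed (auto intro!: dpred_conj)

lemma dpred_subst:
  assumes "dpred R P" "\<And>v. c v \<in> carrier R"
  shows "dpred R (\<lambda>e. P (\<lambda>v. case \<sigma> v of None \<Rightarrow> c v | Some w \<Rightarrow> e w))"
proof -
  obtain p \<rho> d where 1: "valuation R d"
    "\<And>e. valuation R e \<Longrightarrow> P e = rsat R (assign \<rho> d e) p"
    using assms(1) by (rule dpredE) blast
  let ?\<rho> = "\<lambda>i. case \<rho> i of None \<Rightarrow> None | Some v \<Rightarrow> \<sigma> v"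
  let ?d = "\<lambda>i. case \<rho> i of None \<Rightarrow> d i | Some v \<Rightarrow> c v"
  have *: "assign ?\<rho> ?d e = assign \<rho> d (\<lambda>v. case \<sigma> v of None \<Rightarrow> c v | Some w \<Rightarrow> e w)" for e
    by (auto simp: assign_def fun_eq_iff split: option.split)
  show ?thesis
    by (rule dpredI[of ?d _ _ ?\<rho> p], unfold *)
      (use 1 assms(2) in \<open>auto split: option.split\<close>)
qed

lemma dpred_rename:
  assumes "ring R" "dpred R P"
  shows "dpred R (\<lambda>e. P (\<lambda>v. e (\<sigma> v)))"
proof -
  interpret ring R by fact
  show ?thesis using dpred_subst[OF assms(2), of "\<lambda>v. \<zero>\<^bsub>R\<^esub>" "\<lambda>v. Some (\<sigma> v)"] by simp
qed

lemma dpred_finite_support: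
  fixes P :: "('v \<Rightarrow> 'a) \<Rightarrow> bool"
  assumes "dpred R P"
  shows "\<exists>V. finite V \<and> (\<forall>e e'. valuation R e \<longrightarrow> valuation R e' \<longrightarrow>
    (\<forall>v\<in>V. e v = e' v) \<longrightarrow> P e = P e')"
proof -
  obtain p \<rho> c where 1: "valuation R c"
    "\<And>e. valuation R e \<Longrightarrow> P e = rsat R (assign \<rho> c e) p"
    using assms by (rule dpredE) blast
  obtain n where n: "\<And>e e'. (\<forall>i<n. e i = e' i) \<Longrightarrow> rsat R e p = rsat R e' p"
    using rsat_finite_support by metis
  let ?V = "{v. \<exists>i<n. \<rho> i = Some v}"
  have "?V \<subseteq> (\<lambda>i. the (\<rho> i)) ` {..<n}" by force
  then have "finite ?V" by (rule finite_subset) auto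
  moreover have "P e = P e'" if "valuation R e" "valuation R e'" 
    "\<forall>v\<in>?V. e v = e' v" for e e'
  proof -
    have "\<forall>i<n. assign \<rho> c e i = assign \<rho> c e' i"
      using that(3) by (force simp: assign_def split: option.split)
    then show ?thesis using n that 1(2) by metis
  qed
  ultimately show ?thesis by blast
qed

lemma dpred_ex_var:
  assumes "dpred R P"
  shows "dpred R (\<lambda>e. \<exists>a\<in>carrier R. P (e(v := a)))"
proof -
  obtain p \<rho> c where 1: "valuation R c"
    "\<And>e. valuation R e \<Longrightarrow> P e = rsat R (assign \<rho> c e) p"
    using assms by (rule dpredE) blast
  let ?r = "\<lambda>i. if \<rho> i = Some v then 0 else Suc i"
  have "(\<lambda>i. case_nat a (assign \<rho> c e) (?r i)) = assign \<rho> c (e(v := a))" for a e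
    by (auto simp: assign_def fun_eq_iff split: option.split)
  then show ?thesis
    by (intro dpredI[of c _ _ \<rho> "Ex (rename_formula p ?r)"]) (use 1 in \<open>auto simp: rsat_rename\<close>)
qed

lemma dpred_ex_vars:
  assumes "finite V" "dpred R P"
  shows "dpred R (\<lambda>e. \<exists>e'. valuation R e' \<and> (\<forall>v. v \<notin> V \<longrightarrow> e' v = e v) \<and> P e')"
  using assms(1)
proof (induction V rule: finite_induct)
  case empty
  show ?case by (rule dpred_cong[OF assms(2)]) (simp flip: fun_eq_iff)
next
  case (insert w V)
  show ?case
  proof (rule dpred_cong[OF dpred_ex_var[OF insert.IH, of w]], safe)
    fix e e' a assume "valuation R e" "a \<in> carrier R" "valuation R e'"
      "\<forall>v. v \<notin> V \<longrightarrow> e' v = (e(w := a)) v" "P e'"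
    then show "\<exists>e'. valuation R e' \<and> (\<forall>v. v \<notin> insert w V \<longrightarrow> e' v = e v) \<and> P e'"
      by (intro exI[of _ e']) auto
  next
    fix e e' assume "valuation R e" "valuation R e'"
      "\<forall>v. v \<notin> insert w V \<longrightarrow> e' v = e v" "P e'"
    then show "\<exists>a\<in>carrier R. \<exists>e'. valuation R e' \<and> 
      (\<forall>v. v \<notin> V \<longrightarrow> e' v = (e(w := a)) v) \<and> P e'"
      by (intro bexI[of _ "e' w"] exI[of _ e']) auto
  qed
qed

text \<open>
  Since a formula only sees finitely many variables, a whole infinite block of variables may be
  quantified away.
\<close>

lemma dpred_ex_block:
  fixes P :: "('u + 'v \<Rightarrow> 'a) \<Rightarrow> bool"
  assumes "ring R" "dpred R P"
  shows "dpred R (\<lambda>e. \<exists>s. valuation R s \<and> P (case_sum s e))"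
proof -
  interpret ring R by fact
  obtain V where V: "finite V" "\<And>e e'. valuation R e \<Longrightarrow> valuation R e' \<Longrightarrow>
    (\<forall>v\<in>V. e v = e' v) \<Longrightarrow> P e = P e'"
    using dpred_finite_support[OF assms(2)] by blast
  let ?V = "V \<inter> range Inl"
  let ?z = "\<lambda>e. \<lambda>v. case (case_sum (\<lambda>u. None) Some v) of None \<Rightarrow> \<zero>\<^bsub>R\<^esub> | Some w \<Rightarrow> e w"
  have "dpred R (\<lambda>e. \<exists>e'. valuation R e' \<and> (\<forall>v. v \<notin> ?V \<longrightarrow> e' v = e v) \<and> P e')"
    using V(1) assms(2) by (intro dpred_ex_vars) auto
  from dpred_subst[OF this, of "\<lambda>v. \<zero>\<^bsub>R\<^esub>" "case_sum (\<lambda>u. None) Some"]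
  have "dpred R (\<lambda>e. \<exists>e'. valuation R e' \<and> (\<forall>v. v \<notin> ?V \<longrightarrow> e' v = ?z e v) \<and> P e')"
    by simp
  then show ?thesis
  proof (rule dpred_cong, safe)
    fix e :: "'v \<Rightarrow> 'a" and e' assume A: "valuation R e" "valuation R e'" "P e'"
      "\<forall>v. v \<notin> ?V \<longrightarrow> e' v = ?z e v"
    have "case_sum (\<lambda>u. e' (Inl u)) e v = e' v" for v
      using A(4)[rule_format, of v] by (cases v) (auto simp: image_iff)
    then have "case_sum (\<lambda>u. e' (Inl u)) e = e'" by blast
    with A show "\<exists>s. valuation R s \<and> P (case_sum s e)"
      by (intro exI[of _ "\<lambda>u. e' (Inl u)"]) auto
  next
    fix e :: "'v \<Rightarrow> 'a" and s assume A: "valuation R e" "valuation R s"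
      "P (case_sum s e)"
    let ?e = "\<lambda>v. if v \<in> ?V then case_sum s e v else ?z e v"
    have c: "valuation R ?e" "\<forall>v. case_sum s e v \<in> carrier R"
      using A by (auto split: sum.split)
    have "\<forall>v\<in>V. case_sum s e v = ?e v" by (auto split: sum.split)
    then have "P ?e" using V(2)[OF c(2,1)] A(3) by blast
    with c show "\<exists>e'. valuation R e' \<and> (\<forall>v. v \<notin> ?V \<longrightarrow> e' v = ?z e v) \<and> P e'"
      by (intro exI[of _ ?e]) auto
  qed
qed

lemma dpred_ex_element:
  fixes P :: "(nat \<Rightarrow> 'a) \<Rightarrow> bool"
  assumes "ring R" "dpred R P"
  shows "dpred R (\<lambda>e. \<exists>a\<in>carrier R. P (case_nat a e))"
proof -
  interpret ring R by fact
  have "dpred R (\<lambda>e. P (\<lambda>i. e (case_nat (Inl ()) Inr i)))" by (rule dpred_rename[OF assms])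
  from dpred_ex_block[OF assms(1) this] show ?thesis
  proof (rule dpred_cong)
    fix e :: "nat \<Rightarrow> 'a"
    have "(\<lambda>i. case_sum s e (case i of 0 \<Rightarrow> Inl () | Suc x \<Rightarrow> Inr x)) = case_nat (s ()) e" for s
      by (auto simp: fun_eq_iff split: nat.split)
    then show "(\<exists>s. valuation R s \<and>
        P (\<lambda>i. case_sum s e (case i of 0 \<Rightarrow> Inl () | Suc x \<Rightarrow> Inr x))) =
      (\<exists>a\<in>carrier R. P (case_nat a e))"
      by (auto intro: exI[of _ "\<lambda>_. _"])
  qed
qed

subsection \<open>Comparison with definable sets of tuples\<close>

text \<open>
  Only the first \<open>n\<close> variables range over the tuple, and the remaining
  ones are frozen at an arbitrary value \<open>c\<close>, so they join the parameters.
\<close>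

lemma dpred_imp_definable:
  assumes "dpred R P" "c \<in> carrier R"
  shows "definable R n {xs \<in> tuples R n. P (\<lambda>i. if i < n then xs ! i else c)}"
proof -
  obtain p \<rho> d where 1: "valuation R d"
    "\<And>e. valuation R e \<Longrightarrow> P e = rsat R (assign \<rho> d e) p"
    using assms(1) by (rule dpredE) blast
  let ?r = "\<lambda>i. case \<rho> i of None \<Rightarrow> n + i | Some v \<Rightarrow> if v < n then v else n + i"
  let ?e = "\<lambda>i. case \<rho> (i - n) of None \<Rightarrow> d (i - n) | Some v \<Rightarrow> c"
  show ?thesis unfolding definable_def
  proof (intro exI[of _ "rename_formula p ?r"] exI[of _ ?e] conjI)
    show "valuation R ?e" using 1 assms(2) by (auto split: option.split)
    have "P (\<lambda>i. if i < n then xs ! i else c) =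
      rsat R (\<lambda>i. if i < n then xs ! i else ?e i) (rename_formula p ?r)" if "xs \<in> tuples R n" for xs
    proof -
      have "\<forall>i. (if i < n then xs ! i else c) \<in> carrier R"
        using that assms(2) by (auto simp: tuples_def)
      moreover have "assign \<rho> d (\<lambda>i. if i < n then xs ! i else c) =
        (\<lambda>i. (if ?r i < n then xs ! ?r i else ?e (?r i)))"
        by (auto simp: assign_def fun_eq_iff split: option.split)
      ultimately show ?thesis using 1(2) by (simp add: rsat_rename)
    qed
    then show "{xs \<in> tuples R n. P (\<lambda>i. if i < n then xs ! i else c)} =
      {xs \<in> tuples R n. rsat R (\<lambda>i. if i < n then xs ! i else ?e i) (rename_formula p ?r)}"
      by blast
  qed
qed

lemma definable_imp_dpred:
  assumes "definable R n S"
  shows "dpred R (\<lambda>e. map e [0..<n] \<in> S)"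
proof -
  obtain p c where 1: "valuation R c"
    "S = {xs \<in> tuples R n. rsat R (\<lambda>i. if i < n then xs ! i else c i) p}"
    using assms unfolding definable_def by blast
  show ?thesis
  proof (rule dpredI[of c _ _ "\<lambda>i. if i < n then Some i else None" p])
    fix e :: "nat \<Rightarrow> 'a" assume "valuation R e"
    then have "map e [0..<n] \<in> tuples R n" by (auto simp: tuples_def)
    moreover have "(\<lambda>i. if i < n then map e [0..<n] ! i else c i) =
      assign (\<lambda>i. if i < n then Some i else None) c e"
      by (auto simp: assign_def fun_eq_iff)
    ultimately show "(map e [0..<n] \<in> S) =
      rsat R (assign (\<lambda>i. if i < n then Some i else None) c e) p"
      using 1(2) by simp
  qed (use 1 in auto)
qed

section \<open>Tame surjections\<close>

text \<open>
  The relation \<open>R a y\<close> is the graph of a partial surjection from \<open>A\<^sup>m\<close> onto \<open>B\<close>. A code \<open>a\<close> is an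
  infinite sequence of which only the first \<open>m\<close> entries count; this avoids arithmetic with tuple
  lengths until the very end. Definability is required over \<open>B\<close>, after pulling the code back
  along \<open>h\<close>; the value sits at index \<open>0\<close> and the code behind it.
\<close>

definition codes ::
  "('a, 'x) ring_scheme \<Rightarrow> ('b, 'y) ring_scheme \<Rightarrow> ('a \<Rightarrow> 'b) \<Rightarrow> nat \<Rightarrow> ((nat \<Rightarrow> 'b) \<Rightarrow> 'a \<Rightarrow> bool) \<Rightarrow> bool"
where
  "codes B A h m R \<longleftrightarrow>
     (\<forall>a a' y. (\<forall>i<m. a i = a' i) \<longrightarrow> R a y = R a' y) \<and>
     (\<forall>y\<in>carrier B. \<exists>a. valuation A a \<and> R a y) \<and>
     (\<forall>a. \<forall>y\<in>carrier B. \<forall>y'\<in>carrier B. valuation A a \<longrightarrow> R a y \<longrightarrow> R a y' \<longrightarrow> y = y') \<and>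
     dpred B (\<lambda>e. R (\<lambda>i. h (e (Suc i))) (e 0))"

lemma codesD:
  assumes "codes B A h m R"
  shows "\<And>a a' y. (\<forall>i<m. a i = a' i) \<Longrightarrow> R a y = R a' y"
    and "\<And>y. y \<in> carrier B \<Longrightarrow> \<exists>a. valuation A a \<and> R a y"
    and "\<And>a y y'. y \<in> carrier B \<Longrightarrow> y' \<in> carrier B \<Longrightarrow> valuation A a \<Longrightarrow>
      R a y \<Longrightarrow> R a y' \<Longrightarrow> y = y'"
    and "dpred B (\<lambda>e. R (\<lambda>i. h (e (Suc i))) (e 0))"
  using assms unfolding codes_def by simp_all

text \<open>
  Bi-interpretability only depends on how \<open>h\<close> moves definable sets. The assumption on preimages is stated for formulas without parameters;
  \<open>preimage_any\<close> adds parameters by lifting them along \<open>h\<close>.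
\<close>

locale tame_surjection = dom: ring B + cod: ring A
  for B :: "('a, 'x) ring_scheme" and A :: "('b, 'y) ring_scheme" +
  fixes h :: "'a \<Rightarrow> 'b"
  assumes surj: "h ` carrier B = carrier A"
    and preimage: "\<And>p. dpred B (\<lambda>e. rsat A (\<lambda>i. h (e i)) p)"
    and image: "\<And>Q :: (nat \<Rightarrow> 'a) \<Rightarrow> bool. dpred B Q \<Longrightarrow>
      dpred A (\<lambda>a. \<exists>e. valuation B e \<and> (\<forall>i. h (e i) = a i) \<and> Q e)"
    and coding: "\<exists>m R. codes B A h m R"
begin

lemma h_closed [simp, intro]: "x \<in> carrier B \<Longrightarrow> h x \<in> carrier A"
  using surj by blast

lemma lift_env:
  assumes "valuation A a"
  obtains e where "valuation B e" "\<forall>i. h (e i) = a i"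
proof -
  have "\<forall>i. \<exists>x. x \<in> carrier B \<and> h x = a i"
  proof
    fix i
    have "a i \<in> h ` carrier B" using assms surj by simp
    then show "\<exists>x. x \<in> carrier B \<and> h x = a i" by auto
  qed
  then obtain e where "\<forall>i. e i \<in> carrier B \<and> h (e i) = a i" by (rule choice[THEN exE])
  then show thesis by (intro that[of e]) auto
qed

lemma preimage_any:
  assumes "dpred A P"
  shows "dpred B (\<lambda>e. P (\<lambda>v. h (e v)))"
proof -
  obtain p \<rho> c where 1: "valuation A c"
    "\<And>e. valuation A e \<Longrightarrow> P e = rsat A (assign \<rho> c e) p"
    using assms by (rule dpredE) blast
  obtain d where d: "valuation B d" "\<forall>i. h (d i) = c i" using 1(1) by (rule lift_env)
  have "dpred B (\<lambda>e. rsat A (\<lambda>i. h (case \<rho> i of None \<Rightarrow> d i | Some v \<Rightarrow> e v)) p)"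
    using dpred_subst[OF preimage, of d \<rho>] d by simp
  then show ?thesis
  proof (rule dpred_cong)
    fix e :: "'c \<Rightarrow> 'a" assume e: "valuation B e"
    have "(\<lambda>i. h (case \<rho> i of None \<Rightarrow> d i | Some v \<Rightarrow> e v)) = assign \<rho> c (\<lambda>v. h (e v))"
      using d by (auto simp: assign_def fun_eq_iff split: option.split)
    then show "rsat A (\<lambda>i. h (case \<rho> i of None \<Rightarrow> d i | Some v \<Rightarrow> e v)) p = P (\<lambda>v. h (e v))"
      using 1(2)[of "\<lambda>v. h (e v)"] e by simp
  qed
qed

end

text \<open>
  To code an element of \<open>B\<close> over \<open>A\<close>, code it over \<open>C\<close> by \<open>s\<^sub>0, \<dots>, s\<^bsub>m-1\<^esub>\<close> and then code every \<open>s\<^sub>i\<close>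
  over \<open>A\<close> by \<open>n\<close> elements; the code of \<open>s\<^sub>i\<close> occupies the positions \<open>i n, \<dots>, i n + n - 1\<close>.
\<close>

lemma tame_surjection_comp:
  fixes B :: "('a, 'x) ring_scheme" and C :: "('c, 'z) ring_scheme" and A :: "('b, 'y) ring_scheme"
  assumes "tame_surjection B C h" "tame_surjection C A k"
  shows "tame_surjection B A (\<lambda>x. k (h x))"
proof -
  interpret f: tame_surjection B C h by fact
  interpret g: tame_surjection C A k by fact
  show ?thesis
  proof unfold_locales
    show "(\<lambda>x. k (h x)) ` carrier B = carrier A"
      using f.surj g.surj by (simp flip: image_image)
  next
    fix p
    from f.preimage_any[OF g.preimage] show "dpred B (\<lambda>e. rsat A (\<lambda>i. k (h (e i))) p)" .
  next
    fix Q :: "(nat \<Rightarrow> 'a) \<Rightarrow> bool" assume "dpred B Q"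
    from g.image[OF f.image[OF this]]
    show "dpred A (\<lambda>a. \<exists>e. valuation B e \<and> (\<forall>i. k (h (e i)) = a i) \<and> Q e)"
    proof (rule dpred_cong)
      fix a :: "nat \<Rightarrow> 'b"
      show "(\<exists>c. valuation C c \<and> (\<forall>i. k (c i) = a i) \<and>
          (\<exists>e. valuation B e \<and> (\<forall>i. h (e i) = c i) \<and> Q e)) =
        (\<exists>e. valuation B e \<and> (\<forall>i. k (h (e i)) = a i) \<and> Q e)" (is "?L = ?R")
      proof
        assume ?L
        then obtain e where "valuation B e" "\<forall>i. k (h (e i)) = a i" "Q e" by auto
        then show ?R by blast
      next
        assume ?R
        then obtain e where "valuation B e" "\<forall>i. k (h (e i)) = a i" "Q e" by blast
        then show ?L by (intro exI[of _ "\<lambda>i. h (e i)"]) auto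
      qed
    qed
  next
    obtain m R where Rc: "codes B C h m R" using f.coding by blast
    note R = codesD[OF Rc]
    obtain n S where Sc: "codes C A k n S" using g.coding by blast
    note S = codesD[OF Sc]
    define T where "T a y \<longleftrightarrow>
      (\<exists>s. valuation C s \<and> R s y \<and> (\<forall>i\<in>{..<m}. S (\<lambda>j. a (i * n + j)) (s i)))" for a y
    show "\<exists>m R. codes B A (\<lambda>x. k (h x)) m R"
      unfolding codes_def
    proof (rule exI[of _ "m * n"], rule exI[of _ T], intro conjI allI ballI impI)
      fix a a' :: "nat \<Rightarrow> 'b" and y assume eq: "\<forall>i<m * n. a i = a' i"
      have "S (\<lambda>j. a (i * n + j)) = S (\<lambda>j. a' (i * n + j))" if "i < m" for i
      proof -
        have "i * n + j < m * n" if "j < n" for j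
        proof -
          have "i * n + j < Suc i * n" using that by simp
          also have "\<dots> \<le> m * n" using \<open>i < m\<close> by (intro mult_le_mono1) simp
          finally show ?thesis .
        qed
        then show ?thesis using eq by (intro ext S(1)) auto
      qed
      then show "T a y = T a' y" unfolding T_def by simp
    next
      fix y assume "y \<in> carrier B"
      then obtain s where s: "valuation C s" "R s y" using R(2) by blast
      have "\<forall>i. \<exists>t. valuation A t \<and> S t (s i)" using S(2) s by blast
      then obtain t where t: "\<And>i j. t i j \<in> carrier A" "\<And>i. S (t i) (s i)" by metis
      let ?a = "\<lambda>l. t (l div n) (l mod n)"
      have "S (\<lambda>j. ?a (i * n + j)) (s i)" for i
      proof -
        have "S (\<lambda>j. ?a (i * n + j)) (s i) = S (t i) (s i)"
          by (rule S(1)) (auto simp: add.commute)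
        then show ?thesis using t by simp
      qed
      then show "\<exists>a. valuation A a \<and> T a y"
        unfolding T_def using s t by (intro exI[of _ ?a]) blast
    next
      fix a y y' assume A: "y \<in> carrier B" "y' \<in> carrier B" "valuation A a" "T a y" "T a y'"
      obtain s where s: "valuation C s" "R s y" "\<forall>i\<in>{..<m}. S (\<lambda>j. a (i * n + j)) (s i)"
        using A(4) unfolding T_def by blast
      obtain s' where s': "valuation C s'" "R s' y'"
        "\<forall>i\<in>{..<m}. S (\<lambda>j. a (i * n + j)) (s' i)"
        using A(5) unfolding T_def by blast
      have "s i = s' i" if "i < m" for i
        using S(3)[of "s i" "s' i" "\<lambda>j. a (i * n + j)"] s s' A(3) that by blast
      then have "R s' y = R s y" by (intro R(1)) auto
      then show "y = y'" using R(3)[of y y' s'] A s s' by blast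
    next
      let ?r = "\<lambda>i. case i of 0 \<Rightarrow> Inr 0 | Suc i \<Rightarrow> Inl i"
      have "dpred B (\<lambda>e. R (\<lambda>i. h (e (?r (Suc i)))) (e (?r 0)))"
        by (rule dpred_rename[OF f.dom.ring_axioms R(4), of ?r])
      then have 1: "dpred B (\<lambda>e. R (\<lambda>i. h (e (Inl i))) (e (Inr 0)))" by simp
      have 2: "dpred B (\<lambda>e. S (\<lambda>j. k (h (e (Inr (Suc (i * n + j)))))) (h (e (Inl i))))" for i
      proof -
        let ?q = "\<lambda>l. case l of 0 \<Rightarrow> Inl i | Suc j \<Rightarrow> Inr (Suc (i * n + j))"
        have "dpred B (\<lambda>e. S (\<lambda>j. k (h (e (?q (Suc j))))) (h (e (?q 0))))"
          by (rule dpred_rename[OF f.dom.ring_axioms f.preimage_any[OF S(4)], of ?q])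
        then show ?thesis by simp
      qed
      have "dpred B (\<lambda>e. R (\<lambda>i. h (e (Inl i))) (e (Inr 0)) \<and>
        (\<forall>i\<in>{..<m}. S (\<lambda>j. k (h (e (Inr (Suc (i * n + j)))))) (h (e (Inl i)))))"
        by (intro dpred_conj 1 dpred_ball[OF f.dom.ring_axioms] 2) auto
      from dpred_ex_block[OF f.dom.ring_axioms this]
      show "dpred B (\<lambda>e. T (\<lambda>i. k (h (e (Suc i)))) (e 0))"
      proof (rule dpred_cong)
        fix e :: "nat \<Rightarrow> 'a" assume e: "valuation B e"
        show "(\<exists>s. valuation B s \<and> R (\<lambda>i. h (case_sum s e (Inl i))) (case_sum s e (Inr 0)) \<and>
          (\<forall>i\<in>{..<m}. S (\<lambda>j. k (h (case_sum s e (Inr (Suc (i * n + j))))))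
             (h (case_sum s e (Inl i))))) = T (\<lambda>i. k (h (e (Suc i)))) (e 0)" (is "?L = ?R")
        proof
          assume ?L
          then obtain s where "valuation B s" "R (\<lambda>i. h (s i)) (e 0)"
            "\<forall>i\<in>{..<m}. S (\<lambda>j. k (h (e (Suc (i * n + j))))) (h (s i))" by auto
          then show ?R unfolding T_def by (intro exI[of _ "\<lambda>i. h (s i)"]) auto
        next
          assume ?R
          then obtain s where s: "valuation C s" "R s (e 0)"
            "\<forall>i\<in>{..<m}. S (\<lambda>j. k (h (e (Suc (i * n + j))))) (s i)" unfolding T_def by blast
          obtain s' where s': "valuation B s'" "\<forall>i. h (s' i) = s i"
            using s(1) by (rule f.lift_env)
          with s show ?L by (intro exI[of _ s']) auto
        qed
      qed
    qed
  qed
qed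

lemma concat_blocks:
  assumes "length zs = m * n" shows "concat (blocks m n zs) = zs"
  using assms
proof (induction n arbitrary: zs)
  case (Suc n)
  have "blocks m (Suc n) zs = take m zs # blocks m n (drop m zs)"
    by (simp add: blocks_def upt_conv_Cons map_Suc_upt[symmetric] comp_def add.commute del: upt_Suc)
  then show ?case using Suc by simp
qed (simp add: blocks_def)

lemma blocks_one: "length zs = n \<Longrightarrow> blocks 1 n zs = map (\<lambda>x. [x]) zs"
  by (rule nth_equalityI) (auto simp: blocks_def take_Suc_conv_app_nth hd_drop_conv_nth take_Suc)

definition unary_map :: "('a, 'x) ring_scheme \<Rightarrow> ('a \<Rightarrow> 'b) \<Rightarrow> ('a, 'b) tuple_map" where
  "unary_map B h = \<lparr> arity = 1, source = tuples B 1, to_fun = (\<lambda>xs. h (hd xs)) \<rparr>"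

lemma tuples_1: "tuples R 1 = {[x] | x. x \<in> carrier R}"
  by (auto simp: tuples_def length_Suc_conv)

lemma tuple_preimage_unary:
  "tuple_preimage (unary_map B h) n S = {xs \<in> tuples B n. map h xs \<in> S}"
proof safe
  fix zs assume "zs \<in> tuple_preimage (unary_map B h) n S"
  then obtain xss where zs: "zs = concat xss" "length xss = n" 
    "set xss \<subseteq> {[x] | x. x \<in> carrier B}" "map (\<lambda>xs. h (hd xs)) xss \<in> S"
    unfolding tuple_preimage_def unary_map_def tuples_1 by auto
  have "xss = map (\<lambda>x. [x]) (map hd xss)" using zs(3) by (induction xss) auto
  then have "zs = map hd xss" using zs(1) concat_map_singleton[of "\<lambda>x. x" "map hd xss"] by simp
  moreover have "\<forall>xs \<in> set xss. hd xs \<in> carrier B" using zs(3) by auto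
  ultimately show "zs \<in> tuples B n" "map h zs \<in> S" using zs by (auto simp: tuples_def comp_def)
next
  fix zs assume "zs \<in> tuples B n" "map h zs \<in> S"
  then show "zs \<in> tuple_preimage (unary_map B h) n S"
    unfolding tuple_preimage_def unary_map_def tuples_1
    by (intro CollectI exI[of _ "map (\<lambda>x. [x]) zs"]) (auto simp: tuples_def comp_def dest: subsetD)
qed

context tame_surjection
begin

lemma unary_interpretation: "interpretation_of B A (unary_map B h)"
  unfolding interpretation_of_def
proof (intro conjI allI impI)
  show "to_fun (unary_map B h) ` source (unary_map B h) = carrier A"
    by (simp add: unary_map_def tuples_1[unfolded One_nat_def] Setcompr_eq_image image_image surj)
  fix n S assume S: "definable A n S"
  let ?e = "\<lambda>xs i. if i < n then xs ! i else \<zero>\<^bsub>B\<^esub>"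
  have "dpred B (\<lambda>e. map (\<lambda>i. h (e i)) [0..<n] \<in> S)"
    by (rule preimage_any[OF definable_imp_dpred[OF S]])
  from dpred_imp_definable[OF this dom.zero_closed, of n]
  have "definable B n {xs \<in> tuples B n. map (\<lambda>i. h (?e xs i)) [0..<n] \<in> S}" .
  also have "{xs \<in> tuples B n. map (\<lambda>i. h (?e xs i)) [0..<n] \<in> S} =
    {xs \<in> tuples B n. map h xs \<in> S}"
  proof -
    have "map (\<lambda>i. h (?e xs i)) [0..<n] = map h xs" if "xs \<in> tuples B n" for xs
      using that by (auto simp: tuples_def intro!: nth_equalityI)
    then show ?thesis by auto
  qed
  finally show "definable B (arity (unary_map B h) * n) (tuple_preimage (unary_map B h) n S)"
    unfolding tuple_preimage_unary by (simp add: unary_map_def)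
qed (auto simp: unary_map_def)

text \<open>
  The decoding map is the interpretation of \<open>B\<close> in \<open>A\<close>, and \<open>h\<close> is the one of \<open>A\<close> in \<open>B\<close>. Every set
  that has to be definable in \<open>A\<close> is obtained by stating its defining condition about lifts in \<open>B\<close>,
  where decoding is definable, and taking the image under \<open>h\<close>.
\<close>

theorem bi_interpretable_image: "bi_interpretable A B"
proof -
  obtain m R where Rc: "codes B A h m R" using coding by blast
    note R = codesD[OF Rc]
  \<comment> \<open>Tuples are padded with zeros, because codes are infinite sequences.\<close>
  define ev where "ev xs = (\<lambda>i. if i < length xs then xs ! i else \<zero>\<^bsub>A\<^esub>)" for xs
  define M where "M = {xs \<in> tuples A m. \<exists>y\<in>carrier B. R (ev xs) y}"
  define decode where "decode xs = (THE y. y \<in> carrier B \<and> R (ev xs) y)" for xs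
  define f where "f = \<lparr> arity = m, source = M, to_fun = decode \<rparr>"
  let ?g = "unary_map B h"
  have ev: "\<forall>i. ev xs i \<in> carrier A" if "xs \<in> tuples A n" for xs n
    using that by (auto simp: ev_def tuples_def)
  have decodeI: "decode xs = y" if "xs \<in> tuples A m" "y \<in> carrier B" "R (ev xs) y" for xs y
    unfolding decode_def using that R(3) ev[OF that(1)] by (intro the_equality) blast+
  have decode: "decode xs \<in> carrier B" "R (ev xs) (decode xs)" if "xs \<in> M" for xs
    using that decodeI unfolding M_def by auto
  have MI: "xs \<in> M" if "xs \<in> tuples A m" "y \<in> carrier B" "R (ev xs) y" for xs y
    using that unfolding M_def by blast

  have interp: "interpretation_of A B f"
    unfolding interpretation_of_def
  proof (intro conjI allI impI)
    show "source f \<subseteq> tuples A (arity f)" by (auto simp: f_def M_def)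
    show "to_fun f ` source f = carrier B"
    proof (safe)
      fix xs assume "xs \<in> source f"
      then show "to_fun f xs \<in> carrier B" using decode by (auto simp: f_def)
    next
      fix y assume y: "y \<in> carrier B"
      then obtain a where a: "valuation A a" "R a y" using R(2) by blast
      let ?xs = "map a [0..<m]"
      have "R (ev ?xs) y = R a y" by (rule R(1)) (auto simp: ev_def)
      moreover have "?xs \<in> tuples A m" using a by (auto simp: tuples_def)
      ultimately have "?xs \<in> M" "decode ?xs = y" using MI decodeI a y by auto
      then show "y \<in> to_fun f ` source f" by (force simp: f_def)
    qed
    fix n S assume S: "definable B n S"
    let ?P = "\<lambda>a. \<exists>ys. valuation B ys \<and>
      (\<forall>i\<in>{..<n}. R (\<lambda>j. a (m * i + j)) (ys i)) \<and> map ys [0..<n] \<in> S"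
    have "dpred A ?P"
    proof -
      have 1: "dpred B (\<lambda>e. R (\<lambda>j. h (e (Inr (m * i + j)))) (e (Inl i)))" for i
      proof -
        let ?q = "\<lambda>l. case l of 0 \<Rightarrow> Inl i | Suc j \<Rightarrow> Inr (m * i + j)"
        have "dpred B (\<lambda>e. R (\<lambda>j. h (e (?q (Suc j)))) (e (?q 0)))"
          by (rule dpred_rename[OF dom.ring_axioms R(4), of ?q])
        then show ?thesis by simp
      qed
      have 2: "dpred B (\<lambda>e. map (\<lambda>i. e (Inl i)) [0..<n] \<in> S)"
        by (rule dpred_rename[OF dom.ring_axioms definable_imp_dpred[OF S]])
      have "dpred B (\<lambda>e. (\<forall>i\<in>{..<n}. R (\<lambda>j. h (e (Inr (m * i + j)))) (e (Inl i))) \<and>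
          map (\<lambda>i. e (Inl i)) [0..<n] \<in> S)"
        by (intro dpred_conj 2 dpred_ball[OF dom.ring_axioms] 1) auto
      from image[OF dpred_ex_block[OF dom.ring_axioms this]]
      show ?thesis
      proof (rule dpred_cong)
        fix a :: "nat \<Rightarrow> 'b" assume a: "valuation A a"
        then obtain e where e: "valuation B e" "\<forall>i. h (e i) = a i" by (rule lift_env)
        show "(\<exists>e. valuation B e \<and> (\<forall>i. h (e i) = a i) \<and>
          (\<exists>s. valuation B s \<and>
            (\<forall>i\<in>{..<n}. R (\<lambda>j. h (case_sum s e (Inr (m * i + j)))) (case_sum s e (Inl i))) \<and>
            map (\<lambda>i. case_sum s e (Inl i)) [0..<n] \<in> S)) = ?P a" (is "?L = _")
        proof
          assume ?L
          then obtain e s where "\<forall>i. h (e i) = a i" "valuation B s"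
            "\<forall>i\<in>{..<n}. R (\<lambda>j. h (e (m * i + j))) (s i)" "map s [0..<n] \<in> S" by auto
          then show "?P a" by (intro exI[of _ s]) auto
        next
          assume "?P a"
          then obtain s where "valuation B s"
            "\<forall>i\<in>{..<n}. R (\<lambda>j. a (m * i + j)) (s i)" "map s [0..<n] \<in> S" by blast
          with e show ?L by (intro exI[of _ e] conjI exI[of _ s]) auto
        qed
      qed
    qed
    from dpred_imp_definable[OF this cod.zero_closed, of "m * n"]
    have "definable A (m * n)
      {zs \<in> tuples A (m * n). ?P (\<lambda>i. if i < m * n then zs ! i else \<zero>\<^bsub>A\<^esub>)}" .
    also have "{zs \<in> tuples A (m * n). ?P (\<lambda>i. if i < m * n then zs ! i else \<zero>\<^bsub>A\<^esub>)} =
      tuple_preimage f n S"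
    proof -
      have block: "blocks m n zs ! i \<in> tuples A m"
        "R (\<lambda>j. if m * i + j < m * n then zs ! (m * i + j) else \<zero>\<^bsub>A\<^esub>) =
         R (ev (blocks m n zs ! i))"
        if "zs \<in> tuples A (m * n)" "i < n" for zs i
      proof -
        have le: "m * i + m \<le> m * n" using that(2) by (metis Suc_leI mult_Suc_right mult_le_mono2 add.commute)
        have len: "length zs = m * n" using that(1) by (simp add: tuples_def)
        have b: "blocks m n zs ! i = take m (drop (m * i) zs)"
          using that(2) by (simp add: blocks_def)
        show 1: "blocks m n zs ! i \<in> tuples A m"
          using that(1) le len unfolding b tuples_def
          by (auto dest!: in_set_takeD in_set_dropD)
        show "R (\<lambda>j. if m * i + j < m * n then zs ! (m * i + j) else \<zero>\<^bsub>A\<^esub>) =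
         R (ev (blocks m n zs ! i))"
          using le add_leD1[OF le] len 1 by (intro ext R(1)) (auto simp: ev_def b tuples_def)
      qed
      show ?thesis
      proof (intro equalityI subsetI)
        fix zs assume "zs \<in> {zs \<in> tuples A (m * n). ?P (\<lambda>i. if i < m * n then zs ! i else \<zero>\<^bsub>A\<^esub>)}"
        then obtain ys where zs: "zs \<in> tuples A (m * n)" and ys: "valuation B ys"
          "\<forall>i\<in>{..<n}. R (\<lambda>j. if m * i + j < m * n then zs ! (m * i + j) else \<zero>\<^bsub>A\<^esub>) (ys i)"
          "map ys [0..<n] \<in> S" by blast
        let ?xss = "blocks m n zs"
        have l: "length ?xss = n" by (simp add: blocks_def)
        have *: "?xss ! i \<in> M" "decode (?xss ! i) = ys i" if "i < n" for i
        proof -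
          have "R (\<lambda>j. if m * i + j < m * n then zs ! (m * i + j) else \<zero>\<^bsub>A\<^esub>) (ys i)"
            using ys(2) that by blast
          then have "R (ev (?xss ! i)) (ys i)" by (simp only: block(2)[OF zs that])
          then show "?xss ! i \<in> M" "decode (?xss ! i) = ys i"
            using MI decodeI block(1)[OF zs that] ys(1) by blast+
        qed
        have "set ?xss \<subseteq> M" using * l by (auto simp: in_set_conv_nth)
        moreover have "map decode ?xss = map ys [0..<n]"
          using * l by (intro nth_equalityI) auto
        moreover have "concat ?xss = zs" using zs by (intro concat_blocks) (simp add: tuples_def)
        ultimately show "zs \<in> tuple_preimage f n S"
          unfolding tuple_preimage_def f_def using l ys(3)
          by (intro CollectI exI[of _ ?xss]) auto
      next
        fix zs assume "zs \<in> tuple_preimage f n S"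
        then obtain xss where xss: "zs = concat xss" "length xss = n" "set xss \<subseteq> M"
          "map decode xss \<in> S" unfolding tuple_preimage_def f_def by auto
        have len: "length xs = m" if "xs \<in> set xss" for xs
          using that xss(3) by (auto simp: M_def tuples_def)
        have zs: "zs \<in> tuples A (m * n)"
        proof -
          have "length zs = n * m" using xss(1,2) len
            by (induction xss arbitrary: zs n) auto
          moreover have "set zs \<subseteq> carrier A" using xss(1,3) by (auto simp: M_def tuples_def)
          ultimately show ?thesis by (simp add: tuples_def mult.commute)
        qed
        have bl: "blocks m n zs = xss" unfolding xss(1) by (rule blocks_concat[OF xss(2) len])
        let ?ys = "\<lambda>i. if i < n then decode (xss ! i) else \<zero>\<^bsub>B\<^esub>"
        have mem: "xss ! i \<in> M" if "i < n" for i
          using xss(3) nth_mem[of i xss] that unfolding xss(2) by blast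
        have "R (\<lambda>j. if m * i + j < m * n then zs ! (m * i + j) else \<zero>\<^bsub>A\<^esub>) (?ys i)"
          if "i < n" for i
          using decode(2)[OF mem[OF that]] that unfolding block(2)[OF zs that] bl by simp
        moreover have "valuation B ?ys" using decode(1) mem by simp
        moreover have "map ?ys [0..<n] = map decode xss" using xss(2)
          by (intro nth_equalityI) auto
        ultimately show "zs \<in> {zs \<in> tuples A (m * n). 
            ?P (\<lambda>i. if i < m * n then zs ! i else \<zero>\<^bsub>A\<^esub>)}"
          using zs xss(4) by (intro CollectI conjI exI[of _ ?ys]) auto
      qed
    qed
    finally show "definable A (arity f * n) (tuple_preimage f n S)" by (simp add: f_def)
  qed

  have pre1: "tuple_preimage f 1 (tuples B 1) = M"
  proof safe
    fix zs assume "zs \<in> tuple_preimage f 1 (tuples B 1)"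
    then show "zs \<in> M" by (auto simp: tuple_preimage_def f_def length_Suc_conv)
  next
    fix zs assume "zs \<in> M"
    then show "zs \<in> tuple_preimage f 1 (tuples B 1)"
      using decode by (auto simp: tuple_preimage_def f_def tuples_1[unfolded One_nat_def] intro!: exI[of _ "[zs]"])
  qed
  \<comment> \<open>An element \<open>w\<close> equals \<open>h (decode x)\<close> iff some lift of \<open>w\<close> is decoded from lifts of \<open>x\<close>.\<close>
  have homA: "homotopic A (tuple_map_comp ?g f) (tuple_map_id A)"
  proof -
    let ?q = "\<lambda>l. case l of 0 \<Rightarrow> m | Suc j \<Rightarrow> j"
    have "dpred B (\<lambda>e. R (\<lambda>j. h (e (?q (Suc j)))) (e (?q 0)))"
      by (rule dpred_rename[OF dom.ring_axioms R(4), of ?q])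
    then have "dpred B (\<lambda>e. R (\<lambda>j. h (e j)) (e m))" by simp
    from image[OF this] have "dpred A (\<lambda>a. \<exists>y\<in>carrier B. h y = a m \<and> R a y)"
    proof (rule dpred_cong)
      fix a :: "nat \<Rightarrow> 'b" assume "valuation A a"
      then obtain e where e: "valuation B e" "\<forall>i. h (e i) = a i" by (rule lift_env)
      have "\<exists>e. valuation B e \<and> (\<forall>i. h (e i) = a i) \<and> R (\<lambda>j. h (e j)) (e m)"
        if "y \<in> carrier B" "h y = a m" "R a y" for y
      proof -
        have "(\<lambda>j. h ((e(m := y)) j)) = a" using that e by auto
        with that e show ?thesis by (intro exI[of _ "e(m := y)"]) auto
      qed
      then show "(\<exists>e. valuation B e \<and> (\<forall>i. h (e i) = a i) \<and> R (\<lambda>j. h (e j)) (e m)) =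
        (\<exists>y\<in>carrier B. h y = a m \<and> R a y)" by auto
    qed
    from dpred_imp_definable[OF this cod.zero_closed, of "m + 1"]
    have "definable A (m + 1) {zs \<in> tuples A (m + 1). \<exists>y\<in>carrier B.
      h y = (if m < m + 1 then zs ! m else \<zero>\<^bsub>A\<^esub>) \<and> R (\<lambda>i. if i < m + 1 then zs ! i else \<zero>\<^bsub>A\<^esub>) y}" .
    also have "{zs \<in> tuples A (m + 1). \<exists>y\<in>carrier B.
      h y = (if m < m + 1 then zs ! m else \<zero>\<^bsub>A\<^esub>) \<and> R (\<lambda>i. if i < m + 1 then zs ! i else \<zero>\<^bsub>A\<^esub>) y} =
      {x @ x' | x x'. x \<in> M \<and> x' \<in> tuples A 1 \<and> h (decode x) = hd x'}" (is "?L = ?R")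
    proof (intro equalityI subsetI)
      fix zs assume "zs \<in> ?L"
      then obtain y where y: "zs \<in> tuples A (m + 1)" "y \<in> carrier B" "h y = zs ! m"
        "R (\<lambda>i. if i < m + 1 then zs ! i else \<zero>\<^bsub>A\<^esub>) y" by auto
      let ?x = "take m zs"
      have "R (\<lambda>i. if i < m + 1 then zs ! i else \<zero>\<^bsub>A\<^esub>) y = R (ev ?x) y"
        using y(1) by (intro R(1)) (auto simp: ev_def tuples_def)
      moreover have "?x \<in> tuples A m" using y(1) by (auto simp: tuples_def dest: in_set_takeD)
      ultimately have "?x \<in> M" "decode ?x = y" using y MI decodeI by auto
      moreover have "zs = ?x @ [zs ! m]" "[zs ! m] \<in> tuples A 1"
        using y(1) by (auto simp: tuples_def take_Suc_conv_app_nth[symmetric])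
      ultimately show "zs \<in> ?R" using y(3)
        by (intro CollectI exI[of _ ?x] exI[of _ "[zs ! m]"]) auto
    next
      fix zs assume "zs \<in> ?R"
      then obtain x w where x: "zs = x @ [w]" "x \<in> M" "w \<in> carrier A" "h (decode x) = w"
        unfolding tuples_1 by auto
      have l: "length x = m" using x(2) by (simp add: M_def tuples_def)
      have "zs \<in> tuples A (m + 1)" using x l by (auto simp: tuples_def M_def)
      moreover have "R (\<lambda>i. if i < m + 1 then zs ! i else \<zero>\<^bsub>A\<^esub>) (decode x) = R (ev x) (decode x)"
        using x(1) l by (intro R(1)) (auto simp: ev_def nth_append)
      ultimately show "zs \<in> ?L" using decode[OF x(2)] x l
        by (intro CollectI conjI bexI[of _ "decode x"]) auto
    qed
    also have "?R = {x @ x' | x x'. x \<in> source (tuple_map_comp ?g f) \<and>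
      x' \<in> source (tuple_map_id A) \<and> to_fun (tuple_map_comp ?g f) x = to_fun (tuple_map_id A) x'}"
    proof -
      have "source (tuple_map_comp ?g f) = M"
        using pre1 by (simp add: tuple_map_comp_def unary_map_def)
      moreover have "to_fun (tuple_map_comp ?g f) x = h (decode x)" if "x \<in> M" for x
        using that by (simp add: tuple_map_comp_def unary_map_def f_def blocks_def M_def tuples_def)
      ultimately show ?thesis by (simp add: tuple_map_id_def cong: conj_cong)
    qed
    finally show ?thesis
      unfolding homotopic_def by (simp add: tuple_map_comp_def tuple_map_id_def unary_map_def f_def)
  qed

  have homB: "homotopic B (tuple_map_comp f ?g) (tuple_map_id B)"
  proof -
    let ?q = "\<lambda>l. case l of 0 \<Rightarrow> m | Suc j \<Rightarrow> j"
    have "dpred B (\<lambda>e. R (\<lambda>j. h (e (?q (Suc j)))) (e (?q 0)))"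
      by (rule dpred_rename[OF dom.ring_axioms R(4), of ?q])
    then have "dpred B (\<lambda>e. R (\<lambda>j. h (e j)) (e m))" by simp
    from dpred_imp_definable[OF this dom.zero_closed, of "m + 1"]
    have "definable B (m + 1) {zs \<in> tuples B (m + 1).
      R (\<lambda>i. h (if i < m + 1 then zs ! i else \<zero>\<^bsub>B\<^esub>)) (if m < m + 1 then zs ! m else \<zero>\<^bsub>B\<^esub>)}" .
    also have "{zs \<in> tuples B (m + 1).
      R (\<lambda>i. h (if i < m + 1 then zs ! i else \<zero>\<^bsub>B\<^esub>)) (if m < m + 1 then zs ! m else \<zero>\<^bsub>B\<^esub>)} =
      {x @ x' | x x'. x \<in> {x \<in> tuples B m. map h x \<in> M} \<and> x' \<in> tuples B 1 \<and>
        decode (map h x) = hd x'}" (is "?L = ?R")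
    proof (intro equalityI subsetI)
      fix zs assume "zs \<in> ?L"
      then have y: "zs \<in> tuples B (m + 1)"
        "R (\<lambda>i. h (if i < m + 1 then zs ! i else \<zero>\<^bsub>B\<^esub>)) (zs ! m)" by auto
      let ?x = "take m zs"
      have 1: "zs ! m \<in> carrier B" "?x \<in> tuples B m"
        using y(1) by (auto simp: tuples_def dest: in_set_takeD)
      have "R (\<lambda>i. h (if i < m + 1 then zs ! i else \<zero>\<^bsub>B\<^esub>)) (zs ! m) = R (ev (map h ?x)) (zs ! m)"
        using y(1) by (intro R(1)) (auto simp: ev_def tuples_def)
      moreover have "map h ?x \<in> tuples A m" using 1(2) by (auto simp: tuples_def)
      ultimately have "map h ?x \<in> M" "decode (map h ?x) = zs ! m" using y 1 MI decodeI by auto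
      moreover have "zs = ?x @ [zs ! m]" "[zs ! m] \<in> tuples B 1"
        using y(1) by (auto simp: tuples_def take_Suc_conv_app_nth[symmetric])
      ultimately show "zs \<in> ?R" using 1
        by (intro CollectI exI[of _ ?x] exI[of _ "[zs ! m]"]) auto
    next
      fix zs assume "zs \<in> ?R"
      then obtain x w where x: "zs = x @ [w]" "map h x \<in> M" "x \<in> tuples B m" "w \<in> carrier B"
        "decode (map h x) = w" unfolding tuples_1 by auto
      have l: "length x = m" using x(3) by (simp add: tuples_def)
      have "zs \<in> tuples B (m + 1)" using x l by (auto simp: tuples_def)
      moreover have "R (\<lambda>i. h (if i < m + 1 then zs ! i else \<zero>\<^bsub>B\<^esub>)) w = R (ev (map h x)) w"
        using x(1) l by (intro R(1)) (auto simp: ev_def nth_append)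
      ultimately show "zs \<in> ?L" using decode[OF x(2)] x l by auto
    qed
    also have "?R = {x @ x' | x x'. x \<in> source (tuple_map_comp f ?g) \<and>
      x' \<in> source (tuple_map_id B) \<and> to_fun (tuple_map_comp f ?g) x = to_fun (tuple_map_id B) x'}"
    proof -
      have "source (tuple_map_comp f ?g) = {x \<in> tuples B m. map h x \<in> M}"
        by (simp add: tuple_map_comp_def tuple_preimage_unary f_def)
      moreover have "to_fun (tuple_map_comp f ?g) x = decode (map h x)" if "x \<in> tuples B m" for x
      proof -
        have "to_fun (tuple_map_comp f ?g) x = decode (map (\<lambda>xs. h (hd xs)) (blocks 1 m x))"
          by (simp add: tuple_map_comp_def unary_map_def f_def)
        also have "blocks 1 m x = map (\<lambda>x. [x]) x" using that
          by (intro blocks_one) (simp add: tuples_def)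
        finally show ?thesis by (simp add: comp_def)
      qed
      ultimately show ?thesis by (simp add: tuple_map_id_def cong: conj_cong)
    qed
    finally show ?thesis
      unfolding homotopic_def by (simp add: tuple_map_comp_def tuple_map_id_def unary_map_def f_def)
  qed
  from interp unary_interpretation homA homB show ?thesis
    unfolding bi_interpretable_def bi_interpretation_def by blast
qed

end

section \<open>Finitely generated rings are noetherian\<close>

text \<open>
  Coefficients are taken from a subset \<open>S\<close> of the ring, so that subrings with different carriers act
  inside one ambient ring; Hilbert's theorem and the finiteness over \<open>p\<close>-th powers both enlarge
  the coefficients or the span step by step.
\<close>

inductive_set lspan :: "('a, 'x) ring_scheme \<Rightarrow> 'a set \<Rightarrow> 'a set \<Rightarrow> 'a set"
  for R S G where
    zero: "\<zero>\<^bsub>R\<^esub> \<in> lspan R S G"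
  | step: "s \<in> S \<Longrightarrow> g \<in> G \<Longrightarrow> x \<in> lspan R S G \<Longrightarrow> (s \<otimes>\<^bsub>R\<^esub> g) \<oplus>\<^bsub>R\<^esub> x \<in> lspan R S G"

definition submodule_over :: "('a, 'x) ring_scheme \<Rightarrow> 'a set \<Rightarrow> 'a set \<Rightarrow> bool" where
  "submodule_over R S M \<longleftrightarrow> M \<subseteq> carrier R \<and> \<zero>\<^bsub>R\<^esub> \<in> M \<and> (\<forall>x\<in>M. \<forall>y\<in>M. x \<oplus>\<^bsub>R\<^esub> y \<in> M) \<and>
     (\<forall>s\<in>S. \<forall>x\<in>M. s \<otimes>\<^bsub>R\<^esub> x \<in> M)"

definition noetherian_over :: "('a, 'x) ring_scheme \<Rightarrow> 'a set \<Rightarrow> bool" where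
  "noetherian_over R S \<longleftrightarrow> (\<forall>I. submodule_over R S I \<longrightarrow> I \<subseteq> S \<longrightarrow>
     (\<exists>G\<subseteq>I. finite G \<and> I \<subseteq> lspan R S G))"

definition tuple_submodule :: "('a, 'x) ring_scheme \<Rightarrow> (nat \<Rightarrow> 'a) set \<Rightarrow> bool" where
  "tuple_submodule R K \<longleftrightarrow> (\<forall>k\<in>K. \<forall>j. k j \<in> carrier R) \<and> (\<lambda>j. \<zero>\<^bsub>R\<^esub>) \<in> K \<and>
     (\<forall>k\<in>K. \<forall>l\<in>K. (\<lambda>j. k j \<oplus>\<^bsub>R\<^esub> l j) \<in> K) \<and>
     (\<forall>c\<in>carrier R. \<forall>k\<in>K. (\<lambda>j. c \<otimes>\<^bsub>R\<^esub> k j) \<in> K)"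

lemma tuple_submoduleD:
  assumes "tuple_submodule R K"
  shows "k \<in> K \<Longrightarrow> k j \<in> carrier R" "(\<lambda>j. \<zero>\<^bsub>R\<^esub>) \<in> K"
    "k \<in> K \<Longrightarrow> l \<in> K \<Longrightarrow> (\<lambda>j. k j \<oplus>\<^bsub>R\<^esub> l j) \<in> K"
    "c \<in> carrier R \<Longrightarrow> k \<in> K \<Longrightarrow> (\<lambda>j. c \<otimes>\<^bsub>R\<^esub> k j) \<in> K"
  using assms unfolding tuple_submodule_def by simp_all

context cring
begin

lemma finsum_lessThan_Suc:
  assumes "\<And>i. i \<le> n \<Longrightarrow> f i \<in> carrier R"
  shows "(\<Oplus>i\<in>{..<Suc n}. f i) = (\<Oplus>i\<in>{..<n}. f i) \<oplus> f n"
  unfolding lessThan_Suc using assms by (subst finsum_insert) (auto intro!: a_comm finsum_closed)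

lemma finsum_append:
  fixes m n :: nat
  assumes "\<And>i. f i \<in> carrier R"
  shows "(\<Oplus>i\<in>{..<m + n}. f i) = (\<Oplus>i\<in>{..<m}. f i) \<oplus> (\<Oplus>i\<in>{..<n}. f (m + i))"
proof (induction n)
  case (Suc n)
  then show ?case using assms
    by (simp only: add_Suc_right finsum_lessThan_Suc) (simp add: a_assoc Pi_def)
qed (simp add: assms Pi_def)

lemma lspan_subset:
  assumes "submodule_over R S M" "G \<subseteq> M" shows "lspan R S G \<subseteq> M"
proof
  fix x assume "x \<in> lspan R S G"
  then show "x \<in> M" by induction (use assms in \<open>auto simp: submodule_over_def\<close>)
qed

lemma lspan_submodule:
  assumes "subring S R" "G \<subseteq> carrier R"
  shows "submodule_over R S (lspan R S G)"
proof -
  note S = subringE[OF assms(1)]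
  have c: "x \<in> carrier R" if "x \<in> lspan R S G" for x
    using that
  proof induction
    case (step s g x)
    then have "s \<in> carrier R" "g \<in> carrier R" using S(1) assms(2) by blast+
    with step show ?case by simp
  qed simp
  have "x \<oplus> y \<in> lspan R S G" if "x \<in> lspan R S G" "y \<in> lspan R S G" for x y
    using that
  proof induction
    case (step s g x)
    then have "(s \<otimes> g) \<oplus> (x \<oplus> y) \<in> lspan R S G" by (intro lspan.step) auto
    moreover have "s \<in> carrier R" "g \<in> carrier R" using step S assms by auto
    ultimately show ?case using c[OF step.hyps(3)] c[OF step.prems] by (simp add: a_assoc)
  qed (use c in auto)
  moreover have "t \<otimes> x \<in> lspan R S G" if "x \<in> lspan R S G" "t \<in> S" for x t
    using that
  proof induction
    case zero
    then have "t \<in> carrier R" using S(1) by blast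
    then show ?case by (auto intro: lspan.zero)
  next
    case (step s g x)
    then have "((t \<otimes> s) \<otimes> g) \<oplus> (t \<otimes> x) \<in> lspan R S G" using S by (intro lspan.step) auto
    moreover have "s \<in> carrier R" "g \<in> carrier R" "t \<in> carrier R" using step S assms by auto
    ultimately show ?case using c[OF step.hyps(3)] by (simp add: r_distr m_assoc)
  qed
  ultimately show ?thesis using c unfolding submodule_over_def by (auto intro: lspan.zero)
qed

lemma lspan_generator:
  assumes "subring S R" "G \<subseteq> carrier R" "g \<in> G" shows "g \<in> lspan R S G"
proof -
  have "(\<one> \<otimes> g) \<oplus> \<zero> \<in> lspan R S G"
    using subringE[OF assms(1)] assms(3) by (intro lspan.step lspan.zero) auto
  then show ?thesis using assms by (auto simp: subset_iff)
qed

lemma submodule_overD: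
  assumes "submodule_over R S M"
  shows "x \<in> M \<Longrightarrow> x \<in> carrier R" "\<zero> \<in> M" "x \<in> M \<Longrightarrow> y \<in> M \<Longrightarrow> x \<oplus> y \<in> M"
    "s \<in> S \<Longrightarrow> x \<in> M \<Longrightarrow> s \<otimes> x \<in> M"
  using assms unfolding submodule_over_def by auto

lemma submodule_over_minus:
  assumes "subring S R" "submodule_over R S M" "x \<in> M" "y \<in> M"
  shows "x \<ominus> y \<in> M"
proof -
  note S = subringE[OF assms(1)] and M = submodule_overD[OF assms(2)]
  have "(\<ominus> \<one>) \<otimes> y \<in> M" using S assms M by auto
  then have "x \<oplus> (\<ominus> \<one>) \<otimes> y \<in> M" using M assms(3) by auto
  moreover have "x \<oplus> (\<ominus> \<one>) \<otimes> y = x \<ominus> y" using M(1) assms by (simp add: a_minus_def l_minus)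
  ultimately show ?thesis by simp
qed

lemma lspan_finite_sum:
  assumes "subring S R" "g ` {..<r} \<subseteq> carrier R" "x \<in> lspan R S (g ` {..<r})"
  shows "\<exists>c. (\<forall>i. c i \<in> S) \<and> x = (\<Oplus>i\<in>{..<r::nat}. c i \<otimes> g i)"
  using assms(3)
proof induction
  note S = subringE[OF assms(1)]
  have g: "g i \<in> carrier R" if "i < r" for i using that assms(2) by auto
  case zero
  have "(\<Oplus>i\<in>{..<r}. \<zero> \<otimes> g i) = (\<Oplus>i\<in>{..<r}. \<zero>)"
    by (rule finsum_cong') (auto simp: g)
  then show ?case using S by (intro exI[of _ "\<lambda>i. \<zero>"]) simp
next
  note S = subringE[OF assms(1)]
  have g: "g i \<in> carrier R" if "i < r" for i using that assms(2) by auto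
  case (step s h x)
  then obtain c k where c: "\<forall>i. c i \<in> S" "x = (\<Oplus>i\<in>{..<r}. c i \<otimes> g i)" "k < r" "h = g k"
    by auto
  let ?c = "\<lambda>i. if i = k then s \<oplus> c k else c i"
  have cc: "c i \<in> carrier R" for i using c(1) S(1) by auto
  have s: "s \<in> carrier R" using step S by auto
  have split: "{..<r} = insert k ({..<r} - {k})" using c(3) by auto
  have "x = c k \<otimes> g k \<oplus> (\<Oplus>i\<in>{..<r} - {k}. c i \<otimes> g i)"
    unfolding c(2) by (subst split, subst finsum_insert) (auto simp: cc g c(3))
  moreover have "(\<Oplus>i\<in>{..<r}. ?c i \<otimes> g i) =
    (s \<oplus> c k) \<otimes> g k \<oplus> (\<Oplus>i\<in>{..<r} - {k}. ?c i \<otimes> g i)"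
    by (subst split, subst finsum_insert) (auto simp: cc g c(3) s)
  moreover have "(\<Oplus>i\<in>{..<r} - {k}. ?c i \<otimes> g i) = (\<Oplus>i\<in>{..<r} - {k}. c i \<otimes> g i)"
    by (rule finsum_cong') (auto simp: cc g)
  moreover have "(\<Oplus>i\<in>{..<r} - {k}. c i \<otimes> g i) \<in> carrier R"
    by (rule finsum_closed) (auto simp: cc g)
  ultimately have "(\<Oplus>i\<in>{..<r}. ?c i \<otimes> g i) = s \<otimes> h \<oplus> x"
    using cc s g[OF c(3)] c(4) by (simp add: l_distr a_assoc)
  moreover have "\<forall>i. ?c i \<in> S" using c(1) step(1) S by auto
  ultimately show ?case by (intro exI[of _ ?c]) auto
qed

lemma finite_enumeration:
  assumes "finite G" obtains g and r :: nat where "G = g ` {..<r}"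
  using finite_imp_nat_seg_image_inj_on[OF assms] by (metis lessThan_def)

text \<open>
  The polynomial expressions in \<open>x\<close> of degree less than \<open>n\<close> with coefficients in \<open>S\<close>. Working with
  values instead of formal polynomials makes Hilbert's argument take place inside the given ring.
\<close>

primrec bounded_degree :: "'a set \<Rightarrow> 'a \<Rightarrow> nat \<Rightarrow> 'a set" where
  "bounded_degree S x 0 = {\<zero>}"
| "bounded_degree S x (Suc n) = {d \<oplus> s \<otimes> x [^] n | d s. d \<in> bounded_degree S x n \<and> s \<in> S}"

lemma bounded_degree_submodule:
  assumes "subring S R" "x \<in> carrier R"
  shows "submodule_over R S (bounded_degree S x n)"
proof (induction n)
  note S = subringE[OF assms(1)]
  case 0
  then show ?case using S by (auto simp: submodule_over_def)
next
  note S = subringE[OF assms(1)]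
  case (Suc n)
  note D = submodule_overD[OF Suc]
  have sc: "s \<in> carrier R" if "s \<in> S" for s using that S by auto
  show ?case unfolding submodule_over_def
  proof (intro conjI ballI subsetI)
    fix f assume "f \<in> bounded_degree S x (Suc n)"
    then show "f \<in> carrier R" using D sc assms by auto
  next
    have "\<zero> = \<zero> \<oplus> \<zero> \<otimes> x [^] n" using assms by simp
    then show "\<zero> \<in> bounded_degree S x (Suc n)" using D(2) S(2) by auto
  next
    fix f g assume "f \<in> bounded_degree S x (Suc n)" "g \<in> bounded_degree S x (Suc n)"
    then obtain d s d' s' where f: "f = d \<oplus> s \<otimes> x [^] n" "d \<in> bounded_degree S x n" "s \<in> S"
      and g: "g = d' \<oplus> s' \<otimes> x [^] n" "d' \<in> bounded_degree S x n" "s' \<in> S" by auto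
    have xn: "x [^] n \<in> carrier R" using assms by simp
    have "f \<oplus> g = (d \<oplus> d') \<oplus> (s \<oplus> s') \<otimes> x [^] n"
      using f g D(1) sc xn by (simp add: l_distr a_ac)
    then show "f \<oplus> g \<in> bounded_degree S x (Suc n)"
      unfolding bounded_degree.simps using D(3)[OF f(2) g(2)] S(7)[OF f(3) g(3)] by blast
  next
    fix t f assume "t \<in> S" "f \<in> bounded_degree S x (Suc n)"
    then obtain d s where f: "f = d \<oplus> s \<otimes> x [^] n" "d \<in> bounded_degree S x n" "s \<in> S" by auto
    have "t \<otimes> f = t \<otimes> d \<oplus> (t \<otimes> s) \<otimes> x [^] n"
      using f D(1) sc \<open>t \<in> S\<close> assms by (simp add: r_distr m_assoc)
    then show "t \<otimes> f \<in> bounded_degree S x (Suc n)"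
      unfolding bounded_degree.simps using D(4)[OF \<open>t \<in> S\<close> f(2)] S(6)[OF \<open>t \<in> S\<close> f(3)] by blast
  qed
qed

lemma bounded_degree_Suc:
  assumes "subring S R" "x \<in> carrier R" "d \<in> bounded_degree S x n"
  shows "d \<in> bounded_degree S x (Suc n)"
proof -
  have "d = d \<oplus> \<zero> \<otimes> x [^] n"
    using submodule_overD(1)[OF bounded_degree_submodule[OF assms(1,2)] assms(3)] assms by simp
  then show ?thesis using assms(3) subringE(2)[OF assms(1)] by auto
qed

lemma bounded_degree_mono:
  assumes "subring S R" "x \<in> carrier R" "m \<le> n" "d \<in> bounded_degree S x m"
  shows "d \<in> bounded_degree S x n"
  using assms(3,4) by (induction rule: dec_induct) (simp_all only: bounded_degree_Suc[OF assms(1,2)])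

lemma bounded_degree_shift:
  assumes "subring S R" "x \<in> carrier R" "d \<in> bounded_degree S x n"
  shows "x \<otimes> d \<in> bounded_degree S x (Suc n)"
  using assms(3)
proof (induction n arbitrary: d)
  case 0
  then have "x \<otimes> d = \<zero> \<oplus> \<zero> \<otimes> x [^] (0::nat)" using assms(2) by simp
  then show ?case using subringE(2)[OF assms(1)] unfolding bounded_degree.simps by blast
next
  note D = submodule_overD[OF bounded_degree_submodule[OF assms(1,2)]]
  case (Suc n)
  then obtain e s where d: "d = e \<oplus> s \<otimes> x [^] n" "e \<in> bounded_degree S x n" "s \<in> S" by auto
  have "s \<in> carrier R" using d(3) subringE(1)[OF assms(1)] by auto
  then have "x \<otimes> d = x \<otimes> e \<oplus> s \<otimes> x [^] Suc n"
    using d(1) D(1)[OF d(2)] assms(2) by (simp add: r_distr m_ac)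
  then show ?case using Suc.IH[OF d(2)] d(3) by auto
qed

lemma bounded_degree_shift_pow:
  assumes "subring S R" "x \<in> carrier R" "d \<in> bounded_degree S x n"
  shows "x [^] k \<otimes> d \<in> bounded_degree S x (k + n)"
proof (induction k)
  case 0
  then show ?case using assms submodule_overD(1)[OF bounded_degree_submodule[OF assms(1,2)] assms(3)] 
    by simp
next
  case (Suc k)
  have "d \<in> carrier R" using submodule_overD(1)[OF bounded_degree_submodule[OF assms(1,2)] assms(3)] .
  then have "x [^] Suc k \<otimes> d = x \<otimes> (x [^] k \<otimes> d)" using assms by (simp add: m_ac)
  then show ?case using bounded_degree_shift[OF assms(1,2) Suc] by simp
qed

lemma adjoin_bounded_degree:
  assumes S: "subring S R" and x: "x \<in> carrier R"
  shows "subring (\<Union>n. bounded_degree S x n) R" "S \<subseteq> (\<Union>n. bounded_degree S x n)"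
    "x \<in> (\<Union>n. bounded_degree S x n)"
proof -
  note SE = subringE[OF S]
  note D = submodule_overD[OF bounded_degree_submodule[OF S x]]
  let ?T = "\<Union>n. bounded_degree S x n"
  have add: "f \<oplus> g \<in> ?T" if fg: "f \<in> ?T" "g \<in> ?T" for f g
  proof -
    obtain m n where "f \<in> bounded_degree S x m" "g \<in> bounded_degree S x n" using fg by blast
    then have "f \<in> bounded_degree S x (max m n)" "g \<in> bounded_degree S x (max m n)"
      using bounded_degree_mono[OF S x, of m "max m n" f]
        bounded_degree_mono[OF S x, of n "max m n" g] by simp_all
    then show ?thesis using D(3) by blast
  qed
  have smult: "s \<otimes> f \<in> ?T" if "s \<in> S" "f \<in> ?T" for f s
    using that D(4) by blast
  have shift: "x [^] k \<otimes> f \<in> ?T" if "f \<in> ?T" for f and k :: nat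
    using that bounded_degree_shift_pow[OF S x] by blast
  have car: "f \<in> carrier R" if "f \<in> ?T" for f using that D(1) by blast
  have zero: "\<zero> \<in> ?T" by (rule UN_I[of 0]) auto
  have "\<zero> \<oplus> s \<otimes> x [^] (0::nat) \<in> bounded_degree S x (Suc 0)" if "s \<in> S" for s
    using that by auto
  moreover have "\<zero> \<oplus> s \<otimes> x [^] (0::nat) = s" if "s \<in> S" for s using that SE by auto
  ultimately have ST: "s \<in> ?T" if "s \<in> S" for s using that by (metis UNIV_I UN_I)
  then show "S \<subseteq> ?T" by blast
  have "x [^] (1::nat) \<otimes> \<one> \<in> ?T" by (rule shift[OF ST[OF SE(3)]])
  then show "x \<in> ?T" using x by simp
  have mult: "f \<otimes> g \<in> ?T" if "f \<in> bounded_degree S x n" "g \<in> ?T" for f g n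
    using that(1)
  proof (induction n arbitrary: f)
    case 0
    then show ?case using zero car[OF that(2)] by simp
  next
    case (Suc n)
    then obtain e s where f: "f = e \<oplus> s \<otimes> x [^] n" "e \<in> bounded_degree S x n" "s \<in> S" by auto
    have "s \<in> carrier R" using f SE by auto
    then have "f \<otimes> g = e \<otimes> g \<oplus> s \<otimes> (x [^] n \<otimes> g)"
      using f D(1)[OF f(2)] x car[OF that(2)] by (simp add: l_distr m_assoc)
    then show ?case using add[OF Suc.IH[OF f(2)] smult[OF f(3) shift[OF that(2)]]] by simp
  qed
  show "subring ?T R"
  proof (rule subringI)
    show "?T \<subseteq> carrier R" using car by blast
    show "\<one> \<in> ?T" using ST SE(3) by blast
    fix f g assume fg: "f \<in> ?T" "g \<in> ?T"
    show "f \<otimes> g \<in> ?T" using fg(1) mult[OF _ fg(2)] by blast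
    show "f \<oplus> g \<in> ?T" by (rule add[OF fg])
    have "(\<ominus> \<one>) \<otimes> f \<in> ?T" using SE(3,5) smult fg(1) by blast
    then show "\<ominus> f \<in> ?T" using car[OF fg(1)] by (simp add: l_minus)
  qed
qed

text \<open>
  Hilbert's basis theorem for \<open>S[x]\<close>, by the usual argument on leading coefficients. The ideals \<open>L n\<close>
  of coefficients of \<open>x\<^sup>n\<close> in elements of \<open>J\<close> of formal degree at most \<open>n\<close> grow with \<open>n\<close> and become
  stationary at some \<open>n0\<close>. Lifts of generators of \<open>L 0, \<dots>, L n0\<close> generate \<open>J\<close>, since subtracting
  a suitable combination of them lowers the formal degree. A value may have several polynomial
  expressions; the argument only uses that some expression exists.
\<close>

lemma noetherian_adjoin:
  assumes S: "subring S R" and x: "x \<in> carrier R" and noeth: "noetherian_over R S"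
  shows "noetherian_over R (\<Union>n. bounded_degree S x n)"
  unfolding noetherian_over_def
proof (intro allI impI)
  let ?T = "\<Union>n. bounded_degree S x n"
  fix J assume J: "submodule_over R ?T J" "J \<subseteq> ?T"
  note SE = subringE[OF S] and T = adjoin_bounded_degree[OF S x]
  note D = submodule_overD[OF bounded_degree_submodule[OF S x]]
  note JD = submodule_overD[OF J(1)]
  have xn: "x [^] n \<in> ?T" for n :: nat
    by (induction n) (use subringE[OF T(1)] T(3) in auto)
  define L where "L n = {s \<in> S. \<exists>d\<in>bounded_degree S x n. d \<oplus> s \<otimes> x [^] n \<in> J}" for n
  have sc: "s \<in> carrier R" if "s \<in> S" for s using that SE by auto
  have xc: "x [^] n \<in> carrier R" for n :: nat using x by simp
  have L_sub: "submodule_over R S (L n)" for n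
    unfolding submodule_over_def
  proof (intro conjI ballI subsetI)
    show "s \<in> carrier R" if "s \<in> L n" for s using that sc by (auto simp: L_def)
    have "\<zero> \<oplus> \<zero> \<otimes> x [^] n \<in> J" using JD(2) xc by simp
    then show "\<zero> \<in> L n" using SE(2) D(2) unfolding L_def by blast
  next
    fix s t assume "s \<in> L n" "t \<in> L n"
    then obtain d e where d: "s \<in> S" "d \<in> bounded_degree S x n" "d \<oplus> s \<otimes> x [^] n \<in> J"
      and e: "t \<in> S" "e \<in> bounded_degree S x n" "e \<oplus> t \<otimes> x [^] n \<in> J" unfolding L_def by blast
    have "(d \<oplus> e) \<oplus> (s \<oplus> t) \<otimes> x [^] n = (d \<oplus> s \<otimes> x [^] n) \<oplus> (e \<oplus> t \<otimes> x [^] n)"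
      using sc d e D(1)[OF d(2)] D(1)[OF e(2)] xc by (simp add: l_distr a_ac)
    then have "(d \<oplus> e) \<oplus> (s \<oplus> t) \<otimes> x [^] n \<in> J" using JD(3)[OF d(3) e(3)] by simp
    then show "s \<oplus> t \<in> L n" using d e D(3) SE(7) unfolding L_def by blast
  next
    fix t s assume t: "t \<in> S" and "s \<in> L n"
    then obtain d where d: "s \<in> S" "d \<in> bounded_degree S x n" "d \<oplus> s \<otimes> x [^] n \<in> J"
      unfolding L_def by blast
    have "t \<otimes> d \<oplus> (t \<otimes> s) \<otimes> x [^] n = t \<otimes> (d \<oplus> s \<otimes> x [^] n)"
      using sc t d D(1)[OF d(2)] xc by (simp add: r_distr m_assoc)
    moreover have "t \<otimes> (d \<oplus> s \<otimes> x [^] n) \<in> J" using t T(2) d(3) JD(4) by blast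
    ultimately have "t \<otimes> d \<oplus> (t \<otimes> s) \<otimes> x [^] n \<in> J" by simp
    then show "t \<otimes> s \<in> L n" using d t D(4) SE(6) unfolding L_def by blast
  qed
  have L_Suc: "L n \<subseteq> L (Suc n)" for n
  proof
    fix s assume "s \<in> L n"
    then obtain d where d: "s \<in> S" "d \<in> bounded_degree S x n" "d \<oplus> s \<otimes> x [^] n \<in> J"
      unfolding L_def by blast
    have "x \<otimes> d \<oplus> s \<otimes> x [^] Suc n = x \<otimes> (d \<oplus> s \<otimes> x [^] n)"
      using sc d D(1)[OF d(2)] x by (simp add: r_distr m_ac)
    then have "x \<otimes> d \<oplus> s \<otimes> x [^] Suc n \<in> J" using JD(4)[OF T(3) d(3)] by simp
    then show "s \<in> L (Suc n)" 
      using d bounded_degree_shift[OF S x d(2)] unfolding L_def by blast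
  qed
  have L_mono: "L m \<subseteq> L n" if "m \<le> n" for m n
    using lift_Suc_mono_le[of L, OF L_Suc that] .
  have fin: "\<exists>G\<subseteq>L n. finite G \<and> L n \<subseteq> lspan R S G" for n
    using noeth L_sub[of n] unfolding noetherian_over_def L_def by blast
  obtain n0 where n0: "\<And>n. L n \<subseteq> L n0"
  proof -
    have "submodule_over R S (\<Union>n. L n)"
      unfolding submodule_over_def
    proof (intro conjI ballI subsetI)
      fix s assume "s \<in> (\<Union>n. L n)" then show "s \<in> carrier R" using sc by (auto simp: L_def)
    next
      show "\<zero> \<in> (\<Union>n. L n)" using submodule_overD(2)[OF L_sub] by blast
    next
      fix s t assume "s \<in> (\<Union>n. L n)" "t \<in> (\<Union>n. L n)"
      then obtain m n where "s \<in> L m" "t \<in> L n" by blast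
      then have "s \<in> L (max m n)" "t \<in> L (max m n)"
        using L_mono[of m "max m n"] L_mono[of n "max m n"] by auto
      then show "s \<oplus> t \<in> (\<Union>n. L n)" using submodule_overD(3)[OF L_sub] by blast
    next
      fix s t assume "t \<in> S" "s \<in> (\<Union>n. L n)"
      then show "t \<otimes> s \<in> (\<Union>n. L n)" using submodule_overD(4)[OF L_sub] by blast
    qed
    moreover have "(\<Union>n. L n) \<subseteq> S" by (auto simp: L_def)
    ultimately have "\<exists>G\<subseteq>(\<Union>n. L n). finite G \<and> (\<Union>n. L n) \<subseteq> lspan R S G"
      using noeth unfolding noetherian_over_def by (elim allE impE)
    then obtain G where G: "G \<subseteq> (\<Union>n. L n)" "finite G" "(\<Union>n. L n) \<subseteq> lspan R S G"
      by (elim exE conjE)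
    have "\<forall>g\<in>G. \<exists>n. g \<in> L n" using G(1) by blast
    then obtain N where N: "\<forall>g\<in>G. g \<in> L (N g)" by (rule bchoice[THEN exE])
    have "g \<in> L (Max (N ` G))" if "g \<in> G" for g
      using N that G(2) L_mono[of "N g" "Max (N ` G)"] by auto
    then have "lspan R S G \<subseteq> L (Max (N ` G))" using lspan_subset[OF L_sub] by blast
    then show ?thesis using G(3) that[of "Max (N ` G)"] by blast
  qed
  have "\<forall>n. \<exists>G. G \<subseteq> L n \<and> finite G \<and> L n \<subseteq> lspan R S G" using fin by blast
  then obtain G where G: "\<forall>n. G n \<subseteq> L n \<and> finite (G n) \<and> L n \<subseteq> lspan R S (G n)"
    by (rule choice[THEN exE])
  define lift where
    "lift n g = (SOME f. f \<in> J \<and> (\<exists>d\<in>bounded_degree S x n. f = d \<oplus> g \<otimes> x [^] n))" for n g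
  have lift: "lift n g \<in> J" "\<exists>d\<in>bounded_degree S x n. lift n g = d \<oplus> g \<otimes> x [^] n"
    if "g \<in> L n" for n g
  proof -
    have "\<exists>f. f \<in> J \<and> (\<exists>d\<in>bounded_degree S x n. f = d \<oplus> g \<otimes> x [^] n)"
      using that unfolding L_def by blast
    from someI_ex[OF this] show "lift n g \<in> J"
      "\<exists>d\<in>bounded_degree S x n. lift n g = d \<oplus> g \<otimes> x [^] n" unfolding lift_def by blast+
  qed
  define GG where "GG = (\<Union>n\<in>{..n0}. lift n ` G n)"
  have GG: "finite GG" "GG \<subseteq> J" using G lift(1) unfolding GG_def by (auto, blast)
  have GGc: "GG \<subseteq> carrier R" using GG(2) JD(1) by blast
  note LS = submodule_overD[OF lspan_submodule[OF T(1) GGc]]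
  have LSJ: "lspan R ?T GG \<subseteq> J" by (rule lspan_subset[OF J(1) GG(2)])
  have lead: "\<exists>u\<in>lspan R ?T GG. \<exists>d\<in>bounded_degree S x n. u = d \<oplus> s \<otimes> x [^] n"
    if s: "s \<in> lspan R S (G k)" and k: "k \<le> n" "k \<le> n0" for s k n
    using s
  proof induction
    case zero
    then show ?case using LS(2) D(2) xc by (intro bexI[of _ \<zero>]) auto
  next
    case (step a g s)
    then obtain u d where u: "u \<in> lspan R ?T GG" "d \<in> bounded_degree S x n" "u = d \<oplus> s \<otimes> x [^] n"
      by blast
    have gL: "g \<in> L k" using step G by blast
    then obtain e where e: "e \<in> bounded_degree S x k" "lift k g = e \<oplus> g \<otimes> x [^] k"
      using lift(2) by blast
    have lGG: "lift k g \<in> lspan R ?T GG"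
      using step(2) k(2) by (intro lspan_generator[OF T(1) GGc]) (auto simp: GG_def)
    let ?q = "a \<otimes> x [^] (n - k)"
    have ac: "a \<in> carrier R" "g \<in> carrier R" "s \<in> carrier R" "d \<in> carrier R" "e \<in> carrier R"
      using sc step(1) gL D(1) u(2) e(1) lspan_submodule[OF S, of "G k"] 
        step(3) G submodule_overD(1)[OF lspan_submodule[OF S, of "G k"]] unfolding L_def by blast+
    have "?q \<in> ?T" using step(1) T(2) xn subringE(6)[OF T(1)] by blast
    then have 1: "?q \<otimes> lift k g \<oplus> u \<in> lspan R ?T GG" using LS lGG u(1) by blast
    have "x [^] (n - k) \<otimes> e \<in> bounded_degree S x (n - k + k)"
      by (rule bounded_degree_shift_pow[OF S x e(1)])
    then have 2: "a \<otimes> (x [^] (n - k) \<otimes> e) \<oplus> d \<in> bounded_degree S x n"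
      using k(1) D(3,4) step(1) u(2) by simp
    have p: "x [^] n = x [^] (n - k) \<otimes> x [^] k" using k(1) x by (simp add: nat_pow_mult)
    have "?q \<otimes> lift k g \<oplus> u = (a \<otimes> (x [^] (n - k) \<otimes> e) \<oplus> d) \<oplus> (a \<otimes> g \<oplus> s) \<otimes> x [^] n"
      unfolding e(2) u(3) p using ac xc[of k] xc[of "n - k"] by algebra
    with 1 2 show ?case by (intro bexI[of _ "?q \<otimes> lift k g \<oplus> u"] bexI) auto
  qed
  have "f \<in> lspan R ?T GG" if "f \<in> bounded_degree S x n" "f \<in> J" for n f
    using that
  proof (induction n arbitrary: f)
    case 0
    then show ?case using LS(2) by simp
  next
    case (Suc n)
    then obtain d s where f: "f = d \<oplus> s \<otimes> x [^] n" "d \<in> bounded_degree S x n" "s \<in> S" by auto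
    then have "s \<in> L n" using Suc.prems(2) unfolding L_def by blast
    then have "s \<in> L (min n n0)" using n0[of n] by (auto simp: min_def)
    then have "s \<in> lspan R S (G (min n n0))" using G by blast
    from lead[OF this, of n] obtain u e where u: "u \<in> lspan R ?T GG" "e \<in> bounded_degree S x n"
      "u = e \<oplus> s \<otimes> x [^] n" by auto
    have "f \<ominus> u = d \<ominus> e"
      unfolding f(1) u(3) using D(1)[OF f(2)] D(1)[OF u(2)] sc[OF f(3)] xc[of n] by algebra
    moreover have "d \<ominus> e \<in> bounded_degree S x n"
      by (rule submodule_over_minus[OF S bounded_degree_submodule[OF S x] f(2) u(2)])
    moreover have "f \<ominus> u \<in> J"
      using submodule_over_minus[OF T(1) J(1) Suc.prems(2)] LSJ u(1) by blast
    ultimately have "f \<ominus> u \<in> lspan R ?T GG" using Suc.IH by simp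
    then have "(f \<ominus> u) \<oplus> u \<in> lspan R ?T GG" using LS(3) u(1) by blast
    moreover have "(f \<ominus> u) \<oplus> u = f"
      using JD(1)[OF Suc.prems(2)] LS(1)[OF u(1)] by algebra
    ultimately show ?case by simp
  qed
  then have "J \<subseteq> lspan R ?T GG" using J(2) by blast
  with GG show "\<exists>G\<subseteq>J. finite G \<and> J \<subseteq> lspan R ?T G" by blast
qed

lemma add_pow_zero_int: "[(0::int)] \<cdot> a = \<zero>"
  by (simp add: add_pow_def)

lemma generate_empty:
  "generate_ring R {} = range (\<lambda>k::int. [k] \<cdot> \<one>)"
proof (intro equalityI subsetI)
  fix a assume "a \<in> generate_ring R {}"
  then show "a \<in> range (\<lambda>k::int. [k] \<cdot> \<one>)"
  proof induction
    case one
    have "\<one> = [(1::int)] \<cdot> \<one>" by (simp add: add.int_pow_1)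
    then show ?case by blast
  next
    case (a_inv a)
    then obtain k :: int where "a = [k] \<cdot> \<one>" by blast
    then have "\<ominus> a = [(- k)] \<cdot> \<one>" by (simp add: add.int_pow_neg)
    then show ?case by blast
  next
    case (eng_add a b)
    then obtain k l :: int where "a = [k] \<cdot> \<one>" "b = [l] \<cdot> \<one>" by blast
    then have "a \<oplus> b = [(k + l)] \<cdot> \<one>" by (simp add: add.int_pow_mult)
    then show ?case by blast
  next
    case (eng_mult a b)
    then obtain k l :: int where "a = [k] \<cdot> \<one>" "b = [l] \<cdot> \<one>" by blast
    then have "a \<otimes> b = [(l * k)] \<cdot> \<one>" by (simp add: add_pow_ldistr_int add.int_pow_pow)
    then show ?case by blast
  qed simp
next
  fix a assume "a \<in> range (\<lambda>k::int. [k] \<cdot> \<one>)"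
  then obtain k :: int where a: "a = [k] \<cdot> \<one>" by blast
  have n: "[n] \<cdot> \<one> \<in> generate_ring R {}" for n :: nat
    by (induction n) (auto simp: add.nat_pow_Suc intro: generate_ring.intros zero_in_generate)
  show "a \<in> generate_ring R {}"
    unfolding a by (cases "k \<ge> 0") (auto simp: add_pow_int_ge add_pow_int_lt n generate_ring.a_inv)
qed

text \<open>
  The prime subring is an image of the integers, so division with remainder applies: an ideal is
  generated by the least positive multiple of \<open>1\<close> that it contains, if there is one.
\<close>

lemma noetherian_generate_empty: "noetherian_over R (generate_ring R {})"
  unfolding noetherian_over_def
proof (intro allI impI)
  let ?Z = "generate_ring R {}"
  have Z: "subring ?Z R" by (rule generate_ring_is_subring) simp
  fix I assume I: "submodule_over R ?Z I" "I \<subseteq> ?Z"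
  note ID = submodule_overD[OF I(1)]
  show "\<exists>G\<subseteq>I. finite G \<and> I \<subseteq> lspan R ?Z G"
  proof (cases "\<exists>d::nat. d > 0 \<and> [int d] \<cdot> \<one> \<in> I")
    case True
    define d where "d = (LEAST d::nat. d > 0 \<and> [int d] \<cdot> \<one> \<in> I)"
    have d: "d > 0" "[int d] \<cdot> \<one> \<in> I"
      using LeastI_ex[OF True] unfolding d_def by blast+
    have least: "\<not> (k > 0 \<and> [int k] \<cdot> \<one> \<in> I)" if "k < d" for k
      using not_less_Least that unfolding d_def by blast
    have "a \<in> lspan R ?Z {[int d] \<cdot> \<one>}" if aI: "a \<in> I" for a
    proof -
      obtain k :: int where k: "a = [k] \<cdot> \<one>" using aI I(2) unfolding generate_empty by blast
      let ?q = "k div int d" and ?r = "k mod int d"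
      have qd: "[?q] \<cdot> \<one> \<otimes> [int d] \<cdot> \<one> = [(int d * ?q)] \<cdot> \<one>"
        by (simp add: add_pow_ldistr_int add.int_pow_pow)
      have qZ: "[?q] \<cdot> \<one> \<in> ?Z" using generate_empty by blast
      have c: "[l] \<cdot> \<one> \<in> carrier R" for l :: int by (rule add.int_pow_closed) simp
      have "a = [(int d * ?q + ?r)] \<cdot> \<one>" unfolding k by simp
      then have a: "a = [?q] \<cdot> \<one> \<otimes> [int d] \<cdot> \<one> \<oplus> [?r] \<cdot> \<one>"
        unfolding qd by (simp only: add.int_pow_mult one_closed)
      then have "[?r] \<cdot> \<one> = a \<ominus> [?q] \<cdot> \<one> \<otimes> [int d] \<cdot> \<one>"
        using c[of ?q] c[of "int d"] c[of ?r] by algebra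
      then have "[?r] \<cdot> \<one> \<in> I"
        using submodule_over_minus[OF Z I(1) that ID(4)[OF qZ d(2)]] by simp
      moreover have "?r = int (nat ?r)" "nat ?r < d" using d(1) by (auto simp: nat_less_iff)
      ultimately have "\<not> nat ?r > 0" using least[of "nat ?r"] by metis
      then have "?r = 0" using d(1) by (metis \<open>?r = int (nat ?r)\<close> gr0I of_nat_0)
      then have "a = [?q] \<cdot> \<one> \<otimes> [int d] \<cdot> \<one> \<oplus> \<zero>" using a by (simp add: add_pow_zero_int)
      then show ?thesis using lspan.step[OF qZ _ lspan.zero] by (metis insertI1)
    qed
    then show ?thesis using d by (intro exI[of _ "{[int d] \<cdot> \<one>}"]) auto
  next
    case False
    have "a = \<zero>" if aI: "a \<in> I" for a
    proof -
      obtain k :: int where k: "a = [k] \<cdot> \<one>" using aI I(2) unfolding generate_empty by blast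
      have "\<ominus> a \<in> I" using submodule_over_minus[OF Z I(1) ID(2) that] ID(1)[OF that]
        by (simp add: a_minus_def)
      moreover have "\<ominus> a = [(- k)] \<cdot> \<one>" unfolding k by (simp add: add.int_pow_neg)
      ultimately have "[k] \<cdot> \<one> \<in> I" "[(- k)] \<cdot> \<one> \<in> I" using that k by auto
      then have "\<not> nat k > 0" "\<not> nat (- k) > 0"
        using False[unfolded not_ex, THEN spec, of "nat k"]
          False[unfolded not_ex, THEN spec, of "nat (- k)"] by (cases "k > 0"; auto)+
      then have "k = 0" by simp
      then show ?thesis using k by (simp add: add_pow_zero_int)
    qed
    then show ?thesis by (intro exI[of _ "{}"]) (auto intro: lspan.zero)
  qed
qed

lemma noetherian_over_generate_ring:
  assumes "finite H" "H \<subseteq> carrier R"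
  shows "noetherian_over R (generate_ring R H)"
  using assms
proof (induction H rule: finite_induct)
  case empty
  show ?case by (rule noetherian_generate_empty)
next
  case (insert x H)
  let ?S = "generate_ring R H"
  let ?T = "\<Union>n. bounded_degree ?S x n"
  have S: "subring ?S R" and x: "x \<in> carrier R"
    using insert.prems by (auto intro: generate_ring_is_subring)
  note T = adjoin_bounded_degree[OF S x]
  have "generate_ring R (insert x H) = ?T"
  proof (rule generate_ringI[symmetric])
    show "insert x H \<subseteq> carrier R" by (rule insert.prems)
    show "subring ?T R" by (rule T(1))
    show "insert x H \<subseteq> ?T" using T generate_ring.incl[of _ H R] by blast
    fix K assume K: "subring K R" "insert x H \<subseteq> K"
    have SK: "?S \<subseteq> K" using generate_ring_min_subring1[of H K] K insert.prems by blast
    have xK: "x [^] n \<in> K" for n :: nat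
      by (induction n) (use subringE[OF K(1)] K(2) in auto)
    have "bounded_degree ?S x n \<subseteq> K" for n
    proof (induction n)
      case (Suc n)
      then show ?case using SK xK[of n] subringE(6,7)[OF K(1)] by (auto simp: subset_iff)
    qed (use subringE[OF K(1)] in auto)
    then show "?T \<subseteq> K" by blast
  qed
  then show ?case using noetherian_adjoin[OF S x] insert by simp
qed

lemma noetherian_if_finitely_generated:
  assumes "finitely_generated_ring R"
  shows "noetherian_over R (carrier R)"
  using assms noetherian_over_generate_ring unfolding finitely_generated_ring_def by metis

lemma carrier_subring: "subring (carrier R) R"
  by (rule subringI) auto

lemma tuple_combination_closed:
  fixes K :: "(nat \<Rightarrow> 'a) set" and r :: nat
  assumes "tuple_submodule R K" "valuation R c" "\<forall>i. g i \<in> K"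
  shows "(\<lambda>j. \<Oplus>i\<in>{..<r}. c i \<otimes> g i j) \<in> K"
proof (induction r)
  note K = tuple_submoduleD[OF assms(1)]
  case 0
  show ?case using K(2) by simp
next
  note K = tuple_submoduleD[OF assms(1)]
  case (Suc r)
  from K(3)[OF Suc.IH K(4)[OF assms(2)[rule_format] assms(3)[rule_format]]]
  show ?case using assms(2,3) K(1) by (simp add: finsum_lessThan_Suc)
qed

text \<open>
  Finite generation of submodules of \<open>R\<^sup>m\<close>, by induction on \<open>m\<close>: the last coordinates form an ideal,
  and correcting by lifts of its generators leaves a tuple with last coordinate zero. Tuples are
  infinite sequences, and the conclusion only concerns their first \<open>m\<close> entries.
\<close>

lemma submodule_of_tuples_finitely_generated:
  fixes K :: "(nat \<Rightarrow> 'a) set" and m :: nat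
  assumes noeth: "noetherian_over R (carrier R)"
    and K: "tuple_submodule R K"
  shows "\<exists>r g. (\<forall>i. g i \<in> K) \<and> (\<forall>k\<in>K. \<exists>c. valuation R c \<and>
    (\<forall>j<m. k j = (\<Oplus>i\<in>{..<r::nat}. c i \<otimes> g i j)))"
  using K
proof (induction m arbitrary: K)
  case 0
  show ?case by (intro exI[of _ 0] exI[of _ "\<lambda>i j. \<zero>"]) (use tuple_submoduleD(2)[OF 0] in \<open>auto intro!: exI[of _ "\<lambda>i. \<zero>"]\<close>)
next
  case (Suc m)
  note K = tuple_submoduleD[OF Suc.prems]
  have combo: "(\<lambda>j. \<Oplus>i\<in>{..<r}. c i \<otimes> g i j) \<in> K"
    if "valuation R c" "\<forall>i. g i \<in> K" for c g and r :: nat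
    by (rule tuple_combination_closed[OF Suc.prems that])
  let ?L = "(\<lambda>k. k m) ` K"
  have "submodule_over R (carrier R) ?L"
    unfolding submodule_over_def
  proof (intro conjI ballI subsetI)
    show "\<zero> \<in> ?L" using K(2) by force
    fix a assume a: "a \<in> ?L"
    then obtain k where k: "k \<in> K" "a = k m" by blast
    then show "a \<in> carrier R" using K(1) by simp
    {
      fix b assume "b \<in> ?L"
      then obtain l where "l \<in> K" "b = l m" by blast
      then show "a \<oplus> b \<in> ?L" using K(3)[OF k(1)] k(2) by force
    }
    {
      fix s assume "s \<in> carrier R"
      then show "s \<otimes> a \<in> ?L" using K(4) k by force
    }
  qed
  moreover have "?L \<subseteq> carrier R" using K(1) by auto
  ultimately obtain G where G: "G \<subseteq> ?L" "finite G" "?L \<subseteq> lspan R (carrier R) G"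
    using noeth unfolding noetherian_over_def by blast
  obtain g0 r where g0: "G = g0 ` {..<r::nat}" using finite_enumeration[OF G(2)] by blast
  have "\<forall>i. \<exists>k. k \<in> K \<and> (i < r \<longrightarrow> k m = g0 i)" 
  proof
    fix i
    show "\<exists>k. k \<in> K \<and> (i < r \<longrightarrow> k m = g0 i)"
    proof (cases "i < r")
      case True
      then have "g0 i \<in> ?L" using G(1) g0 by blast
      then show ?thesis by auto
    qed (use K(2) in blast)
  qed
  then obtain g where g: "\<forall>i. g i \<in> K \<and> (i < r \<longrightarrow> g i m = g0 i)" by (rule choice[THEN exE])
  let ?K = "{k \<in> K. k m = \<zero>}"
  have "\<exists>r g. (\<forall>i. g i \<in> ?K) \<and> (\<forall>k\<in>?K. \<exists>c. valuation R c \<and>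
    (\<forall>j<m. k j = (\<Oplus>i\<in>{..<r::nat}. c i \<otimes> g i j)))"
    by (rule Suc.IH) (use K in \<open>auto simp: tuple_submodule_def\<close>)
  then obtain s h where h: "\<forall>i. h i \<in> ?K" "\<forall>k\<in>?K. \<exists>c. valuation R c \<and>
    (\<forall>j<m. k j = (\<Oplus>i\<in>{..<s::nat}. c i \<otimes> h i j))" by (elim exE conjE)
  let ?g = "\<lambda>i. if i < r then g i else h (i - r)"
  show ?case
  proof (intro exI[of _ "r + s"] exI[of _ ?g] conjI ballI)
    show "\<forall>i. ?g i \<in> K" using g h(1) by auto
    fix k assume k: "k \<in> K"
    then have "k m \<in> lspan R (carrier R) (g0 ` {..<r})" using G(3) g0 by blast
    moreover have "g0 ` {..<r} \<subseteq> carrier R" using G(1) g0 K(1) by auto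
    ultimately obtain c where c: "valuation R c" "k m = (\<Oplus>i\<in>{..<r}. c i \<otimes> g0 i)"
      using lspan_finite_sum[OF carrier_subring] by blast
    have gc: "g i j \<in> carrier R" for i j using g K(1) by blast
    have hc: "h i j \<in> carrier R" for i j using h(1) K(1) by blast
    have c': "k m = (\<Oplus>i\<in>{..<r}. c i \<otimes> g i m)"
      unfolding c(2) by (rule finsum_cong') (use g c gc in auto)
    let ?q = "\<lambda>j. \<Oplus>i\<in>{..<r}. c i \<otimes> g i j"
    have q: "?q \<in> K" by (rule combo) (use c g in auto)
    let ?k = "\<lambda>j. k j \<oplus> (\<ominus> \<one>) \<otimes> ?q j"
    have kc: "k j \<in> carrier R" "?q j \<in> carrier R" for j using k K(1) K(1)[OF q] by auto
    have "?k \<in> K" by (rule K(3)[OF k K(4)[OF _ q]]) simp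
    moreover have "?k m = \<zero>" using kc[of m] c' by (simp add: l_minus r_neg)
    ultimately have "?k \<in> ?K" by simp
    from h(2)[rule_format, OF this] obtain d where d: "valuation R d"
      "\<forall>j<m. ?k j = (\<Oplus>i\<in>{..<s}. d i \<otimes> h i j)" by (elim exE conjE)
    let ?c = "\<lambda>i. if i < r then c i else d (i - r)"
    show "\<exists>c. valuation R c \<and> (\<forall>j<Suc m. k j = (\<Oplus>i\<in>{..<r + s}. c i \<otimes> ?g i j))"
    proof (intro exI[of _ ?c] conjI allI impI)
      show "?c i \<in> carrier R" for i using c d by auto
      fix j assume j: "j < Suc m"
      have "(\<Oplus>i\<in>{..<r + s}. ?c i \<otimes> ?g i j) =
        (\<Oplus>i\<in>{..<r}. ?c i \<otimes> ?g i j) \<oplus> (\<Oplus>i\<in>{..<s}. ?c (r + i) \<otimes> ?g (r + i) j)"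
        by (rule finsum_append) (use c d gc hc in auto)
      also have "(\<Oplus>i\<in>{..<r}. ?c i \<otimes> ?g i j) = ?q j"
        by (rule finsum_cong') (use c gc in auto)
      also have "(\<Oplus>i\<in>{..<s}. ?c (r + i) \<otimes> ?g (r + i) j) = (\<Oplus>i\<in>{..<s}. d i \<otimes> h i j)"
        by (rule finsum_cong') (use d hc in auto)
      also have "\<dots> = ?k j"
      proof (cases "j = m")
        case True
        have "(\<Oplus>i\<in>{..<s}. d i \<otimes> h i m) = (\<Oplus>i\<in>{..<s}. \<zero>)"
          by (rule finsum_cong') (use d h(1) in auto)
        then show ?thesis using True \<open>?k m = \<zero>\<close> by simp
      next
        case False
        then show ?thesis using j d(2) by simp
      qed
      also have "?q j \<oplus> ?k j = k j"
      proof -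
        have "a \<oplus> (b \<oplus> (\<ominus> \<one>) \<otimes> a) = b" if "a \<in> carrier R" "b \<in> carrier R" for a b
          using that by algebra
        then show ?thesis using kc[of j] by simp
      qed
      finally show "k j = (\<Oplus>i\<in>{..<r + s}. ?c i \<otimes> ?g i j)" by simp
    qed
  qed
qed

end

section \<open>Powers with prime exponent\<close>

text \<open>
  The integral polynomial \<open>((x + y)\<^sup>p - x\<^sup>p - y\<^sup>p) / p\<close>: up to sign, the carry in the addition of Witt
  vectors of length two.
\<close>

definition power_carry :: "('a, 'x) ring_scheme \<Rightarrow> nat \<Rightarrow> 'a \<Rightarrow> 'a \<Rightarrow> 'a" where
  "power_carry R p x y = (\<Oplus>\<^bsub>R\<^esub>k\<in>{1..<p}.
     ([((p choose k) div p)] \<cdot>\<^bsub>R\<^esub> \<one>\<^bsub>R\<^esub>) \<otimes>\<^bsub>R\<^esub> (x [^]\<^bsub>R\<^esub> k \<otimes>\<^bsub>R\<^esub> y [^]\<^bsub>R\<^esub> (p - k)))"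

context cring
begin

lemma natural_closed [simp, intro]: "[(k::nat)] \<cdot> \<one> \<in> carrier R"
  by (rule add.nat_pow_closed) simp

lemma natural_add: "[(k + l::nat)] \<cdot> \<one> = [k] \<cdot> \<one> \<oplus> [l] \<cdot> \<one>"
  by (simp add: add.nat_pow_mult)

lemma natural_mult: "[(k * l::nat)] \<cdot> \<one> = [k] \<cdot> \<one> \<otimes> [l] \<cdot> \<one>"
  by (simp add: add_pow_ldistr add.nat_pow_pow mult.commute)

lemma natural_scale: "x \<in> carrier R \<Longrightarrow> [(k::nat)] \<cdot> x = [k] \<cdot> \<one> \<otimes> x"
  by (simp add: add_pow_ldistr)

lemma natural_0 [simp]: "[(0::nat)] \<cdot> \<one> = \<zero>"
  by (simp add: add_pow_def)

lemma natural_1 [simp]: "[Suc 0] \<cdot> \<one> = \<one>"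
  by (simp add: add_pow_def)

lemma binomial_formula:
  assumes x: "x \<in> carrier R" and y: "y \<in> carrier R"
  shows "(x \<oplus> y) [^] n = (\<Oplus>k\<in>{..n}. [(n choose k)] \<cdot> \<one> \<otimes> (x [^] k \<otimes> y [^] (n - k)))"
proof (induction n)
  case 0
  then show ?case by simp
next
  case (Suc n)
  let ?f = "\<lambda>k. [(n choose k)] \<cdot> \<one> \<otimes> (x [^] k \<otimes> y [^] (n - k))"
  let ?g = "\<lambda>k. [(n choose k)] \<cdot> \<one> \<otimes> (x [^] k \<otimes> y [^] (Suc n - k))"
  let ?u = "\<lambda>k. [(n choose k)] \<cdot> \<one> \<otimes> (x [^] Suc k \<otimes> y [^] (n - k))"
  let ?v = "\<lambda>k. [(n choose Suc k)] \<cdot> \<one> \<otimes> (x [^] Suc k \<otimes> y [^] (n - k))"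
  let ?F = "\<lambda>k. [(Suc n choose k)] \<cdot> \<one> \<otimes> (x [^] k \<otimes> y [^] (Suc n - k))"
  have c: "?f k \<in> carrier R" "?g k \<in> carrier R" "?u k \<in> carrier R" "?v k \<in> carrier R" 
    "?F k \<in> carrier R" for k
    using x y by auto
  have cs: "(\<Oplus>k\<in>{..m}. ?f k) \<in> carrier R" "(\<Oplus>k\<in>{..m}. ?u k) \<in> carrier R"
    "(\<Oplus>k\<in>{..m}. ?v k) \<in> carrier R" "(\<Oplus>k\<in>{..m}. ?g k) \<in> carrier R" for m
    by (rule finsum_closed; use c in blast)+
  have F0: "?F 0 = y [^] Suc n" "?g 0 = y [^] Suc n" using x y by simp_all
  have 1: "x \<otimes> (\<Oplus>k\<in>{..n}. ?f k) = (\<Oplus>k\<in>{..n}. ?u k)"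
  proof -
    have "x \<otimes> ?f k = ?u k" for k
      using x y natural_closed[of "n choose k"] by (simp add: m_ac)
    moreover have "x \<otimes> (\<Oplus>k\<in>{..n}. ?f k) = (\<Oplus>k\<in>{..n}. x \<otimes> ?f k)"
      by (rule finsum_rdistr) (use c x in auto)
    ultimately show ?thesis by simp
  qed
  have 2: "y \<otimes> (\<Oplus>k\<in>{..n}. ?f k) = (\<Oplus>k\<in>{..n}. ?v k) \<oplus> y [^] Suc n"
  proof -
    have "y \<otimes> (\<Oplus>k\<in>{..n}. ?f k) = (\<Oplus>k\<in>{..n}. y \<otimes> ?f k)"
      by (rule finsum_rdistr) (use c y in auto)
    also have "\<dots> = (\<Oplus>k\<in>{..n}. ?g k)"
    proof (rule finsum_cong')
      fix k assume "k \<in> {..n}"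
      then have "y [^] (Suc n - k) = y \<otimes> y [^] (n - k)" using y by (simp add: Suc_diff_le m_comm)
      then show "y \<otimes> ?f k = ?g k"
        using x y natural_closed[of "n choose k"] by (simp add: m_ac)
    qed (use c in auto)
    also have "\<dots> = (\<Oplus>k\<in>{..Suc n}. ?g k)"
    proof -
      have "(\<Oplus>k\<in>{..Suc n}. ?g k) = ?g (Suc n) \<oplus> (\<Oplus>k\<in>{..n}. ?g k)"
        by (rule finsum_Suc) (use c in blast)
      then show ?thesis using cs(4)[of n] x by (simp add: binomial_eq_0)
    qed
    also have "\<dots> = (\<Oplus>k\<in>{..n}. ?g (Suc k)) \<oplus> ?g 0"
      by (rule finsum_Suc2) (use c in blast)
    finally show ?thesis unfolding F0 by simp
  qed
  have "(\<Oplus>k\<in>{..Suc n}. ?F k) = (\<Oplus>k\<in>{..n}. ?F (Suc k)) \<oplus> ?F 0"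
    by (rule finsum_Suc2) (use c in blast)
  also have "(\<Oplus>k\<in>{..n}. ?F (Suc k)) = (\<Oplus>k\<in>{..n}. ?u k \<oplus> ?v k)"
  proof (rule finsum_cong')
    fix k
    have "?F (Suc k) = [((n choose k) + (n choose Suc k))] \<cdot> \<one> \<otimes> (x [^] Suc k \<otimes> y [^] (n - k))"
      by simp
    also have "\<dots> = ?u k \<oplus> ?v k" unfolding natural_add using x y by (simp add: l_distr)
    finally show "?F (Suc k) = ?u k \<oplus> ?v k" .
  qed (use c in auto)
  also have "\<dots> = (\<Oplus>k\<in>{..n}. ?u k) \<oplus> (\<Oplus>k\<in>{..n}. ?v k)"
    by (rule finsum_addf) (use c in auto)
  finally have "(\<Oplus>k\<in>{..Suc n}. ?F k) = x \<otimes> (\<Oplus>k\<in>{..n}. ?f k) \<oplus> y \<otimes> (\<Oplus>k\<in>{..n}. ?f k)"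
    unfolding 1 2 F0 using cs y by (simp add: a_assoc)
  also have "\<dots> = (x \<oplus> y) [^] Suc n"
    using Suc x y cs(1) by (simp add: l_distr[symmetric] m_comm)
  finally show ?case by simp
qed

lemma power_carry_closed [simp, intro]:
  "x \<in> carrier R \<Longrightarrow> y \<in> carrier R \<Longrightarrow> power_carry R p x y \<in> carrier R"
  unfolding power_carry_def by (rule finsum_closed) auto

lemma prime_power_add:
  assumes "Factorial_Ring.prime (p::nat)" and x: "x \<in> carrier R" and y: "y \<in> carrier R"
  shows "(x \<oplus> y) [^] p = x [^] p \<oplus> y [^] p \<oplus> [p] \<cdot> \<one> \<otimes> power_carry R p x y"
proof -
  let ?f = "\<lambda>k. [(p choose k)] \<cdot> \<one> \<otimes> (x [^] k \<otimes> y [^] (p - k))"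
  let ?g = "\<lambda>k. [((p choose k) div p)] \<cdot> \<one> \<otimes> (x [^] k \<otimes> y [^] (p - k))"
  have c: "?f k \<in> carrier R" "?g k \<in> carrier R" for k using x y by auto
  have p: "p > 1" using assms(1) by (rule prime_gt_1_nat)
  have mid: "(\<Oplus>k\<in>{1..<p}. ?f k) = [p] \<cdot> \<one> \<otimes> power_carry R p x y"
  proof -
    have "(\<Oplus>k\<in>{1..<p}. ?f k) = (\<Oplus>k\<in>{1..<p}. [p] \<cdot> \<one> \<otimes> ?g k)"
    proof (rule finsum_cong')
      fix k assume "k \<in> {1..<p}"
      then have "p dvd (p choose k)" using assms(1) by (intro dvd_choose_prime) auto
      then have "p choose k = p * ((p choose k) div p)" by simp
      then have "[(p choose k)] \<cdot> \<one> = [p] \<cdot> \<one> \<otimes> [((p choose k) div p)] \<cdot> \<one>"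
        using natural_mult by metis
      then show "?f k = [p] \<cdot> \<one> \<otimes> ?g k" using x y by (simp add: m_assoc)
    qed (use c in auto)
    also have "\<dots> = [p] \<cdot> \<one> \<otimes> power_carry R p x y"
      unfolding power_carry_def by (rule finsum_rdistr[symmetric]) (use c in auto)
    finally show ?thesis .
  qed
  have "{..p} = insert 0 (insert p {1..<p})" using p by auto
  then have "(x \<oplus> y) [^] p = (\<Oplus>k\<in>insert 0 (insert p {1..<p}). ?f k)"
    unfolding binomial_formula[OF x y] by (rule arg_cong)
  also have "\<dots> = ?f 0 \<oplus> (\<Oplus>k\<in>insert p {1..<p}. ?f k)"
    by (rule finsum_insert) (use p c x y in auto)
  also have "(\<Oplus>k\<in>insert p {1..<p}. ?f k) = ?f p \<oplus> (\<Oplus>k\<in>{1..<p}. ?f k)"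
    by (rule finsum_insert) (use p c x y in auto)
  finally have "(x \<oplus> y) [^] p = ?f 0 \<oplus> (?f p \<oplus> (\<Oplus>k\<in>{1..<p}. ?f k))" .
  also have "\<dots> = x [^] p \<oplus> y [^] p \<oplus> [p] \<cdot> \<one> \<otimes> power_carry R p x y"
    unfolding mid using x y by (simp add: a_ac)
  finally show ?thesis .
qed

text \<open>
  All terms of the binomial expansion from the second power of \<open>w\<close> on vanish.
\<close>

lemma power_add_square_zero:
  assumes x: "x \<in> carrier R" and w: "w \<in> carrier R" "w \<otimes> w = \<zero>"
  shows "(x \<oplus> w) [^] Suc n = x [^] Suc n \<oplus> [Suc n] \<cdot> \<one> \<otimes> (x [^] n \<otimes> w)"
proof (induction n)
  case 0
  then show ?case using x w by simp
next
  case (Suc n)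
  let ?N = "[Suc n] \<cdot> \<one>" and ?X = "x [^] n"
  have c: "?X \<in> carrier R" "?N \<in> carrier R" using x by auto
  have s: "[Suc (Suc n)] \<cdot> \<one> = ?N \<oplus> \<one>" using natural_add[of "Suc n" 1] by simp
  have "(x \<oplus> w) [^] Suc (Suc n) = (?X \<otimes> x \<oplus> ?N \<otimes> (?X \<otimes> w)) \<otimes> (x \<oplus> w)"
    using Suc x by simp
  also have "\<dots> = ?X \<otimes> x \<otimes> x \<oplus> (?N \<oplus> \<one>) \<otimes> (?X \<otimes> x \<otimes> w) \<oplus> ?N \<otimes> ?X \<otimes> (w \<otimes> w)"
    using c x w(1) by algebra
  also have "\<dots> = x [^] Suc (Suc n) \<oplus> [Suc (Suc n)] \<cdot> \<one> \<otimes> (x [^] Suc n \<otimes> w)"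
    unfolding s w(2) using c x w(1) by simp
  finally show ?case .
qed

text \<open>
  The elements \<open>x\<^sup>p + p z\<close> form a subring because the carry of a sum of \<open>p\<close>-th powers is a multiple
  of \<open>p\<close>.
\<close>

definition prime_power_subring :: "nat \<Rightarrow> 'a set" where
  "prime_power_subring p = {x [^] p \<oplus> [p] \<cdot> \<one> \<otimes> z | x z. x \<in> carrier R \<and> z \<in> carrier R}"

lemma prime_power_subringI:
  "x \<in> carrier R \<Longrightarrow> z \<in> carrier R \<Longrightarrow> x [^] p \<oplus> [p] \<cdot> \<one> \<otimes> z \<in> prime_power_subring p"
  unfolding prime_power_subring_def by blast

lemma prime_power_subring:
  assumes p: "Factorial_Ring.prime (p::nat)"
  shows "subring (prime_power_subring p) R"
proof (rule subringI)
  let ?P = "[p] \<cdot> \<one>"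
  have p0: "p > 0" using p by (rule prime_gt_0_nat)
  show "prime_power_subring p \<subseteq> carrier R" unfolding prime_power_subring_def by auto
  have "\<one> = \<one> [^] p \<oplus> ?P \<otimes> \<zero>" by simp
  then show "\<one> \<in> prime_power_subring p" using prime_power_subringI[of \<one> \<zero> p] by simp
  have add: "f \<oplus> g \<in> prime_power_subring p"
    if "f \<in> prime_power_subring p" "g \<in> prime_power_subring p" for f g
  proof -
    obtain x z u v where 1: "x \<in> carrier R" "z \<in> carrier R" "u \<in> carrier R" "v \<in> carrier R"
      "f = x [^] p \<oplus> ?P \<otimes> z" "g = u [^] p \<oplus> ?P \<otimes> v"
      using \<open>f \<in> prime_power_subring p\<close> \<open>g \<in> prime_power_subring p\<close>
      unfolding prime_power_subring_def by blast
    let ?c = "power_carry R p x u"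
    have c: "?c \<in> carrier R" "x [^] p \<in> carrier R" "u [^] p \<in> carrier R" "?P \<in> carrier R"
      using 1 by auto
    have "f \<oplus> g = (x \<oplus> u) [^] p \<oplus> ?P \<otimes> (z \<oplus> v \<ominus> ?c)"
      unfolding prime_power_add[OF p 1(1,3)] 1(5,6) using c 1(1-4) by algebra
    then show ?thesis using prime_power_subringI[of "x \<oplus> u" "z \<oplus> v \<ominus> ?c" p] 1 c by simp
  qed
  fix f g assume f: "f \<in> prime_power_subring p" and g: "g \<in> prime_power_subring p"
  show "f \<oplus> g \<in> prime_power_subring p" by (rule add[OF f g])
  obtain x z u v where 1: "x \<in> carrier R" "z \<in> carrier R" "u \<in> carrier R" "v \<in> carrier R"
    "f = x [^] p \<oplus> ?P \<otimes> z" "g = u [^] p \<oplus> ?P \<otimes> v"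
    using f g unfolding prime_power_subring_def by blast
  have c: "x [^] p \<in> carrier R" "u [^] p \<in> carrier R" "?P \<in> carrier R" using 1 by auto
  have "f \<otimes> g = (x [^] p \<otimes> u [^] p) \<oplus> ?P \<otimes> (x [^] p \<otimes> v \<oplus> u [^] p \<otimes> z \<oplus> ?P \<otimes> (z \<otimes> v))"
    unfolding 1(5,6) using c 1(1-4) by algebra
  then have "f \<otimes> g = (x \<otimes> u) [^] p \<oplus> ?P \<otimes> (x [^] p \<otimes> v \<oplus> u [^] p \<otimes> z \<oplus> ?P \<otimes> (z \<otimes> v))"
    using nat_pow_distrib[OF 1(1,3)] by simp
  then show "f \<otimes> g \<in> prime_power_subring p" 
    using prime_power_subringI[of "x \<otimes> u" "x [^] p \<otimes> v \<oplus> u [^] p \<otimes> z \<oplus> ?P \<otimes> (z \<otimes> v)" p] 1 c by simp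
  have fc: "f \<in> carrier R" using 1 c by simp
  \<comment> \<open>The negative of \<open>f\<close> is \<open>(p - 1) f + p (- f)\<close>, which works for \<open>p = 2\<close> as well.\<close>
  have "[k] \<cdot> \<one> \<otimes> f \<in> prime_power_subring p" for k :: nat
  proof (induction k)
    case 0
    have "\<zero> [^] p \<oplus> ?P \<otimes> \<zero> = \<zero>" using p0 by (simp add: nat_pow_zero)
    then show ?case using prime_power_subringI[of \<zero> \<zero> p] fc by simp
  next
    case (Suc k)
    have "[Suc k] \<cdot> \<one> \<otimes> f = [k] \<cdot> \<one> \<otimes> f \<oplus> f"
      using natural_add[of k 1] fc by (simp add: l_distr)
    then show ?case using add[OF Suc f] by simp
  qed
  moreover have "\<zero> [^] p \<oplus> ?P \<otimes> (\<ominus> f) \<in> prime_power_subring p"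
    by (rule prime_power_subringI) (use fc in auto)
  ultimately have "[(p - 1)] \<cdot> \<one> \<otimes> f \<oplus> (\<zero> [^] p \<oplus> ?P \<otimes> (\<ominus> f)) \<in> prime_power_subring p"
    by (rule add)
  moreover have "[(p - 1)] \<cdot> \<one> \<otimes> f \<oplus> (\<zero> [^] p \<oplus> ?P \<otimes> (\<ominus> f)) = \<ominus> f"
  proof -
    have P: "?P = [(p - 1)] \<cdot> \<one> \<oplus> \<one>" using natural_add[of "p - 1" 1] p0 by simp
    have z: "\<zero> [^] p = \<zero>" using p0 by (simp add: nat_pow_zero)
    have "a \<otimes> f \<oplus> (\<zero> \<oplus> (a \<oplus> \<one>) \<otimes> (\<ominus> f)) = \<ominus> f" if "a \<in> carrier R" for a
      using that fc by algebra
    then show ?thesis unfolding P z by simp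
  qed
  ultimately show "\<ominus> f \<in> prime_power_subring p" by simp
qed

text \<open>
  If a subring contains the \<open>p\<close>-th powers of all elements, then adjoining an element \<open>x\<close> amounts to
  adjoining the powers \<open>x\<^sup>i\<close> with \<open>i < p\<close> as module generators.
\<close>

lemma generate_ring_finite_over_powers:
  assumes S: "subring S R" and pow: "\<And>x. x \<in> carrier R \<Longrightarrow> x [^] (p::nat) \<in> S" and p: "p > 0"
    and H: "finite H" "H \<subseteq> carrier R"
  shows "\<exists>Y\<subseteq>carrier R. finite Y \<and> generate_ring R H \<subseteq> lspan R S Y"
proof -
  note SE = subringE[OF S]
  have "\<exists>Y\<subseteq>carrier R. finite Y \<and> H \<subseteq> lspan R S Y \<and> \<one> \<in> lspan R S Y \<and>
    (\<forall>s\<in>lspan R S Y. \<forall>t\<in>lspan R S Y. s \<otimes> t \<in> lspan R S Y)"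
    using H
  proof (induction H rule: finite_induct)
    case empty
    have Sl: "S \<subseteq> lspan R S {\<one>}"
    proof
      fix s assume "s \<in> S"
      then have "s \<otimes> \<one> \<oplus> \<zero> \<in> lspan R S {\<one>}" by (intro lspan.intros) auto
      then show "s \<in> lspan R S {\<one>}" using \<open>s \<in> S\<close> SE(1) by (auto simp: subset_iff)
    qed
    have "submodule_over R S S" unfolding submodule_over_def using SE by auto
    then have "lspan R S {\<one>} \<subseteq> S" using SE(3) by (intro lspan_subset) auto
    then have "lspan R S {\<one>} = S" using Sl by blast
    then show ?case using SE by (intro exI[of _ "{\<one>}"]) auto
  next
    case (insert x H)
    then obtain Y where Y: "Y \<subseteq> carrier R" "finite Y" "H \<subseteq> lspan R S Y" "\<one> \<in> lspan R S Y"
      "\<And>s t. s \<in> lspan R S Y \<Longrightarrow> t \<in> lspan R S Y \<Longrightarrow> s \<otimes> t \<in> lspan R S Y" by auto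
    have x: "x \<in> carrier R" using insert by simp
    let ?Z = "(\<lambda>(y, i). y \<otimes> x [^] i) ` (Y \<times> {..<p})"
    have Z: "?Z \<subseteq> carrier R" "finite ?Z" using Y(1,2) x by auto
    let ?T = "lspan R S Y" and ?U = "lspan R S ?Z"
    note T = submodule_overD[OF lspan_submodule[OF S Y(1)]]
    note U = submodule_overD[OF lspan_submodule[OF S Z(1)]]
    have YU: "y \<otimes> x [^] i \<in> ?U" if "y \<in> Y" "i < p" for y i
      using that by (intro lspan_generator[OF S Z(1)]) auto
    have TU: "t \<otimes> x [^] i \<in> ?U" if "t \<in> ?T" "i < p" for t i
      using that(1)
    proof induction
      case zero
      then show ?case using U(2) x by simp
    next
      case (step s y t)
      have c: "s \<in> carrier R" "y \<in> carrier R" "t \<in> carrier R" using step SE(1) Y(1) T(1) by blast+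
      have "(s \<otimes> y \<oplus> t) \<otimes> x [^] i = s \<otimes> (y \<otimes> x [^] i) \<oplus> t \<otimes> x [^] i"
        using c x by (simp add: l_distr m_assoc)
      then show ?case using U(3)[OF U(4)[OF step(1) YU[OF step(2) that(2)]] step.IH] by simp
    qed
    have TU0: "t \<in> ?U" if "t \<in> ?T" for t
      using TU[OF that p] T(1)[OF that] by simp
    have xU: "x \<otimes> u \<in> ?U" if "u \<in> ?U" for u
      using that
    proof induction
      case zero
      then show ?case using U(2) x by simp
    next
      case (step s z u)
      then obtain y i where z: "z = y \<otimes> x [^] i" "y \<in> Y" "i < p" by auto
      have c: "s \<in> carrier R" "y \<in> carrier R" "u \<in> carrier R" using step SE(1) Y(1) z U(1) by blast+
      have e: "x \<otimes> (s \<otimes> z \<oplus> u) = s \<otimes> (y \<otimes> x [^] Suc i) \<oplus> x \<otimes> u"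
        unfolding z(1) nat_pow_Suc using c x nat_pow_closed[OF x, of i] by algebra
      have "y \<otimes> x [^] Suc i \<in> ?U"
      proof (cases "Suc i < p")
        case True
        then show ?thesis using YU z by blast
      next
        case False
        then have "Suc i = p" using z by simp
        then have "y \<otimes> x [^] Suc i = x [^] p \<otimes> y" using c x by (simp add: m_comm del: nat_pow_Suc)
        moreover have "y \<in> ?T" by (rule lspan_generator[OF S Y(1) z(2)])
        ultimately show ?thesis using U(4)[OF pow[OF x] TU0] by simp
      qed
      then show ?case unfolding e using U(3,4) step by blast
    qed
    have xpU: "x [^] i \<otimes> u \<in> ?U" if "u \<in> ?U" for u and i :: nat
    proof (induction i)
      case 0
      then show ?case using that U(1) by simp
    next
      case (Suc i)
      have "x [^] Suc i \<otimes> u = x \<otimes> (x [^] i \<otimes> u)" using x U(1)[OF that] by (simp add: m_ac)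
      then show ?case using xU[OF Suc] by simp
    qed
    have tU: "t \<otimes> u \<in> ?U" if "t \<in> ?T" "u \<in> ?U" for t u
      using that(2)
    proof induction
      case zero
      then show ?case using U(2) T(1)[OF that(1)] by simp
    next
      case (step s z u)
      then obtain y i where z: "z = y \<otimes> x [^] i" "y \<in> Y" "i < p" by auto
      have c: "s \<in> carrier R" "y \<in> carrier R" "u \<in> carrier R" "t \<in> carrier R"
        using step SE(1) Y(1) z U(1) T(1)[OF that(1)] by blast+
      have e: "t \<otimes> (s \<otimes> z \<oplus> u) = s \<otimes> ((t \<otimes> y) \<otimes> x [^] i) \<oplus> t \<otimes> u"
        unfolding z(1) using c nat_pow_closed[OF x, of i] by algebra
      have "(t \<otimes> y) \<otimes> x [^] i \<in> ?U"
        by (rule TU[OF Y(5)[OF that(1) lspan_generator[OF S Y(1) z(2)]] z(3)])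
      then show ?case unfolding e using U(3,4) step by blast
    qed
    have mult: "s \<otimes> u \<in> ?U" if "s \<in> ?U" "u \<in> ?U" for s u
      using that(1)
    proof induction
      case zero
      then show ?case using U(2) U(1)[OF that(2)] by simp
    next
      case (step s z v)
      then obtain y i where z: "z = y \<otimes> x [^] i" "y \<in> Y" "i < p" by auto
      have c: "s \<in> carrier R" "y \<in> carrier R" "u \<in> carrier R" "v \<in> carrier R"
        using step SE(1) Y(1) z U(1) that by blast+
      have e: "(s \<otimes> z \<oplus> v) \<otimes> u = s \<otimes> (y \<otimes> (x [^] i \<otimes> u)) \<oplus> v \<otimes> u"
        unfolding z(1) using c nat_pow_closed[OF x, of i] by algebra
      have "y \<otimes> (x [^] i \<otimes> u) \<in> ?U"
        by (rule tU[OF lspan_generator[OF S Y(1) z(2)] xpU[OF that(2)]])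
      then show ?case unfolding e using U(3,4) step by blast
    qed
    have "x \<otimes> \<one> \<in> ?U" by (rule xU[OF TU0[OF Y(4)]])
    then have "insert x H \<subseteq> ?U" using x TU0 Y(3) by auto
    then show ?case using TU0[OF Y(4)] mult by (intro exI[of _ ?Z] conjI ballI Z)
  qed
  then obtain Y where Y: "Y \<subseteq> carrier R" "finite Y" "H \<subseteq> lspan R S Y" "\<one> \<in> lspan R S Y"
    "\<And>s t. s \<in> lspan R S Y \<Longrightarrow> t \<in> lspan R S Y \<Longrightarrow> s \<otimes> t \<in> lspan R S Y" by blast
  note T = submodule_overD[OF lspan_submodule[OF S Y(1)]]
  have "subring (lspan R S Y) R"
  proof (rule subringI)
    show "lspan R S Y \<subseteq> carrier R" using T(1) by blast
    fix f g assume fg: "f \<in> lspan R S Y" "g \<in> lspan R S Y"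
    show "f \<otimes> g \<in> lspan R S Y" by (rule Y(5)[OF fg])
    show "f \<oplus> g \<in> lspan R S Y" by (rule T(3)[OF fg])
    have "(\<ominus> \<one>) \<otimes> f \<in> lspan R S Y" using SE(3,5) T(4) fg(1) by blast
    then show "\<ominus> f \<in> lspan R S Y" using T(1)[OF fg(1)] by (simp add: l_minus)
  qed (rule Y(4))
  then have "generate_ring R H \<subseteq> lspan R S Y"
    by (intro generate_ring_min_subring1 H(2) Y(3))
  then show ?thesis using Y by blast
qed

end

context ring_hom_cring
begin

lemma hom_natural: "h ([(k::nat)] \<cdot>\<^bsub>R\<^esub> \<one>\<^bsub>R\<^esub>) = [k] \<cdot>\<^bsub>S\<^esub> \<one>\<^bsub>S\<^esub>"
proof (induction k)
  case (Suc k)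
  then show ?case using R.natural_add[of k 1] S.natural_add[of k 1] by simp
qed simp

lemma finitely_generated_image:
  assumes "finitely_generated_ring R" and surj: "h ` carrier R = carrier S"
  shows "finitely_generated_ring S"
proof -
  obtain H where H: "finite H" "H \<subseteq> carrier R" "generate_ring R H = carrier R"
    using assms(1) unfolding finitely_generated_ring_def by blast
  have hH: "h ` H \<subseteq> carrier S" using H(2) by auto
  have "h x \<in> generate_ring S (h ` H)" if "x \<in> generate_ring R H" for x
    using that
  proof induction
    case (a_inv x)
    then show ?case using H(3) by (auto intro: generate_ring.intros)
  next
    case (eng_add x y)
    then show ?case using H(3) by (auto intro: generate_ring.intros)
  next
    case (eng_mult x y)
    then show ?case using H(3) by (auto intro: generate_ring.intros)
  qed (auto intro: generate_ring.intros)
  then have "carrier S \<subseteq> generate_ring S (h ` H)" unfolding surj[symmetric] H(3) by auto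
  then have "generate_ring S (h ` H) = carrier S" using S.generate_ring_incl[OF hH] by blast
  then show ?thesis unfolding finitely_generated_ring_def using H(1) hH by blast
qed

end

section \<open>Extensions by a square-zero principal ideal of prime characteristic\<close>

text \<open>
  The case \<open>eps = 0\<close> is included, so the results also apply to isomorphisms.
\<close>

locale infinitesimal_extension = dom: cring B + cod: cring A
  for B :: "('a, 'x) ring_scheme" (structure) and A :: "('b, 'y) ring_scheme" +
  fixes h :: "'a \<Rightarrow> 'b" and eps :: 'a and p :: nat
  assumes hom: "h \<in> ring_hom B A"
    and surj: "h ` carrier B = carrier A"
    and eps_closed: "eps \<in> carrier B"
    and eps_square: "eps \<otimes> eps = \<zero>"
    and prime: "Factorial_Ring.prime p"
    and eps_torsion: "[p] \<cdot> \<one> \<otimes> eps = \<zero>"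
    and h_eps: "h eps = \<zero>\<^bsub>A\<^esub>"
    and kernel: "\<And>x. x \<in> carrier B \<Longrightarrow> h x = \<zero>\<^bsub>A\<^esub> \<Longrightarrow> \<exists>b\<in>carrier B. x = b \<otimes> eps"
    and fin_gen: "finitely_generated_ring B"
begin

sublocale hom: ring_hom_cring B A h
  by unfold_locales (rule hom)

abbreviation "p\<^sub>B \<equiv> [p] \<cdot> \<one>"
abbreviation "p\<^sub>A \<equiv> [p] \<cdot>\<^bsub>A\<^esub> \<one>\<^bsub>A\<^esub>"

lemma p_pos: "p > 0"
  by (rule prime_gt_0_nat[OF prime])

lemmas h_natural = hom.hom_natural

lemma h_pow: "x \<in> carrier B \<Longrightarrow> h (x [^] (k::nat)) = h x [^]\<^bsub>A\<^esub> k"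
  by (induction k) auto

lemma h_carry:
  assumes "x \<in> carrier B" "y \<in> carrier B"
  shows "h (power_carry B p x y) = power_carry A p (h x) (h y)"
proof -
  let ?f = "\<lambda>k. ([((p choose k) div p)] \<cdot> \<one>) \<otimes>
    (x [^] k \<otimes> y [^] (p - k))"
  have "h (power_carry B p x y) = (\<Oplus>\<^bsub>A\<^esub>k\<in>{1..<p}. h (?f k))"
    unfolding power_carry_def by (subst hom.hom_finsum) (use assms in \<open>auto simp: comp_def\<close>)
  also have "\<dots> = power_carry A p (h x) (h y)"
    unfolding power_carry_def by (rule cod.finsum_cong') (use assms in \<open>auto simp: h_natural h_pow\<close>)
  finally show ?thesis .
qed

lemma h_eqE:
  assumes "x \<in> carrier B" "y \<in> carrier B" "h x = h y"
  obtains b where "b \<in> carrier B" "x = y \<oplus> b \<otimes> eps"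
proof -
  have "h (x \<ominus> y) = \<zero>\<^bsub>A\<^esub>"
    using assms by (simp add: a_minus_def cod.r_neg)
  then obtain b where b: "b \<in> carrier B" "x \<ominus> y = b \<otimes> eps"
    using kernel assms by blast
  have "x = y \<oplus> (x \<ominus> y)" using assms by algebra
  then show ?thesis using that b by simp
qed

lemma h_eq_iff:
  assumes "x \<in> carrier B" "y \<in> carrier B"
  shows "h x = h y \<longleftrightarrow> (\<exists>b\<in>carrier B. x = y \<oplus> b \<otimes> eps)"
proof
  assume "h x = h y"
  with assms show "\<exists>b\<in>carrier B. x = y \<oplus> b \<otimes> eps" by (metis h_eqE)
next
  assume "\<exists>b\<in>carrier B. x = y \<oplus> b \<otimes> eps"
  then show "h x = h y" using assms eps_closed by (auto simp: h_eps)
qed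

text \<open>
  By the binomial formula \<open>(y + b \<epsilon>)\<^sup>p = y\<^sup>p + p y\<^bsup>p-1\<^esup> b \<epsilon>\<close>, and \<open>p \<epsilon> = 0\<close>.
\<close>

lemma pow_cong:
  assumes "x \<in> carrier B" "y \<in> carrier B" "h x = h y"
  shows "x [^] p = y [^] p"
proof -
  obtain b where b: "b \<in> carrier B" "x = y \<oplus> b \<otimes> eps"
    using assms by (rule h_eqE)
  let ?w = "b \<otimes> eps"
  obtain n where n: "p = Suc n" using p_pos by (cases p) auto
  have w: "?w \<in> carrier B" using b eps_closed by simp
  have "?w \<otimes> ?w = b \<otimes> b \<otimes> (eps \<otimes> eps)"
    using b(1) eps_closed by algebra
  then have "?w \<otimes> ?w = \<zero>" using b eps_square by simp
  from dom.power_add_square_zero[OF assms(2) w this, of n]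
  have "x [^] p = y [^] p \<oplus> p\<^sub>B \<otimes> (y [^] n \<otimes> ?w)"
    unfolding b(2) n .
  also have "p\<^sub>B \<otimes> (y [^] n \<otimes> ?w) = (p\<^sub>B \<otimes> eps) \<otimes> (y [^] n \<otimes> b)"
    using assms b(1) eps_closed by (simp add: dom.m_ac)
  also have "\<dots> = \<zero>" using eps_torsion assms b by simp
  finally show ?thesis using assms by simp
qed

lemma p_mult_cong:
  assumes "x \<in> carrier B" "y \<in> carrier B" "h x = h y"
  shows "p\<^sub>B \<otimes> x = p\<^sub>B \<otimes> y"
proof -
  obtain b where b: "b \<in> carrier B" "x = y \<oplus> b \<otimes> eps"
    using assms by (rule h_eqE)
  have "p\<^sub>B \<otimes> x = p\<^sub>B \<otimes> y \<oplus> b \<otimes> (p\<^sub>B \<otimes> eps)"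
    unfolding b(2) using b(1) assms(2) eps_closed dom.natural_closed[of p] by algebra
  then show ?thesis using eps_torsion assms b by simp
qed

definition lift :: "'b \<Rightarrow> 'a" where
  "lift a = (SOME x. x \<in> carrier B \<and> h x = a)"

text \<open>
  The ghost component \<open>a\<^sup>p + p b\<close> of the Witt vector \<open>(a, b)\<close> over \<open>A\<close>; it is computed with arbitrary
  lifts and takes values in \<open>B\<close>.
\<close>

definition ghost :: "'b \<Rightarrow> 'b \<Rightarrow> 'a" where
  "ghost a b = lift a [^] p \<oplus> p\<^sub>B \<otimes> lift b"

lemma lift:
  assumes "a \<in> carrier A" shows "lift a \<in> carrier B" "h (lift a) = a"
proof -
  have "\<exists>x. x \<in> carrier B \<and> h x = a" using assms unfolding surj[symmetric] by auto
  from someI_ex[OF this] show "lift a \<in> carrier B" "h (lift a) = a" unfolding lift_def by auto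
qed

text \<open>
  The value does not depend on the lifts. All identities for \<open>ghost\<close> follow by choosing lifts of the
  arguments and calculating in \<open>B\<close>.
\<close>

lemma ghost_h:
  assumes "x \<in> carrier B" "z \<in> carrier B"
  shows "ghost (h x) (h z) = x [^] p \<oplus> p\<^sub>B \<otimes> z"
  unfolding ghost_def
  using pow_cong[of "lift (h x)" x] p_mult_cong[of "lift (h z)" z] lift assms by simp

lemma ghost_closed [simp, intro]: "a \<in> carrier A \<Longrightarrow> b \<in> carrier A \<Longrightarrow> ghost a b \<in> carrier B"
  unfolding ghost_def by (simp add: lift)

lemma liftE:
  assumes "a \<in> carrier A" obtains x where "x \<in> carrier B" "a = h x"
  using lift[OF assms] by metis

lemma h_ghost:
  assumes "a \<in> carrier A" "b \<in> carrier A"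
  shows "h (ghost a b) = a [^]\<^bsub>A\<^esub> p \<oplus>\<^bsub>A\<^esub> p\<^sub>A \<otimes>\<^bsub>A\<^esub> b"
  unfolding ghost_def using lift assms by (simp add: h_pow h_natural)

lemma ghost_zero: "ghost \<zero>\<^bsub>A\<^esub> \<zero>\<^bsub>A\<^esub> = \<zero>"
  using ghost_h[of "\<zero>" "\<zero>"] p_pos by (simp add: dom.nat_pow_zero)

lemma ghost_add:
  assumes "a \<in> carrier A" "b \<in> carrier A" "c \<in> carrier A" "d \<in> carrier A"
  shows "ghost a b \<oplus> ghost c d =
    ghost (a \<oplus>\<^bsub>A\<^esub> c) (b \<oplus>\<^bsub>A\<^esub> d \<ominus>\<^bsub>A\<^esub> power_carry A p a c)"
proof -
  obtain x where x: "x \<in> carrier B" "a = h x" using assms(1) by (rule liftE)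
  obtain z where z: "z \<in> carrier B" "b = h z" using assms(2) by (rule liftE)
  obtain u where u: "u \<in> carrier B" "c = h u" using assms(3) by (rule liftE)
  obtain v where v: "v \<in> carrier B" "d = h v" using assms(4) by (rule liftE)
  let ?c = "power_carry B p x u"
  have cl: "?c \<in> carrier B" "x [^] p \<in> carrier B" "u [^] p \<in> carrier B" "p\<^sub>B \<in> carrier B"
    using x u by auto
  have "ghost (a \<oplus>\<^bsub>A\<^esub> c) (b \<oplus>\<^bsub>A\<^esub> d \<ominus>\<^bsub>A\<^esub> power_carry A p a c) =
    ghost (h (x \<oplus> u)) (h (z \<oplus> v \<ominus> ?c))"
    using x z u v cl by (simp add: a_minus_def h_carry)
  also have "\<dots> = (x \<oplus> u) [^] p \<oplus> p\<^sub>B \<otimes> (z \<oplus> v \<ominus> ?c)"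
    by (rule ghost_h) (use x z u v cl in auto)
  also have "\<dots> = (x [^] p \<oplus> p\<^sub>B \<otimes> z) \<oplus> (u [^] p \<oplus> p\<^sub>B \<otimes> v)"
    unfolding dom.prime_power_add[OF prime x(1) u(1)] using x(1) z(1) u(1) v(1) cl by algebra
  also have "\<dots> = ghost a b \<oplus> ghost c d"
    using x z u v by (simp add: ghost_h)
  finally show ?thesis by simp
qed

lemma ghost_mult:
  assumes "a \<in> carrier A" "b \<in> carrier A" "c \<in> carrier A" "d \<in> carrier A"
  shows "ghost a b \<otimes> ghost c d = ghost (a \<otimes>\<^bsub>A\<^esub> c)
    (a [^]\<^bsub>A\<^esub> p \<otimes>\<^bsub>A\<^esub> d \<oplus>\<^bsub>A\<^esub> c [^]\<^bsub>A\<^esub> p \<otimes>\<^bsub>A\<^esub> b \<oplus>\<^bsub>A\<^esub> p\<^sub>A \<otimes>\<^bsub>A\<^esub> (b \<otimes>\<^bsub>A\<^esub> d))"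
proof -
  obtain x where x: "x \<in> carrier B" "a = h x" using assms(1) by (rule liftE)
  obtain z where z: "z \<in> carrier B" "b = h z" using assms(2) by (rule liftE)
  obtain u where u: "u \<in> carrier B" "c = h u" using assms(3) by (rule liftE)
  obtain v where v: "v \<in> carrier B" "d = h v" using assms(4) by (rule liftE)
  have cl: "x [^] p \<in> carrier B" "u [^] p \<in> carrier B" "p\<^sub>B \<in> carrier B"
    using x u by auto
  let ?r = "x [^] p \<otimes> v \<oplus> u [^] p \<otimes> z \<oplus> p\<^sub>B \<otimes> (z \<otimes> v)"
  have "ghost (a \<otimes>\<^bsub>A\<^esub> c)
    (a [^]\<^bsub>A\<^esub> p \<otimes>\<^bsub>A\<^esub> d \<oplus>\<^bsub>A\<^esub> c [^]\<^bsub>A\<^esub> p \<otimes>\<^bsub>A\<^esub> b \<oplus>\<^bsub>A\<^esub> p\<^sub>A \<otimes>\<^bsub>A\<^esub> (b \<otimes>\<^bsub>A\<^esub> d)) =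
    ghost (h (x \<otimes> u)) (h ?r)"
    using x z u v cl by (simp add: h_pow h_natural)
  also have "\<dots> = (x \<otimes> u) [^] p \<oplus> p\<^sub>B \<otimes> ?r"
    by (rule ghost_h) (use x z u v cl in auto)
  also have "\<dots> = (x [^] p \<oplus> p\<^sub>B \<otimes> z) \<otimes> (u [^] p \<oplus> p\<^sub>B \<otimes> v)"
    unfolding dom.nat_pow_distrib[OF x(1) u(1)] using z(1) v(1) cl by algebra
  also have "\<dots> = ghost a b \<otimes> ghost c d"
    using x z u v by (simp add: ghost_h)
  finally show ?thesis by simp
qed

lemma ghost_scale:
  assumes "x \<in> carrier B" "a \<in> carrier A" "b \<in> carrier A"
  shows "ghost (h x \<otimes>\<^bsub>A\<^esub> a) (h x [^]\<^bsub>A\<^esub> p \<otimes>\<^bsub>A\<^esub> b) = x [^] p \<otimes> ghost a b"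
proof -
  obtain u where u: "u \<in> carrier B" "a = h u" using assms(2) by (rule liftE)
  obtain v where v: "v \<in> carrier B" "b = h v" using assms(3) by (rule liftE)
  have "ghost (h x \<otimes>\<^bsub>A\<^esub> a) (h x [^]\<^bsub>A\<^esub> p \<otimes>\<^bsub>A\<^esub> b) =
    ghost (h (x \<otimes> u)) (h (x [^] p \<otimes> v))"
    using assms(1) u v by (simp add: h_pow)
  also have "\<dots> = (x \<otimes> u) [^] p \<oplus> p\<^sub>B \<otimes> (x [^] p \<otimes> v)"
    by (rule ghost_h) (use assms(1) u v in auto)
  also have "\<dots> = x [^] p \<otimes> (u [^] p \<oplus> p\<^sub>B \<otimes> v)"
  proof -
    have "x [^] p \<in> carrier B" "u [^] p \<in> carrier B" "p\<^sub>B \<in> carrier B"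
      using assms(1) u by auto
    then show ?thesis unfolding dom.nat_pow_distrib[OF assms(1) u(1)] using v(1) by algebra
  qed
  finally show ?thesis using u v by (simp add: ghost_h)
qed

lemma ghost_zero_add:
  assumes "b \<in> carrier A" "d \<in> carrier A" "a \<in> carrier A"
  shows "ghost a (b \<oplus>\<^bsub>A\<^esub> d) = ghost a b \<oplus> ghost \<zero>\<^bsub>A\<^esub> d"
proof -
  obtain u where u: "u \<in> carrier B" "a = h u" using assms(3) by (rule liftE)
  obtain z where z: "z \<in> carrier B" "b = h z" using assms(1) by (rule liftE)
  obtain v where v: "v \<in> carrier B" "d = h v" using assms(2) by (rule liftE)
  have "ghost a (b \<oplus>\<^bsub>A\<^esub> d) = ghost (h u) (h (z \<oplus> v))" using u z v by simp
  also have "\<dots> = u [^] p \<oplus> p\<^sub>B \<otimes> (z \<oplus> v)" by (rule ghost_h) (use u z v in auto)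
  also have "\<dots> = (u [^] p \<oplus> p\<^sub>B \<otimes> z) \<oplus> p\<^sub>B \<otimes> v"
    using u z v by (simp add: dom.r_distr dom.a_assoc)
  also have "\<dots> = ghost a b \<oplus> ghost \<zero>\<^bsub>A\<^esub> d"
  proof -
    have "ghost \<zero>\<^bsub>A\<^esub> d = p\<^sub>B \<otimes> v"
      using ghost_h[of "\<zero>" v] v p_pos by (simp add: dom.nat_pow_zero)
    then show ?thesis using u z by (simp add: ghost_h)
  qed
  finally show ?thesis .
qed

lemma ghost_zero_scale:
  assumes "x \<in> carrier B" "b \<in> carrier A"
  shows "ghost \<zero>\<^bsub>A\<^esub> (h x \<otimes>\<^bsub>A\<^esub> b) = x \<otimes> ghost \<zero>\<^bsub>A\<^esub> b"
proof -
  obtain v where v: "v \<in> carrier B" "b = h v" using assms(2) by (rule liftE)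
  have 1: "ghost \<zero>\<^bsub>A\<^esub> (h w) = p\<^sub>B \<otimes> w" if "w \<in> carrier B" for w
    using ghost_h[of "\<zero>" w] that p_pos by (simp add: dom.nat_pow_zero)
  have "ghost \<zero>\<^bsub>A\<^esub> (h x \<otimes>\<^bsub>A\<^esub> b) = ghost \<zero>\<^bsub>A\<^esub> (h (x \<otimes> v))" using v assms by simp
  also have "\<dots> = p\<^sub>B \<otimes> (x \<otimes> v)" by (rule 1) (use v assms in auto)
  also have "\<dots> = x \<otimes> (p\<^sub>B \<otimes> v)" using v assms by (simp add: dom.m_lcomm)
  finally show ?thesis using 1 v by simp
qed

text \<open>
  The subring of ghost components contains all \<open>p\<close>-th powers, and \<open>B\<close> is generated by finitely many
  elements, so \<open>B\<close> is a finitely generated module over that subring.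
\<close>

lemma ghost_spanning:
  "\<exists>m y. valuation B y \<and> (\<forall>x\<in>carrier B. \<exists>a b. valuation A a \<and>
     valuation A b \<and> x = (\<Oplus>j\<in>{..<m::nat}. y j \<otimes> ghost (a j) (b j)))"
proof -
  let ?S = "dom.prime_power_subring p"
  have S: "subring ?S B" by (rule dom.prime_power_subring[OF prime])
  obtain H where H: "finite H" "H \<subseteq> carrier B" "generate_ring B H = carrier B"
    using fin_gen unfolding finitely_generated_ring_def by blast
  have "x [^] p \<in> ?S" if "x \<in> carrier B" for x
    using dom.prime_power_subringI[OF that dom.zero_closed, of p] that by simp
  from dom.generate_ring_finite_over_powers[OF S this p_pos H(1,2)]
  obtain Y where Y: "Y \<subseteq> carrier B" "finite Y" "carrier B \<subseteq> lspan B ?S Y"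
    unfolding H(3) by blast
  obtain g m where g: "Y = g ` {..<m::nat}" using dom.finite_enumeration[OF Y(2)] by blast
  let ?y = "\<lambda>j. if j < m then g j else \<zero>"
  have yc: "?y j \<in> carrier B" for j using Y(1) g by auto
  have "\<exists>a b. valuation A a \<and> valuation A b \<and>
    x = (\<Oplus>j\<in>{..<m}. ?y j \<otimes> ghost (a j) (b j))" if "x \<in> carrier B" for x
  proof -
    have "x \<in> lspan B ?S (g ` {..<m})" "g ` {..<m} \<subseteq> carrier B" using that Y g by auto
    then obtain c where c: "\<forall>i. c i \<in> ?S" "x = (\<Oplus>i\<in>{..<m}. c i \<otimes> g i)"
      using dom.lspan_finite_sum[OF S] by blast
    have "\<forall>i. \<exists>u v. u \<in> carrier B \<and> v \<in> carrier B \<and> c i = u [^] p \<oplus> p\<^sub>B \<otimes> v"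
      using c(1) unfolding dom.prime_power_subring_def by blast
    then obtain u v where uv: "\<And>i. u i \<in> carrier B" "\<And>i. v i \<in> carrier B"
      "\<And>i. c i = u i [^] p \<oplus> p\<^sub>B \<otimes> v i" by metis
    have "x = (\<Oplus>j\<in>{..<m}. ?y j \<otimes> ghost (h (u j)) (h (v j)))"
      unfolding c(2)
    proof (rule dom.finsum_cong')
      fix i assume "i \<in> {..<m}"
      then show "c i \<otimes> g i = ?y i \<otimes> ghost (h (u i)) (h (v i))"
        using uv yc[of i] by (simp add: ghost_h dom.m_comm)
    qed (rule refl, intro Pi_I dom.m_closed yc ghost_closed hom.hom_closed uv)
    then show ?thesis using uv by (intro exI[of _ "\<lambda>j. h (u j)"] exI[of _ "\<lambda>j. h (v j)"]) auto
  qed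
  then show ?thesis by (intro exI[of _ m] exI[of _ ?y] conjI allI ballI yc)
qed

end

lemma (in ring) polyfun_rterm: "polyfun R (\<lambda>e. rterm_val R (\<lambda>i. e (f i)) s)"
  by (induction s) (auto intro: polyfun_var polyfun_add polyfun_mult local.ring_axioms)

lemma (in cring) polyfun_carry:
  "polyfun R f \<Longrightarrow> polyfun R g \<Longrightarrow> polyfun R (\<lambda>e. power_carry R p (f e) (g e))"
  unfolding power_carry_def
  by (intro polyfun_finsum polyfun_mult polyfun_pow polyfun_const) auto

text \<open>
  A choice of module generators \<open>y\<close> over the subring of ghost components turns \<open>A\<^bsup>2m\<^esup>\<close> into a set of
  coordinates for \<open>B\<close>.
\<close>

locale infinitesimal_extension_basis = infinitesimal_extension B A h eps p
  for B :: "('a, 'x) ring_scheme" (structure) and A :: "('b, 'y) ring_scheme" and h eps p +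
  fixes m :: nat and y :: "nat \<Rightarrow> 'a"
  assumes y_closed [simp, intro]: "y j \<in> carrier B"
    and spanning: "x \<in> carrier B \<Longrightarrow> \<exists>a b. valuation A a \<and> valuation A b \<and>
      x = (\<Oplus>j\<in>{..<m}. y j \<otimes> ghost (a j) (b j))"
begin

definition val :: "(nat \<Rightarrow> 'b) \<Rightarrow> (nat \<Rightarrow> 'b) \<Rightarrow> 'a" where
  "val a b = (\<Oplus>j\<in>{..<m}. y j \<otimes> ghost (a j) (b j))"

lemma val_closed:
  assumes "\<And>j. a j \<in> carrier A" "\<And>j. b j \<in> carrier A" shows "val a b \<in> carrier B"
  unfolding val_def using assms by (intro dom.finsum_closed) auto

lemma val_cong:
  assumes "\<And>j. j < m \<Longrightarrow> ghost (a j) (b j) = ghost (a' j) (b' j)"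
    "\<And>j. a' j \<in> carrier A" "\<And>j. b' j \<in> carrier A"
  shows "val a b = val a' b'"
  unfolding val_def by (rule dom.finsum_cong') (use assms in auto)

lemma val_sum:
  assumes "\<And>j. j < m \<Longrightarrow> ghost (a j) (b j) = ghost (c j) (d j) \<oplus> ghost (c' j) (d' j)"
    "\<And>j. c j \<in> carrier A" "\<And>j. d j \<in> carrier A" "\<And>j. c' j \<in> carrier A" "\<And>j. d' j \<in> carrier A"
  shows "val a b = val c d \<oplus> val c' d'"
proof -
  have "val a b = (\<Oplus>j\<in>{..<m}. y j \<otimes> ghost (c j) (d j) \<oplus> y j \<otimes> ghost (c' j) (d' j))"
    unfolding val_def by (rule dom.finsum_cong') (use assms in \<open>auto simp: dom.r_distr\<close>)
  also have "\<dots> = val c d \<oplus> val c' d'"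
    unfolding val_def by (rule dom.finsum_addf) (use assms in auto)
  finally show ?thesis .
qed

lemma val_scale:
  assumes "\<And>j. j < m \<Longrightarrow> ghost (a j) (b j) = x \<otimes> ghost (c j) (d j)"
    "x \<in> carrier B" "\<And>j. c j \<in> carrier A" "\<And>j. d j \<in> carrier A"
  shows "val a b = x \<otimes> val c d"
proof -
  have "val a b = (\<Oplus>j\<in>{..<m}. x \<otimes> (y j \<otimes> ghost (c j) (d j)))"
    unfolding val_def by (rule dom.finsum_cong') (use assms in \<open>auto simp: dom.m_lcomm\<close>)
  also have "\<dots> = x \<otimes> val c d"
    unfolding val_def by (rule dom.finsum_rdistr[symmetric]) (use assms in auto)
  finally show ?thesis .
qed

text \<open>
  Functions with values in \<open>B\<close> whose coordinates can be chosen as polynomial functions over \<open>A\<close>. They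
  form a ring containing the constants (\<open>repr_const\<close>, \<open>repr_add\<close>, \<open>repr_mult\<close>), which is what
  makes atomic formulas over \<open>B\<close> accessible from \<open>A\<close>.
\<close>

definition repr :: "(('w \<Rightarrow> 'b) \<Rightarrow> 'a) \<Rightarrow> bool" where
  "repr G \<longleftrightarrow> (\<exists>a b. (\<forall>j. polyfun A (a j)) \<and> (\<forall>j. polyfun A (b j)) \<and>
     (\<forall>t. valuation A t \<longrightarrow> G t = val (\<lambda>j. a j t) (\<lambda>j. b j t)))"

lemma reprE:
  assumes "repr G"
  obtains a b where "\<And>j. polyfun A (a j)" "\<And>j. polyfun A (b j)"
    "\<And>t. valuation A t \<Longrightarrow> G t = val (\<lambda>j. a j t) (\<lambda>j. b j t)"
proof -
  from assms obtain a b where "\<forall>j. polyfun A (a j)" "\<forall>j. polyfun A (b j)"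
    "\<forall>t. valuation A t \<longrightarrow> G t = val (\<lambda>j. a j t) (\<lambda>j. b j t)"
    unfolding repr_def by (elim exE conjE)
  then show thesis by (intro that[of a b]) auto
qed

lemma reprI:
  assumes "\<And>j. polyfun A (a j)" "\<And>j. polyfun A (b j)"
    "\<And>t. valuation A t \<Longrightarrow> G t = val (\<lambda>j. a j t) (\<lambda>j. b j t)"
  shows "repr G"
  using assms unfolding repr_def by blast

lemmas polyfun_A_closed = polyfun_closed[OF cod.ring_axioms]

lemma repr_closed:
  assumes "repr G" "\<And>v. t v \<in> carrier A" shows "G t \<in> carrier B"
proof -
  from assms(1) obtain a b where ab: "\<And>j. polyfun A (a j)" "\<And>j. polyfun A (b j)"
    "\<And>t. valuation A t \<Longrightarrow> G t = val (\<lambda>j. a j t) (\<lambda>j. b j t)" by (rule reprE) blast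
  have "G t = val (\<lambda>j. a j t) (\<lambda>j. b j t)" using ab(3) assms(2) by simp
  then show ?thesis using ab(1,2) assms(2) by (simp add: val_closed polyfun_A_closed)
qed

lemma repr_cong:
  assumes "repr G" "\<And>t. valuation A t \<Longrightarrow> G t = G' t" shows "repr G'"
  using assms unfolding repr_def by simp

lemma repr_subst:
  assumes "repr G" shows "repr (\<lambda>t. G (\<lambda>v. t (\<sigma> v)))"
proof -
  from assms obtain a b where ab: "\<And>j. polyfun A (a j)" "\<And>j. polyfun A (b j)"
    "\<And>t. valuation A t \<Longrightarrow> G t = val (\<lambda>j. a j t) (\<lambda>j. b j t)" by (rule reprE) blast
  show ?thesis
    by (rule reprI[of "\<lambda>j t. a j (\<lambda>v. t (\<sigma> v))" "\<lambda>j t. b j (\<lambda>v. t (\<sigma> v))"])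
      (use ab in \<open>auto intro: polyfun_subst\<close>)
qed

lemma repr_const:
  assumes "x \<in> carrier B" shows "repr (\<lambda>t. x)"
proof -
  obtain a b where "valuation A a" "valuation A b" "x = val a b"
    using spanning[OF assms] unfolding val_def by blast
  then show ?thesis
    by (intro reprI[of "\<lambda>j t. a j" "\<lambda>j t. b j"] polyfun_const) auto
qed

lemma repr_add:
  assumes "repr F" "repr G" shows "repr (\<lambda>t. F t \<oplus> G t)"
proof -
  from assms(1) obtain a b where ab: "\<And>j. polyfun A (a j)" "\<And>j. polyfun A (b j)"
    "\<And>t. valuation A t \<Longrightarrow> F t = val (\<lambda>j. a j t) (\<lambda>j. b j t)" by (rule reprE) blast
  from assms(2) obtain c d where cd: "\<And>j. polyfun A (c j)" "\<And>j. polyfun A (d j)"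
    "\<And>t. valuation A t \<Longrightarrow> G t = val (\<lambda>j. c j t) (\<lambda>j. d j t)" by (rule reprE) blast
  show ?thesis
  proof (rule reprI[of "\<lambda>j t. a j t \<oplus>\<^bsub>A\<^esub> c j t"
        "\<lambda>j t. b j t \<oplus>\<^bsub>A\<^esub> d j t \<ominus>\<^bsub>A\<^esub> power_carry A p (a j t) (c j t)"])
    fix t :: "'c \<Rightarrow> 'b" assume t: "valuation A t"
    have cl: "a j t \<in> carrier A" "b j t \<in> carrier A" "c j t \<in> carrier A" "d j t \<in> carrier A" for j
      using t by (simp_all add: polyfun_A_closed[OF ab(1)] polyfun_A_closed[OF ab(2)]
          polyfun_A_closed[OF cd(1)] polyfun_A_closed[OF cd(2)])
    show "F t \<oplus> G t = val (\<lambda>j. a j t \<oplus>\<^bsub>A\<^esub> c j t)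
      (\<lambda>j. b j t \<oplus>\<^bsub>A\<^esub> d j t \<ominus>\<^bsub>A\<^esub> power_carry A p (a j t) (c j t))"
      unfolding ab(3)[OF t] cd(3)[OF t]
      by (rule val_sum[symmetric]) (use cl in \<open>auto simp: ghost_add\<close>)
  qed (auto intro!: polyfun_add cod.polyfun_minus cod.polyfun_carry ab cd)
qed

lemma repr_ghost_mult:
  assumes f: "polyfun A f" and g: "polyfun A g" and "repr G"
  shows "repr (\<lambda>t. ghost (f t) (g t) \<otimes> G t)"
proof -
  from assms(3) obtain c d where cd: "\<And>j. polyfun A (c j)" "\<And>j. polyfun A (d j)"
    "\<And>t. valuation A t \<Longrightarrow> G t = val (\<lambda>j. c j t) (\<lambda>j. d j t)" by (rule reprE) blast
  let ?d = "\<lambda>j t. f t [^]\<^bsub>A\<^esub> p \<otimes>\<^bsub>A\<^esub> d j t \<oplus>\<^bsub>A\<^esub> c j t [^]\<^bsub>A\<^esub> p \<otimes>\<^bsub>A\<^esub> g t \<oplus>\<^bsub>A\<^esub>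
    p\<^sub>A \<otimes>\<^bsub>A\<^esub> (g t \<otimes>\<^bsub>A\<^esub> d j t)"
  show ?thesis
  proof (rule reprI[of "\<lambda>j t. f t \<otimes>\<^bsub>A\<^esub> c j t" ?d])
    fix t :: "'c \<Rightarrow> 'b" assume t: "valuation A t"
    have cl: "f t \<in> carrier A" "g t \<in> carrier A" "c j t \<in> carrier A" "d j t \<in> carrier A" for j
      using t by (simp_all add: polyfun_A_closed[OF f] polyfun_A_closed[OF g]
          polyfun_A_closed[OF cd(1)] polyfun_A_closed[OF cd(2)])
    show "ghost (f t) (g t) \<otimes> G t = val (\<lambda>j. f t \<otimes>\<^bsub>A\<^esub> c j t) (\<lambda>j. ?d j t)"
      unfolding cd(3)[OF t]
      by (rule val_scale[symmetric]) (use cl in \<open>auto simp: ghost_mult\<close>)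
  qed (auto intro!: polyfun_add polyfun_mult polyfun_const cod.polyfun_pow f g cd)
qed

lemma repr_finsum:
  fixes n :: nat
  assumes "\<And>i. repr (G i)" shows "repr (\<lambda>t. \<Oplus>i\<in>{..<n}. G i t)"
proof (induction n)
  case (Suc n)
  show ?case
    by (rule repr_cong[OF repr_add[OF Suc assms[of n]]])
      (use assms in \<open>simp add: dom.finsum_lessThan_Suc repr_closed\<close>)
qed (simp add: repr_const)

text \<open>
  The structure constants are absorbed here: each product \<open>y i \<otimes> y j\<close> is a constant, hence has
  coordinates.
\<close>

lemma repr_basis_mult:
  assumes "repr G" shows "repr (\<lambda>t. y i \<otimes> G t)"
proof -
  from assms obtain c d where cd: "\<And>j. polyfun A (c j)" "\<And>j. polyfun A (d j)"
    "\<And>t. valuation A t \<Longrightarrow> G t = val (\<lambda>j. c j t) (\<lambda>j. d j t)" by (rule reprE) blast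
  have "repr (\<lambda>t. \<Oplus>j\<in>{..<m}. ghost (c j t) (d j t) \<otimes> (y i \<otimes> y j))"
    by (intro repr_finsum repr_ghost_mult repr_const cd) simp
  then show ?thesis
  proof (rule repr_cong)
    fix t :: "'c \<Rightarrow> 'b" assume t: "valuation A t"
    have cl: "c j t \<in> carrier A" "d j t \<in> carrier A" for j
      using t by (simp_all add: polyfun_A_closed[OF cd(1)] polyfun_A_closed[OF cd(2)])
    have "y i \<otimes> G t = (\<Oplus>j\<in>{..<m}. y i \<otimes> (y j \<otimes> ghost (c j t) (d j t)))"
      unfolding cd(3)[OF t] val_def by (rule dom.finsum_rdistr) (use cl in auto)
    also have "\<dots> = (\<Oplus>j\<in>{..<m}. ghost (c j t) (d j t) \<otimes> (y i \<otimes> y j))"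
      by (rule dom.finsum_cong') (use cl in \<open>auto simp: dom.m_ac\<close>)
    finally show "(\<Oplus>j\<in>{..<m}. ghost (c j t) (d j t) \<otimes> (y i \<otimes> y j)) = y i \<otimes> G t"
      by simp
  qed
qed

lemma repr_mult:
  assumes "repr F" "repr G" shows "repr (\<lambda>t. F t \<otimes> G t)"
proof -
  from assms(1) obtain c d where cd: "\<And>j. polyfun A (c j)" "\<And>j. polyfun A (d j)"
    "\<And>t. valuation A t \<Longrightarrow> F t = val (\<lambda>j. c j t) (\<lambda>j. d j t)" by (rule reprE) blast
  have "repr (\<lambda>t. \<Oplus>j\<in>{..<m}. ghost (c j t) (d j t) \<otimes> (y j \<otimes> G t))"
    by (intro repr_finsum repr_ghost_mult repr_basis_mult assms(2) cd)
  then show ?thesis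
  proof (rule repr_cong)
    fix t :: "'c \<Rightarrow> 'b" assume t: "valuation A t"
    have cl: "c j t \<in> carrier A" "d j t \<in> carrier A" for j
      using t by (simp_all add: polyfun_A_closed[OF cd(1)] polyfun_A_closed[OF cd(2)])
    have G: "G t \<in> carrier B" using assms(2) t by (simp add: repr_closed)
    have "F t \<otimes> G t = (\<Oplus>j\<in>{..<m}. y j \<otimes> ghost (c j t) (d j t) \<otimes> G t)"
      unfolding cd(3)[OF t] val_def by (rule dom.finsum_ldistr) (use cl G in auto)
    also have "\<dots> = (\<Oplus>j\<in>{..<m}. ghost (c j t) (d j t) \<otimes> (y j \<otimes> G t))"
      by (rule dom.finsum_cong') (use cl G in \<open>auto simp: dom.m_ac\<close>)
    finally show "(\<Oplus>j\<in>{..<m}. ghost (c j t) (d j t) \<otimes> (y j \<otimes> G t)) = F t \<otimes> G t"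
      by simp
  qed
qed

lemma repr_rterm:
  "(\<And>i. repr (G i)) \<Longrightarrow> repr (\<lambda>t. rterm_val B (\<lambda>i. G i t) s)"
  by (induction s) (auto intro: repr_add repr_mult)

lemma noetherian_A: "noetherian_over A (carrier A)"
  by (rule cod.noetherian_if_finitely_generated[OF hom.finitely_generated_image[OF fin_gen surj]])

text \<open>
  For vanishing first coordinates, \<open>ghost\<close> is additive and satisfies
  \<open>ghost 0 (h x * b) = x * ghost 0 b\<close>. The relations are therefore a submodule of \<open>A\<^sup>m\<close>, and being
  such a relation means being a combination of finitely many fixed ones.
\<close>

lemma zero_ghost_definable:
  fixes b :: "nat \<Rightarrow> ('w \<Rightarrow> 'b) \<Rightarrow> 'b"
  assumes b: "\<And>j. polyfun A (b j)"
  shows "dpred A (\<lambda>t. val (\<lambda>j. \<zero>\<^bsub>A\<^esub>) (\<lambda>j. b j t) = \<zero>)"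
proof -
  let ?K = "{k. valuation A k \<and> val (\<lambda>j. \<zero>\<^bsub>A\<^esub>) k = \<zero>}"
  have K1: "k j \<in> carrier A" if "k \<in> ?K" for k j using that by blast
  have K2: "(\<lambda>j. \<zero>\<^bsub>A\<^esub>) \<in> ?K"
  proof -
    have "val (\<lambda>j. \<zero>\<^bsub>A\<^esub>) (\<lambda>j. \<zero>\<^bsub>A\<^esub>) = \<zero>" by (simp add: val_def ghost_zero)
    then show ?thesis by simp
  qed
  have K3: "(\<lambda>j. k j \<oplus>\<^bsub>A\<^esub> l j) \<in> ?K" if "k \<in> ?K" "l \<in> ?K" for k l
  proof -
    have "val (\<lambda>j. \<zero>\<^bsub>A\<^esub>) (\<lambda>j. k j \<oplus>\<^bsub>A\<^esub> l j) = val (\<lambda>j. \<zero>\<^bsub>A\<^esub>) k \<oplus> val (\<lambda>j. \<zero>\<^bsub>A\<^esub>) l"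
      by (rule val_sum) (use that in \<open>auto simp: ghost_zero_add\<close>)
    then show ?thesis using that by simp
  qed
  have K4: "(\<lambda>j. c \<otimes>\<^bsub>A\<^esub> k j) \<in> ?K" if "c \<in> carrier A" "k \<in> ?K" for c k
  proof -
    obtain x where x: "x \<in> carrier B" "c = h x" using \<open>c \<in> carrier A\<close> by (rule liftE)
    have "val (\<lambda>j. \<zero>\<^bsub>A\<^esub>) (\<lambda>j. c \<otimes>\<^bsub>A\<^esub> k j) = x \<otimes> val (\<lambda>j. \<zero>\<^bsub>A\<^esub>) k"
      by (rule val_scale) (use that x in \<open>auto simp: ghost_zero_scale\<close>)
    then show ?thesis using that x by simp
  qed
  have K: "tuple_submodule A ?K"
    unfolding tuple_submodule_def using K1 K2 K3 K4 by (intro conjI ballI allI)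
  obtain r g where g: "\<forall>i. g i \<in> ?K" "\<forall>k\<in>?K. \<exists>c. valuation A c \<and>
    (\<forall>j<m. k j = (\<Oplus>\<^bsub>A\<^esub>i\<in>{..<r::nat}. c i \<otimes>\<^bsub>A\<^esub> g i j))"
    using cod.submodule_of_tuples_finitely_generated[OF noetherian_A K, of m]
    by (elim exE conjE)
  have gc: "g i j \<in> carrier A" for i j using g(1) by blast
  have "dpred A (\<lambda>e. \<forall>j\<in>{..<m}. b j (\<lambda>v. e (Inr v)) = (\<Oplus>\<^bsub>A\<^esub>i\<in>{..<r}. e (Inl i) \<otimes>\<^bsub>A\<^esub> g i j))"
  proof (rule dpred_ball[OF cod.ring_axioms finite_lessThan], rule dpred_eq)
    show "polyfun A (\<lambda>e. b j (\<lambda>v. e (Inr v)))" for j by (rule polyfun_subst[OF b])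
    show "polyfun A (\<lambda>e. \<Oplus>\<^bsub>A\<^esub>i\<in>{..<r}. e (Inl i) \<otimes>\<^bsub>A\<^esub> g i j)" for j
      by (intro cod.polyfun_finsum polyfun_mult polyfun_const polyfun_var cod.ring_axioms gc) auto
  qed
  from dpred_ex_block[OF cod.ring_axioms this] show ?thesis
  proof (rule dpred_cong)
    fix t :: "'w \<Rightarrow> 'b" assume t: "valuation A t"
    have bc: "b j t \<in> carrier A" for j using t by (simp add: polyfun_A_closed[OF b])
    show "(\<exists>s. valuation A s \<and> (\<forall>j\<in>{..<m}. b j (\<lambda>v. case_sum s t (Inr v)) =
       (\<Oplus>\<^bsub>A\<^esub>i\<in>{..<r}. case_sum s t (Inl i) \<otimes>\<^bsub>A\<^esub> g i j))) =
      (val (\<lambda>j. \<zero>\<^bsub>A\<^esub>) (\<lambda>j. b j t) = \<zero>)" (is "?L = ?R")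
    proof
      assume ?L
      then obtain s where s: "valuation A s"
        "\<forall>j\<in>{..<m}. b j t = (\<Oplus>\<^bsub>A\<^esub>i\<in>{..<r}. s i \<otimes>\<^bsub>A\<^esub> g i j)" by auto
      have "(\<lambda>j. \<Oplus>\<^bsub>A\<^esub>i\<in>{..<r}. s i \<otimes>\<^bsub>A\<^esub> g i j) \<in> ?K"
        by (rule cod.tuple_combination_closed[OF K s(1) g(1)])
      then have k: "val (\<lambda>j. \<zero>\<^bsub>A\<^esub>) (\<lambda>j. \<Oplus>\<^bsub>A\<^esub>i\<in>{..<r}. s i \<otimes>\<^bsub>A\<^esub> g i j) = \<zero>"
        "\<And>j. (\<Oplus>\<^bsub>A\<^esub>i\<in>{..<r}. s i \<otimes>\<^bsub>A\<^esub> g i j) \<in> carrier A" by auto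
      have "val (\<lambda>j. \<zero>\<^bsub>A\<^esub>) (\<lambda>j. b j t) = 
        val (\<lambda>j. \<zero>\<^bsub>A\<^esub>) (\<lambda>j. \<Oplus>\<^bsub>A\<^esub>i\<in>{..<r}. s i \<otimes>\<^bsub>A\<^esub> g i j)"
        by (rule val_cong) (use s k(2) in auto)
      then show ?R using k(1) by simp
    next
      assume ?R
      then have "(\<lambda>j. b j t) \<in> ?K" using bc by simp
      from g(2)[THEN bspec, OF this] obtain c where "valuation A c"
        "\<forall>j<m. b j t = (\<Oplus>\<^bsub>A\<^esub>i\<in>{..<r}. c i \<otimes>\<^bsub>A\<^esub> g i j)" by (elim exE conjE)
      then show ?L by (intro exI[of _ c]) auto
    qed
  qed
qed

text \<open>
  The first coordinate of a sum of Witt vectors is the sum of the first coordinates; the second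
  collects the carries, a polynomial in all the coordinates.
\<close>

lemma ghost_sum:
  fixes u v :: "nat \<Rightarrow> ('w \<Rightarrow> 'b) \<Rightarrow> 'b" and r :: nat
  assumes u: "\<And>i. polyfun A (u i)" and v: "\<And>i. polyfun A (v i)"
  shows "\<exists>V. polyfun A V \<and> (\<forall>t. valuation A t \<longrightarrow>
    (\<Oplus>i\<in>{..<r}. ghost (u i t) (v i t)) = ghost (\<Oplus>\<^bsub>A\<^esub>i\<in>{..<r}. u i t) (V t))"
proof (induction r)
  case 0
  show ?case by (intro exI[of _ "\<lambda>t. \<zero>\<^bsub>A\<^esub>"]) (auto simp: ghost_zero intro: polyfun_const)
next
  case (Suc r)
  then obtain V where V0: "polyfun A V" "\<forall>t. valuation A t \<longrightarrow>
    (\<Oplus>i\<in>{..<r}. ghost (u i t) (v i t)) = ghost (\<Oplus>\<^bsub>A\<^esub>i\<in>{..<r}. u i t) (V t)"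
    by (elim exE conjE)
  note V = V0(1) V0(2)[THEN spec, THEN mp]
  let ?U = "\<lambda>t. \<Oplus>\<^bsub>A\<^esub>i\<in>{..<r}. u i t"
  have U: "polyfun A ?U" by (intro cod.polyfun_finsum u) auto
  let ?V = "\<lambda>t. V t \<oplus>\<^bsub>A\<^esub> v r t \<ominus>\<^bsub>A\<^esub> power_carry A p (?U t) (u r t)"
  show ?case
  proof (intro exI[of _ ?V] conjI allI impI)
    show "polyfun A ?V"
      by (intro polyfun_add cod.polyfun_minus cod.polyfun_carry U V u v)
    fix t :: "'w \<Rightarrow> 'b" assume t: "valuation A t"
    have cl: "u i t \<in> carrier A" "v i t \<in> carrier A" "V t \<in> carrier A" "?U t \<in> carrier A" for i
      using t by (simp_all add: polyfun_A_closed[OF u] polyfun_A_closed[OF v]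
          polyfun_A_closed[OF V(1)] polyfun_A_closed[OF U])
    have "(\<Oplus>i\<in>{..<Suc r}. ghost (u i t) (v i t)) = ghost (?U t) (V t) \<oplus> ghost (u r t) (v r t)"
      using cl V(2)[OF t] by (simp add: dom.finsum_lessThan_Suc)
    also have "\<dots> = ghost (?U t \<oplus>\<^bsub>A\<^esub> u r t) (?V t)" by (rule ghost_add) (use cl in auto)
    finally show "(\<Oplus>i\<in>{..<Suc r}. ghost (u i t) (v i t)) =
      ghost (\<Oplus>\<^bsub>A\<^esub>i\<in>{..<Suc r}. u i t) (?V t)" using cl by (simp add: cod.finsum_lessThan_Suc)
  qed
qed

text \<open>
  The tuples \<open>a\<close> that occur as first coordinates of a relation form a submodule of \<open>A\<^sup>m\<close>: relations can
  be added as Witt vectors, and \<open>c = h x\<close> acts by \<open>(a, b) \<mapsto> (c a, c\<^sup>p b)\<close>, which multiplies ghost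
  components by \<open>x\<^sup>p\<close>. Let \<open>g i\<close> generate this submodule and let \<open>(g i, l i)\<close> be relations. If
  \<open>a = \<Sum>\<^sub>i c\<^sub>i g\<^sub>i\<close>, then the sum of the relations \<open>(c\<^sub>i g\<^sub>i, c\<^sub>i\<^sup>p l\<^sub>i)\<close> is a relation \<open>(a, V)\<close> with \<open>V\<close>
  polynomial in \<open>c\<close>, and \<open>(a, b)\<close> is a relation iff \<open>(0, b - V)\<close> is one.
\<close>

lemma zero_set_definable:
  fixes G :: "('w \<Rightarrow> 'b) \<Rightarrow> 'a"
  assumes "repr G"
  shows "dpred A (\<lambda>t. G t = \<zero>)"
proof -
  from assms obtain a b where ab: "\<And>j. polyfun A (a j)" "\<And>j. polyfun A (b j)"
    "\<And>t. valuation A t \<Longrightarrow> G t = val (\<lambda>j. a j t) (\<lambda>j. b j t)" by (rule reprE) blast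
  let ?K = "{k. valuation A k \<and> (\<exists>l. valuation A l \<and> val k l = \<zero>)}"
  have K1: "k j \<in> carrier A" if "k \<in> ?K" for k j using that by blast
  have K2: "(\<lambda>j. \<zero>\<^bsub>A\<^esub>) \<in> ?K"
  proof -
    have "val (\<lambda>j. \<zero>\<^bsub>A\<^esub>) (\<lambda>j. \<zero>\<^bsub>A\<^esub>) = \<zero>" by (simp add: val_def ghost_zero)
    then show ?thesis by (intro CollectI conjI exI[of _ "\<lambda>j. \<zero>\<^bsub>A\<^esub>"]) auto
  qed
  have K3: "(\<lambda>j. k j \<oplus>\<^bsub>A\<^esub> k' j) \<in> ?K" if "k \<in> ?K" "k' \<in> ?K" for k k'
  proof -
    obtain l where l: "valuation A l" "val k l = \<zero>" using \<open>k \<in> ?K\<close> by blast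
    obtain l' where l': "valuation A l'" "val k' l' = \<zero>" using \<open>k' \<in> ?K\<close> by blast
    let ?l = "\<lambda>j. l j \<oplus>\<^bsub>A\<^esub> l' j \<ominus>\<^bsub>A\<^esub> power_carry A p (k j) (k' j)"
    have "val (\<lambda>j. k j \<oplus>\<^bsub>A\<^esub> k' j) ?l = val k l \<oplus> val k' l'"
      by (rule val_sum) (use that l l' in \<open>auto simp: ghost_add\<close>)
    then have "val (\<lambda>j. k j \<oplus>\<^bsub>A\<^esub> k' j) ?l = \<zero>" using l l' by simp
    moreover have "valuation A ?l" "\<forall>j. k j \<oplus>\<^bsub>A\<^esub> k' j \<in> carrier A"
      using that l l' by auto
    ultimately show ?thesis by (intro CollectI conjI exI[of _ ?l])
  qed
  have K4: "(\<lambda>j. c \<otimes>\<^bsub>A\<^esub> k j) \<in> ?K" if "c \<in> carrier A" "k \<in> ?K" for c k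
  proof -
    obtain l where l: "valuation A l" "val k l = \<zero>" using \<open>k \<in> ?K\<close> by blast
    obtain x where x: "x \<in> carrier B" "c = h x" using \<open>c \<in> carrier A\<close> by (rule liftE)
    let ?l = "\<lambda>j. c [^]\<^bsub>A\<^esub> p \<otimes>\<^bsub>A\<^esub> l j"
    have "val (\<lambda>j. c \<otimes>\<^bsub>A\<^esub> k j) ?l = x [^] p \<otimes> val k l"
      by (rule val_scale) (use that x l in \<open>auto simp: ghost_scale\<close>)
    then have "val (\<lambda>j. c \<otimes>\<^bsub>A\<^esub> k j) ?l = \<zero>" using l x by simp
    moreover have "valuation A ?l" "\<forall>j. c \<otimes>\<^bsub>A\<^esub> k j \<in> carrier A"
      using that l by auto
    ultimately show ?thesis by (intro CollectI conjI exI[of _ ?l])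
  qed
  have K: "tuple_submodule A ?K"
    unfolding tuple_submodule_def using K1 K2 K3 K4 by (intro conjI ballI allI)
  obtain r g where g: "\<forall>i. g i \<in> ?K" "\<forall>k\<in>?K. \<exists>c. valuation A c \<and>
    (\<forall>j<m. k j = (\<Oplus>\<^bsub>A\<^esub>i\<in>{..<r::nat}. c i \<otimes>\<^bsub>A\<^esub> g i j))"
    using cod.submodule_of_tuples_finitely_generated[OF noetherian_A K, of m]
    by (elim exE conjE)
  have gc: "g i j \<in> carrier A" for i j using g(1) by blast
  have "\<forall>i. \<exists>l. valuation A l \<and> val (g i) l = \<zero>" using g(1) by blast
  then obtain l where l: "\<And>i j. l i j \<in> carrier A" "\<And>i. val (g i) (l i) = \<zero>" by metis
  define u where "u j i e = e (Inl i) \<otimes>\<^bsub>A\<^esub> g i j" for j i and e :: "nat + 'w \<Rightarrow> 'b"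
  define v where "v j i e = e (Inl i) [^]\<^bsub>A\<^esub> p \<otimes>\<^bsub>A\<^esub> l i j" for j i and e :: "nat + 'w \<Rightarrow> 'b"
  have u: "polyfun A (u j i)" and v: "polyfun A (v j i)" for j i
    unfolding u_def v_def
    by (intro polyfun_mult polyfun_const cod.polyfun_pow polyfun_var cod.ring_axioms gc l)+
  have "\<forall>j. \<exists>V. polyfun A V \<and> (\<forall>t. valuation A t \<longrightarrow>
    (\<Oplus>i\<in>{..<r}. ghost (u j i t) (v j i t)) = ghost (\<Oplus>\<^bsub>A\<^esub>i\<in>{..<r}. u j i t) (V t))"
    by (intro allI ghost_sum u v)
  then obtain V where V: "\<forall>j. polyfun A (V j) \<and> (\<forall>t. valuation A t \<longrightarrow>
    (\<Oplus>i\<in>{..<r}. ghost (u j i t) (v j i t)) = ghost (\<Oplus>\<^bsub>A\<^esub>i\<in>{..<r}. u j i t) (V j t))"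
    by (rule choice[THEN exE])
  have Vp: "polyfun A (V j)" for j using V by blast
  let ?D = "\<lambda>e. (\<forall>j\<in>{..<m}. a j (\<lambda>v. e (Inr v)) = (\<Oplus>\<^bsub>A\<^esub>i\<in>{..<r}. u j i e)) \<and>
    val (\<lambda>j. \<zero>\<^bsub>A\<^esub>) (\<lambda>j. b j (\<lambda>v. e (Inr v)) \<ominus>\<^bsub>A\<^esub> V j e) = \<zero>"
  have "dpred A ?D"
  proof (rule dpred_conj, rule dpred_ball[OF cod.ring_axioms finite_lessThan], rule dpred_eq)
    show "polyfun A (\<lambda>e. a j (\<lambda>v. e (Inr v)))" for j by (rule polyfun_subst[OF ab(1)])
    show "polyfun A (\<lambda>e. \<Oplus>\<^bsub>A\<^esub>i\<in>{..<r}. u j i e)" for j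
      by (intro cod.polyfun_finsum u) auto
    have "polyfun A (\<lambda>e. b j (\<lambda>v. e (Inr v)))" for j by (rule polyfun_subst[OF ab(2)])
    then show "dpred A (\<lambda>e. val (\<lambda>j. \<zero>\<^bsub>A\<^esub>) (\<lambda>j. b j (\<lambda>v. e (Inr v)) \<ominus>\<^bsub>A\<^esub> V j e) = \<zero>)"
      by (intro zero_ghost_definable cod.polyfun_minus Vp)
  qed
  from dpred_ex_block[OF cod.ring_axioms this] show ?thesis
  proof (rule dpred_cong)
    fix t :: "'w \<Rightarrow> 'b" assume t: "valuation A t"
    have cl: "a j t \<in> carrier A" "b j t \<in> carrier A" for j
      using t by (simp_all add: polyfun_A_closed[OF ab(1)] polyfun_A_closed[OF ab(2)])
    have key: "G t = val (\<lambda>j. \<zero>\<^bsub>A\<^esub>) (\<lambda>j. b j t \<ominus>\<^bsub>A\<^esub> V j (case_sum s t))"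
      if s: "valuation A s"
        "\<forall>j\<in>{..<m}. a j t = (\<Oplus>\<^bsub>A\<^esub>i\<in>{..<r}. u j i (case_sum s t))" for s
    proof -
      let ?e = "case_sum s t"
      have e: "valuation A ?e" using s t by (auto split: sum.split)
      have cle: "u j i ?e \<in> carrier A" "v j i ?e \<in> carrier A" "V j ?e \<in> carrier A"
        "(\<Oplus>\<^bsub>A\<^esub>i\<in>{..<n}. u j i ?e) \<in> carrier A" for i j and n :: nat
        using e by (auto intro!: cod.finsum_closed
            simp: polyfun_A_closed[OF u] polyfun_A_closed[OF v] polyfun_A_closed[OF Vp])
      \<comment> \<open>Partial sums of the relations \<open>(c\<^sub>i g\<^sub>i, c\<^sub>i\<^sup>p l\<^sub>i)\<close> are relations.\<close>
      have relations: "(\<Oplus>j\<in>{..<m}. y j \<otimes> (\<Oplus>i\<in>{..<n}. ghost (u j i ?e) (v j i ?e))) = \<zero>"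
        for n :: nat
      proof (induction n)
        case (Suc n)
        obtain x where x: "x \<in> carrier B" "s n = h x" using s(1)[rule_format, of n] by (rule liftE)
        have "val (\<lambda>j. u j n ?e) (\<lambda>j. v j n ?e) = x [^] p \<otimes> val (g n) (l n)"
          by (rule val_scale) (use x gc l in \<open>auto simp: u_def v_def ghost_scale\<close>)
        then have z: "val (\<lambda>j. u j n ?e) (\<lambda>j. v j n ?e) = \<zero>" using l(2) x by simp
        have sc: "(\<Oplus>i\<in>{..<k}. ghost (u j i ?e) (v j i ?e)) \<in> carrier B" for j and k :: nat
          using cle by (intro dom.finsum_closed) auto
        have "(\<Oplus>j\<in>{..<m}. y j \<otimes> (\<Oplus>i\<in>{..<Suc n}. ghost (u j i ?e) (v j i ?e))) =
          (\<Oplus>j\<in>{..<m}. y j \<otimes> (\<Oplus>i\<in>{..<n}. ghost (u j i ?e) (v j i ?e)) \<oplus>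
            y j \<otimes> ghost (u j n ?e) (v j n ?e))"
          by (rule dom.finsum_cong')
            (use cle sc in \<open>auto simp: dom.finsum_lessThan_Suc dom.r_distr\<close>)
        also have "\<dots> = (\<Oplus>j\<in>{..<m}. y j \<otimes> (\<Oplus>i\<in>{..<n}. ghost (u j i ?e) (v j i ?e))) \<oplus>
            val (\<lambda>j. u j n ?e) (\<lambda>j. v j n ?e)"
          unfolding val_def by (rule dom.finsum_addf) (use cle sc in auto)
        finally show ?case using Suc.IH z by simp
      qed simp
      have "val (\<lambda>j. \<Oplus>\<^bsub>A\<^esub>i\<in>{..<r}. u j i ?e) (\<lambda>j. V j ?e) = 
        (\<Oplus>j\<in>{..<m}. y j \<otimes> (\<Oplus>i\<in>{..<r}. ghost (u j i ?e) (v j i ?e)))"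
        unfolding val_def using V e by simp
      then have 0: "val (\<lambda>j. \<Oplus>\<^bsub>A\<^esub>i\<in>{..<r}. u j i ?e) (\<lambda>j. V j ?e) = \<zero>"
        using relations by simp
      have "G t = val (\<lambda>j. \<Oplus>\<^bsub>A\<^esub>i\<in>{..<r}. u j i ?e) (\<lambda>j. V j ?e) \<oplus>
        val (\<lambda>j. \<zero>\<^bsub>A\<^esub>) (\<lambda>j. b j t \<ominus>\<^bsub>A\<^esub> V j ?e)"
        unfolding ab(3)[OF t]
      proof (rule val_sum)
        fix j assume j: "j < m"
        let ?d = "b j t \<ominus>\<^bsub>A\<^esub> V j ?e"
        have "b j t = V j ?e \<oplus>\<^bsub>A\<^esub> ?d" using cl(2)[of j] cle(3)[of j] by algebra
        then have "ghost (a j t) (b j t) = ghost (a j t) (V j ?e \<oplus>\<^bsub>A\<^esub> ?d)" by simp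
        also have "\<dots> = ghost (a j t) (V j ?e) \<oplus> ghost \<zero>\<^bsub>A\<^esub> ?d"
          by (rule ghost_zero_add) (use cl cle in auto)
        finally show "ghost (a j t) (b j t) =
          ghost (\<Oplus>\<^bsub>A\<^esub>i\<in>{..<r}. u j i ?e) (V j ?e) \<oplus> ghost \<zero>\<^bsub>A\<^esub> ?d"
          using s(2) j by simp
      qed (use cl cle in auto)
      moreover have "val (\<lambda>j. \<zero>\<^bsub>A\<^esub>) (\<lambda>j. b j t \<ominus>\<^bsub>A\<^esub> V j ?e) \<in> carrier B"
        using cl cle by (intro val_closed) auto
      ultimately show ?thesis using 0 by simp
    qed
    show "(\<exists>s. valuation A s \<and>
      (\<forall>j\<in>{..<m}. a j (\<lambda>v. case_sum s t (Inr v)) = (\<Oplus>\<^bsub>A\<^esub>i\<in>{..<r}. u j i (case_sum s t))) \<and>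
      val (\<lambda>j. \<zero>\<^bsub>A\<^esub>) (\<lambda>j. b j (\<lambda>v. case_sum s t (Inr v)) \<ominus>\<^bsub>A\<^esub> V j (case_sum s t)) = \<zero>) =
      (G t = \<zero>)" (is "?L = ?R")
    proof
      assume ?L
      then show ?R using key by auto
    next
      assume ?R
      then have "(\<lambda>j. a j t) \<in> ?K" using cl ab(3)[OF t]
        by (intro CollectI conjI exI[of _ "\<lambda>j. b j t"]) auto
      from g(2)[THEN bspec, OF this] obtain c where "valuation A c"
        "\<forall>j<m. a j t = (\<Oplus>\<^bsub>A\<^esub>i\<in>{..<r}. c i \<otimes>\<^bsub>A\<^esub> g i j)" by (elim exE conjE)
      then show ?L using key[of c] \<open>?R\<close> by (intro exI[of _ c]) (auto simp: u_def)
    qed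
  qed
qed

lemma equal_set_definable:
  assumes "repr F" "repr G" shows "dpred A (\<lambda>t. F t = G t)"
proof -
  have "repr (\<lambda>t. F t \<oplus> (\<ominus> \<one>) \<otimes> G t)"
    by (intro repr_add repr_mult repr_const assms) simp
  from zero_set_definable[OF this] show ?thesis
  proof (rule dpred_cong)
    fix t :: "'c \<Rightarrow> 'b" assume "valuation A t"
    then have c: "F t \<in> carrier B" "G t \<in> carrier B" using assms repr_closed by auto
    have "F t \<oplus> (\<ominus> \<one>) \<otimes> G t = F t \<ominus> G t" using c by algebra
    then show "(F t \<oplus> (\<ominus> \<one>) \<otimes> G t = \<zero>) = (F t = G t)"
      using c by (simp add: dom.r_right_minus_eq)
  qed
qed

definition code :: "(nat \<Rightarrow> 'b) \<Rightarrow> 'a" where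
  "code s = val (\<lambda>j. s (2 * j)) (\<lambda>j. s (Suc (2 * j)))"

lemma repr_code: "repr code"
  by (rule reprI[of "\<lambda>j s. s (2 * j)" "\<lambda>j s. s (Suc (2 * j))"])
    (auto simp: code_def intro: polyfun_var cod.ring_axioms)

lemma code_closed: "(\<And>i. s i \<in> carrier A) \<Longrightarrow> code s \<in> carrier B"
  by (rule repr_closed[OF repr_code])

lemma code_surj:
  assumes "x \<in> carrier B"
  obtains s where "valuation A s" "x = code s"
proof -
  obtain a b where "valuation A a" "valuation A b" "x = val a b"
    using spanning[OF assms] unfolding val_def by blast
  then show thesis
    by (intro that[of "interleave a b"]) (auto simp: code_def interleave_def)
qed

text \<open>
  A quantifier over \<open>B\<close> becomes a quantifier over codes. The code of the new element and the old
  variables share one sequence, at its even and odd positions.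
\<close>

lemma satisfaction_definable:
  fixes G :: "nat \<Rightarrow> (nat \<Rightarrow> 'b) \<Rightarrow> 'a"
  assumes "\<And>i. repr (G i)"
  shows "dpred A (\<lambda>t. rsat B (\<lambda>i. G i t) q)"
  using assms
proof (induction q arbitrary: G)
  case (Eq s t)
  show ?case by (simp, intro equal_set_definable repr_rterm Eq)
next
  case (Neg q)
  then show ?case by (auto intro: dpred_not)
next
  case (Conj q1 q2)
  then show ?case by (auto intro: dpred_conj)
next
  case (Ex q)
  let ?G = "\<lambda>i t. case i of 0 \<Rightarrow> code (\<lambda>k. t (2 * k)) | Suc i \<Rightarrow> G i (\<lambda>k. t (Suc (2 * k)))"
  have "repr (?G i)" for i
    by (cases i) (auto intro: repr_subst[OF repr_code] repr_subst[OF Ex.prems])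
  then have "dpred A (\<lambda>t. rsat B (\<lambda>i. ?G i t) q)" by (rule Ex.IH)
  from dpred_rename[OF cod.ring_axioms this, of "\<lambda>k. if even k then Inl (k div 2) else Inr (k div 2)"]
  have "dpred A (\<lambda>e. rsat B (\<lambda>i. case i of 0 \<Rightarrow> code (\<lambda>k. e (Inl k)) | Suc i \<Rightarrow> G i (\<lambda>k. e (Inr k))) q)"
    by (rule dpred_cong, intro arg_cong[where f = "\<lambda>e. rsat B e q"])
      (auto simp: fun_eq_iff split: nat.split)
  from dpred_ex_block[OF cod.ring_axioms this] show ?case
  proof (rule dpred_cong)
    fix t :: "nat \<Rightarrow> 'b" assume t: "valuation A t"
    have "(\<exists>s. valuation A s \<and> rsat B (case_nat (code s) (\<lambda>i. G i t)) q) =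
      (\<exists>x\<in>carrier B. rsat B (case_nat x (\<lambda>i. G i t)) q)"
      by (metis code_closed code_surj)
    then show "(\<exists>s. valuation A s \<and> rsat B (\<lambda>i. case i of 0 \<Rightarrow> code (\<lambda>k. case_sum s t (Inl k))
       | Suc i \<Rightarrow> G i (\<lambda>k. case_sum s t (Inr k))) q) = rsat B (\<lambda>i. G i t) (Ex q)"
      by (simp cong: nat.case_cong)
  qed
qed

lemma h_code:
  assumes "\<And>i. s i \<in> carrier A"
  shows "h (code s) = (\<Oplus>\<^bsub>A\<^esub>j\<in>{..<m}. h (y j) \<otimes>\<^bsub>A\<^esub>
    (s (2 * j) [^]\<^bsub>A\<^esub> p \<oplus>\<^bsub>A\<^esub> p\<^sub>A \<otimes>\<^bsub>A\<^esub> s (Suc (2 * j))))"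
proof -
  have "h (code s) = (\<Oplus>\<^bsub>A\<^esub>j\<in>{..<m}. h (y j \<otimes> ghost (s (2 * j)) (s (Suc (2 * j)))))"
    unfolding code_def val_def by (subst hom.hom_finsum) (use assms in \<open>auto simp: comp_def\<close>)
  also have "\<dots> = (\<Oplus>\<^bsub>A\<^esub>j\<in>{..<m}. h (y j) \<otimes>\<^bsub>A\<^esub>
    (s (2 * j) [^]\<^bsub>A\<^esub> p \<oplus>\<^bsub>A\<^esub> p\<^sub>A \<otimes>\<^bsub>A\<^esub> s (Suc (2 * j))))"
    by (rule cod.finsum_cong') (use assms in \<open>auto simp: h_ghost\<close>)
  finally show ?thesis .
qed

lemma code_h:
  assumes "\<And>i. e i \<in> carrier B"
  shows "code (\<lambda>i. h (e i)) = (\<Oplus>j\<in>{..<m}. y j \<otimes>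
    (e (2 * j) [^] p \<oplus> p\<^sub>B \<otimes> e (Suc (2 * j))))"
  unfolding code_def val_def by (rule dom.finsum_cong') (use assms in \<open>auto simp: ghost_h\<close>)

text \<open>
  A tuple \<open>a\<close> lies in the image of \<open>Q\<close> iff there are codes whose values satisfy \<open>Q\<close> and are mapped to
  \<open>a\<close>. The second condition is imposed on the finitely many variables \<open>W\<close> that \<open>Q\<close> depends on; it is
  polynomial because \<open>h (ghost a b) = a\<^sup>p + p b\<close>.
\<close>

lemma image_definable:
  fixes Q :: "(nat \<Rightarrow> 'a) \<Rightarrow> bool"
  assumes "dpred B Q"
  shows "dpred A (\<lambda>a. \<exists>e. valuation B e \<and> (\<forall>i. h (e i) = a i) \<and> Q e)"
proof -
  obtain q \<rho> c where q: "valuation B c"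
    "\<And>e. valuation B e \<Longrightarrow> Q e = rsat B (assign \<rho> c e) q"
    using assms by (rule dpredE) blast
  obtain W where W: "finite W" "\<And>e e'. valuation B e \<Longrightarrow> valuation B e' \<Longrightarrow>
    (\<forall>v\<in>W. e v = e' v) \<Longrightarrow> Q e = Q e'"
    using dpred_finite_support[OF assms] by blast
  let ?F = "\<lambda>t v. code (\<lambda>k. t (prod_encode (v, k)))"
  let ?G = "\<lambda>i t. case \<rho> i of None \<Rightarrow> c i | Some v \<Rightarrow> ?F t v"
  have "repr (?G i)" for i
    by (cases "\<rho> i") (use q(1) in \<open>auto intro: repr_const repr_subst[OF repr_code]\<close>)
  from satisfaction_definable[of ?G q, OF this]
  have "dpred A (\<lambda>t. Q (?F t))"
  proof (rule dpred_cong)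
    fix t :: "nat \<Rightarrow> 'b" assume t: "valuation A t"
    have "(\<lambda>i. ?G i t) = assign \<rho> c (?F t)" by (auto simp: assign_def fun_eq_iff)
    then show "rsat B (\<lambda>i. ?G i t) q = Q (?F t)" using q(2)[of "?F t"] t by (simp add: code_closed)
  qed
  from dpred_rename[OF cod.ring_axioms this, of Inl]
  have 1: "dpred A (\<lambda>e :: nat + nat \<Rightarrow> 'b. Q (?F (\<lambda>k. e (Inl k))))" .
  have 2: "dpred A (\<lambda>e :: nat + nat \<Rightarrow> 'b. \<forall>v\<in>W. h (?F (\<lambda>k. e (Inl k)) v) = e (Inr v))"
  proof (rule dpred_ball[OF cod.ring_axioms W(1)])
    fix v
    have "polyfun A (\<lambda>e :: nat + nat \<Rightarrow> 'b. \<Oplus>\<^bsub>A\<^esub>j\<in>{..<m}. h (y j) \<otimes>\<^bsub>A\<^esub>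
      (e (Inl (prod_encode (v, 2 * j))) [^]\<^bsub>A\<^esub> p \<oplus>\<^bsub>A\<^esub>
        p\<^sub>A \<otimes>\<^bsub>A\<^esub> e (Inl (prod_encode (v, Suc (2 * j))))))"
      by (intro cod.polyfun_finsum polyfun_mult polyfun_add cod.polyfun_pow polyfun_const
          polyfun_var cod.ring_axioms) auto
    then have "polyfun A (\<lambda>e :: nat + nat \<Rightarrow> 'b. h (?F (\<lambda>k. e (Inl k)) v))"
      by (rule polyfun_cong) (simp add: h_code)
    then show "dpred A (\<lambda>e :: nat + nat \<Rightarrow> 'b. h (?F (\<lambda>k. e (Inl k)) v) = e (Inr v))"
      by (intro dpred_eq polyfun_var cod.ring_axioms)
  qed
  from dpred_ex_block[OF cod.ring_axioms dpred_conj[OF 1 2]] show ?thesis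
  proof (rule dpred_cong)
    fix a :: "nat \<Rightarrow> 'b" assume a: "valuation A a"
    show "(\<exists>s. valuation A s \<and> Q (?F (\<lambda>k. case_sum s a (Inl k))) \<and>
       (\<forall>v\<in>W. h (?F (\<lambda>k. case_sum s a (Inl k)) v) = case_sum s a (Inr v))) =
      (\<exists>e. valuation B e \<and> (\<forall>i. h (e i) = a i) \<and> Q e)" (is "?L = ?R")
    proof
      assume ?L
      then obtain s where s: "valuation A s" "Q (?F s)" "\<forall>v\<in>W. h (?F s v) = a v"
        by auto
      let ?e = "\<lambda>v. if v \<in> W then ?F s v else lift (a v)"
      have e: "valuation B ?e" "\<forall>v. ?F s v \<in> carrier B"
        using s(1) a lift by (auto simp: code_closed)
      have "Q ?e = Q (?F s)" by (rule W(2)) (use e in auto)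
      then show ?R using s(2,3) e(1) a lift by (intro exI[of _ ?e]) auto
    next
      assume ?R
      then obtain e where e: "valuation B e" "\<forall>i. h (e i) = a i" "Q e" by blast
      have "\<forall>i. \<exists>s. valuation A s \<and> e i = code s" using e(1) code_surj by metis
      then obtain s where s: "\<And>i k. s i k \<in> carrier A" "\<And>i. e i = code (s i)" by metis
      let ?s = "\<lambda>l. s (fst (prod_decode l)) (snd (prod_decode l))"
      have "?F ?s = e" using s(2) by (simp add: fun_eq_iff)
      then show ?L using e s(1) by (intro exI[of _ ?s]) auto
    qed
  qed
qed

text \<open>
  Only equations need an argument: \<open>h u = h v\<close> means that \<open>u - v\<close> is a multiple of \<open>eps\<close>.
\<close>

lemma preimage_definable:
  "dpred B (\<lambda>e. rsat A (\<lambda>i. h (e i)) q)"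
proof (induction q)
  case (Eq s t)
  have rt: "rterm_val A (\<lambda>i. h (e i)) s = h (rterm_val B e s)"
    if "valuation B e" for e :: "nat \<Rightarrow> 'a" and s
    using that by (induction s) (auto simp: rterm_val_closed dom.ring_axioms)
  have "dpred B (\<lambda>e. rterm_val B (\<lambda>i. e (Suc i)) s =
      rterm_val B (\<lambda>i. e (Suc i)) t \<oplus> e 0 \<otimes> eps)"
    by (intro dpred_eq polyfun_add polyfun_mult polyfun_const polyfun_var dom.polyfun_rterm
        dom.ring_axioms eps_closed)
  from dpred_ex_element[OF dom.ring_axioms this] show ?case
    by (rule dpred_cong) (simp add: rt h_eq_iff rterm_val_closed dom.ring_axioms)
next
  case (Neg q)
  then show ?case by (auto intro: dpred_not)
next
  case (Conj q1 q2)
  then show ?case by (auto intro: dpred_conj)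
next
  case (Ex q)
  from dpred_ex_element[OF dom.ring_axioms this] show ?case
  proof (rule dpred_cong)
    fix e :: "nat \<Rightarrow> 'a" assume e: "valuation B e"
    have "(\<lambda>i. h (case_nat x e i)) = case_nat (h x) (\<lambda>i. h (e i))" for x
      by (auto simp: fun_eq_iff split: nat.split)
    then have "(\<exists>x\<in>carrier B. rsat A (\<lambda>i. h (case_nat x e i)) q) =
      (\<exists>a\<in>h ` carrier B. rsat A (case_nat a (\<lambda>i. h (e i))) q)"
      by (simp only: bex_simps)
    then show "(\<exists>a\<in>carrier B. rsat A (\<lambda>i. h (case_nat a e i)) q) = rsat A (\<lambda>i. h (e i)) (Ex q)"
      unfolding surj by simp
  qed
qed

lemma code_cong:
  assumes "\<And>i. i < 2 * m \<Longrightarrow> s i = t i" "\<And>i. t i \<in> carrier A"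
  shows "code s = code t"
  unfolding code_def by (rule val_cong) (use assms in auto)

text \<open>
  Codes are cut off after \<open>2 * m\<close> entries by passing to an \<open>s\<close> with the same beginning, so that the
  relation makes sense for sequences with entries outside \<open>A\<close> further on.
\<close>

lemma code_codes:
  "codes B A h (2 * m) (\<lambda>a z. \<exists>s. valuation A s \<and> (\<forall>i<2 * m. s i = a i) \<and> z = code s)"
  (is "codes B A h _ ?R")
  unfolding codes_def
proof (intro conjI allI impI ballI)
  fix z assume "z \<in> carrier B"
  then obtain s where "valuation A s" "z = code s" by (rule code_surj)
  then show "\<exists>a. valuation A a \<and> ?R a z" by blast
next
  fix a z z' assume "?R a z" "?R a z'"
  then obtain s t where "valuation A s" "valuation A t"
    "\<forall>i<2 * m. s i = a i" "\<forall>i<2 * m. t i = a i" "z = code s" "z' = code t" by blast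
  then show "z = z'" using code_cong[of s t] by simp
next
  have "polyfun B (\<lambda>e. \<Oplus>j\<in>{..<m}. y j \<otimes>
    (e (Suc (2 * j)) [^] p \<oplus> p\<^sub>B \<otimes> e (Suc (Suc (2 * j)))))"
    by (intro dom.polyfun_finsum polyfun_mult polyfun_add dom.polyfun_pow polyfun_const
          polyfun_var dom.ring_axioms) auto
  then have "polyfun B (\<lambda>e. code (\<lambda>i. h (e (Suc i))))"
    by (rule polyfun_cong) (simp add: code_h)
  then have "dpred B (\<lambda>e. e 0 = code (\<lambda>i. h (e (Suc i))))"
    by (intro dpred_eq polyfun_var dom.ring_axioms)
  then show "dpred B (\<lambda>e. ?R (\<lambda>i. h (e (Suc i))) (e 0))"
  proof (rule dpred_cong)
    fix e :: "nat \<Rightarrow> 'a" assume e: "valuation B e"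
    show "(e 0 = code (\<lambda>i. h (e (Suc i)))) = ?R (\<lambda>i. h (e (Suc i))) (e 0)"
    proof
      assume "e 0 = code (\<lambda>i. h (e (Suc i)))"
      then show "?R (\<lambda>i. h (e (Suc i))) (e 0)"
        using e by (intro exI[of _ "\<lambda>i. h (e (Suc i))"]) auto
    next
      assume "?R (\<lambda>i. h (e (Suc i))) (e 0)"
      then obtain s where "\<forall>i<2 * m. s i = h (e (Suc i))" "e 0 = code s" by blast
      then show "e 0 = code (\<lambda>i. h (e (Suc i)))"
        using code_cong[of s "\<lambda>i. h (e (Suc i))"] e by simp
    qed
  qed
qed simp

lemma tame: "tame_surjection B A h"
proof unfold_locales
  show "\<exists>m R. codes B A h m R" using code_codes by blast
qed (fact surj preimage_definable image_definable)+

end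

theorem (in infinitesimal_extension) tame: "tame_surjection B A h"
proof -
  obtain m y where "valuation B y" "\<forall>x\<in>carrier B. \<exists>a b. valuation A a \<and>
     valuation A b \<and> x = (\<Oplus>j\<in>{..<m::nat}. y j \<otimes> ghost (a j) (b j))"
    using ghost_spanning by blast
  then interpret infinitesimal_extension_basis B A h eps p m y by unfold_locales blast+
  show ?thesis by (rule tame)
qed

section \<open>From the reduced ring to the ring\<close>

lemma carrier_quotient: "carrier (R Quot I) = (+>\<^bsub>R\<^esub>) I ` carrier R"
  by (simp only: FactRing_def partial_object.simps A_RCOSETS_def' UNION_singleton_eq_range)

lemma zero_quotient: "\<zero>\<^bsub>R Quot I\<^esub> = I"
  by (simp add: FactRing_def)

text \<open>
  An isomorphism is an extension by the zero ideal, and any prime will do.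
\<close>

lemma tame_isomorphism:
  assumes "cring B" "cring A" "finitely_generated_ring B" and hom: "h \<in> ring_hom B A"
    and surj: "h ` carrier B = carrier A"
    and inj: "\<And>x. x \<in> carrier B \<Longrightarrow> h x = \<zero>\<^bsub>A\<^esub> \<Longrightarrow> x = \<zero>\<^bsub>B\<^esub>"
  shows "tame_surjection B A h"
proof -
  interpret B: cring B by fact
  interpret A: cring A by fact
  interpret hom: ring_hom_cring B A h by unfold_locales (rule hom)
  have "infinitesimal_extension B A h \<zero>\<^bsub>B\<^esub> 2"
  proof unfold_locales
    fix x assume "x \<in> carrier B" "h x = \<zero>\<^bsub>A\<^esub>"
    then have "x = \<one>\<^bsub>B\<^esub> \<otimes>\<^bsub>B\<^esub> \<zero>\<^bsub>B\<^esub>" using inj by simp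
    then show "\<exists>b\<in>carrier B. x = b \<otimes>\<^bsub>B\<^esub> \<zero>\<^bsub>B\<^esub>" by blast
  qed (use hom surj assms(3) two_is_prime_nat in auto)
  then show ?thesis by (rule infinitesimal_extension.tame)
qed

context cring
begin

lemma ideal_submodule: "ideal J R \<Longrightarrow> submodule_over R (carrier R) J"
proof -
  assume "ideal J R"
  then interpret J: ideal J R .
  show ?thesis unfolding submodule_over_def using J.a_subset J.I_l_closed by auto
qed

lemma idealI_cring:
  assumes "submodule_over R (carrier R) J" shows "ideal J R"
proof -
  note J = submodule_overD[OF assms]
  show ?thesis
  proof (rule idealI[OF local.ring_axioms])
    have inv: "\<ominus> x \<in> J" if "x \<in> J" for x
    proof -
      have "(\<ominus> \<one>) \<otimes> x \<in> J" using J(4) that by simp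
      then show ?thesis using J(1)[OF that] by (simp add: l_minus)
    qed
    show "subgroup J (add_monoid R)"
      by (rule add.subgroupI) (use J inv in auto)
    fix a x assume "a \<in> J" "x \<in> carrier R"
    then show xa: "x \<otimes> a \<in> J" by (intro J(4))
    have "a \<otimes> x = x \<otimes> a" by (rule m_comm[OF J(1)]) fact+
    with xa show "a \<otimes> x \<in> J" by simp
  qed
qed

text \<open>
  The factor \<open>z\<close> makes the induction work: one factor of \<open>(x + y)\<^bsup>n+m\<^esup>\<close> is split off and
  \<open>x\<close> or \<open>y\<close> is absorbed into \<open>z\<close>.
\<close>

lemma sum_nilpotent:
  assumes x: "x \<in> carrier R" and y: "y \<in> carrier R" and "z \<in> carrier R"
    and "x [^] n \<otimes> z = \<zero>" "y [^] m \<otimes> z = \<zero>"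
  shows "(x \<oplus> y) [^] (n + m :: nat) \<otimes> z = \<zero>"
  using assms(3-5)
proof (induction "n + m" arbitrary: n m z rule: less_induct)
  case less
  show ?case
  proof (cases "n = 0 \<or> m = 0")
    case True
    then have "z = \<zero>" using less.prems by auto
    then show ?thesis using x y by simp
  next
    case False
    then obtain n' m' where nm: "n = Suc n'" "m = Suc m'" by (metis not0_implies_Suc)
    have c: "x [^] k \<in> carrier R" "y [^] k \<in> carrier R" "(x \<oplus> y) [^] k \<in> carrier R" for k :: nat
      using x y by auto
    have z: "z \<in> carrier R" by fact
    have 1: "(x \<oplus> y) [^] (n' + m) \<otimes> (x \<otimes> z) = \<zero>"
    proof (rule less.hyps)
      have "x [^] n' \<otimes> (x \<otimes> z) = x [^] n \<otimes> z" unfolding nm using c x z by (simp add: m_assoc)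
      then show "x [^] n' \<otimes> (x \<otimes> z) = \<zero>" using less.prems by simp
      have "y [^] m \<otimes> (x \<otimes> z) = x \<otimes> (y [^] m \<otimes> z)" using c x z by (simp add: m_lcomm)
      then show "y [^] m \<otimes> (x \<otimes> z) = \<zero>" using less.prems x by simp
    qed (use nm x z in auto)
    have 2: "(x \<oplus> y) [^] (n + m') \<otimes> (y \<otimes> z) = \<zero>"
    proof (rule less.hyps)
      have "y [^] m' \<otimes> (y \<otimes> z) = y [^] m \<otimes> z" unfolding nm using c y z by (simp add: m_assoc)
      then show "y [^] m' \<otimes> (y \<otimes> z) = \<zero>" using less.prems by simp
      have "x [^] n \<otimes> (y \<otimes> z) = y \<otimes> (x [^] n \<otimes> z)" using c y z by (simp add: m_lcomm)
      then show "x [^] n \<otimes> (y \<otimes> z) = \<zero>" using less.prems y by simp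
    qed (use nm y z in auto)
    have e: "n + m = Suc (n' + m)" "n + m' = n' + m" using nm by auto
    have "(x \<oplus> y) [^] (n + m) \<otimes> z =
      (x \<oplus> y) [^] (n' + m) \<otimes> (x \<otimes> z) \<oplus> (x \<oplus> y) [^] (n' + m) \<otimes> (y \<otimes> z)"
      unfolding e(1) using c[of "n' + m"] x y z by (simp add: m_assoc l_distr r_distr)
    then show ?thesis using 1 2 unfolding e(2) by simp
  qed
qed

lemma nilradical_ideal: "ideal (nilradical R) R"
proof (rule idealI_cring, unfold submodule_over_def, intro conjI ballI)
  show "nilradical R \<subseteq> carrier R" unfolding nilradical_def by blast
  have "\<zero> [^] (1::nat) = \<zero>" by simp
  then show "\<zero> \<in> nilradical R" unfolding nilradical_def by blast
next
  fix x y assume "x \<in> nilradical R" "y \<in> nilradical R"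
  then obtain n m :: nat where x: "x \<in> carrier R" "x [^] n = \<zero>" and y: "y \<in> carrier R" "y [^] m = \<zero>"
    unfolding nilradical_def by blast
  have "(x \<oplus> y) [^] (n + m) \<otimes> \<one> = \<zero>" by (rule sum_nilpotent) (use x y in auto)
  then have "(x \<oplus> y) [^] (n + m) = \<zero>" using x y by simp
  then show "x \<oplus> y \<in> nilradical R" using x y unfolding nilradical_def by blast
next
  fix s x assume s: "s \<in> carrier R" and "x \<in> nilradical R"
  then obtain n :: nat where x: "x \<in> carrier R" "x [^] n = \<zero>" unfolding nilradical_def by blast
  have "(s \<otimes> x) [^] n = \<zero>" using nat_pow_distrib[OF s x(1)] x s by simp
  then show "s \<otimes> x \<in> nilradical R" using s x unfolding nilradical_def by blast
qed

lemma wf_ideals: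
  assumes "noetherian_over R (carrier R)"
  shows "wf {(J', J). ideal J R \<and> ideal J' R \<and> J \<subset> J'}"
  unfolding wf_iff_no_infinite_down_chain
proof
  assume "\<exists>f. \<forall>i. (f (Suc i), f i) \<in> {(J', J). ideal J R \<and> ideal J' R \<and> J \<subset> J'}"
  then obtain f where "\<forall>i. ideal (f i) R \<and> ideal (f (Suc i)) R \<and> f i \<subset> f (Suc i)" by auto
  then have f: "\<And>i. ideal (f i) R" "\<And>i. f i \<subset> f (Suc i)" by blast+
  have mono: "f i \<subseteq> f j" if "i \<le> j" for i j
    by (rule lift_Suc_mono_le[of f, OF _ that]) (use f(2) in blast)
  note S = submodule_overD[OF ideal_submodule[OF f(1)]]
  have "submodule_over R (carrier R) (\<Union>i. f i)"
    unfolding submodule_over_def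
  proof (intro conjI ballI subsetI)
    fix x assume "x \<in> (\<Union>i. f i)" then show "x \<in> carrier R" using S(1) by blast
  next
    show "\<zero> \<in> (\<Union>i. f i)" using S(2) by blast
  next
    fix x y assume "x \<in> (\<Union>i. f i)" "y \<in> (\<Union>i. f i)"
    then obtain i j where "x \<in> f i" "y \<in> f j" by blast
    then have "x \<in> f (max i j)" "y \<in> f (max i j)"
      using mono[of i "max i j"] mono[of j "max i j"] by auto
    then show "x \<oplus> y \<in> (\<Union>i. f i)" using S(3) by blast
  next
    fix s x assume "s \<in> carrier R" "x \<in> (\<Union>i. f i)"
    then show "s \<otimes> x \<in> (\<Union>i. f i)" using S(4) by blast
  qed
  moreover have "(\<Union>i. f i) \<subseteq> carrier R" using S(1) by blast
  ultimately have "\<exists>G\<subseteq>(\<Union>i. f i). finite G \<and> (\<Union>i. f i) \<subseteq> lspan R (carrier R) G"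
    using assms unfolding noetherian_over_def by (elim allE impE)
  then obtain G where G: "G \<subseteq> (\<Union>i. f i)" "finite G" "(\<Union>i. f i) \<subseteq> lspan R (carrier R) G"
    by (elim exE conjE)
  have "\<forall>g\<in>G. \<exists>n. g \<in> f n" using G(1) by blast
  then obtain N where N: "\<forall>g\<in>G. g \<in> f (N g)" by (rule bchoice[THEN exE])
  let ?n = "Max (N ` G)"
  have "g \<in> f ?n" if "g \<in> G" for g
    using N that G(2) mono[of "N g" ?n] by auto
  then have "lspan R (carrier R) G \<subseteq> f ?n"
    by (intro lspan_subset ideal_submodule f(1)) blast
  then show False using G(3) f(2)[of ?n] by blast
qed

text \<open>
  The hypotheses say that modulo \<open>J\<close> the ideal \<open>J'\<close> is generated by \<open>v\<close>, with \<open>v\<^sup>2 = 0\<close> and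
  \<open>p v = 0\<close>.
\<close>

lemma quotient_step:
  assumes fg: "finitely_generated_ring R" and J: "ideal J R" and J': "ideal J' R" and "J \<subseteq> J'"
    and v: "v \<in> J'" "v \<otimes> v \<in> J" and prime: "Factorial_Ring.prime (p::nat)" "[p] \<cdot> \<one> \<otimes> v \<in> J"
    and J'_eq: "\<And>a. a \<in> J' \<Longrightarrow> \<exists>j\<in>J. \<exists>b\<in>carrier R. a = j \<oplus> b \<otimes> v"
  shows "\<exists>h. tame_surjection (R Quot J) (R Quot J') h"
proof -
  interpret J: ideal J R by fact
  interpret J': ideal J' R by fact
  interpret Q: cring "R Quot J" by (rule J.quotient_is_cring[OF is_cring])
  interpret pr: ring_hom_cring R "R Quot J" "(+>) J" by (rule J.rcos_ring_hom_cring[OF is_cring])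
  interpret pr': ring_hom_cring R "R Quot J'" "(+>) J'" by (rule J'.rcos_ring_hom_cring[OF is_cring])
  have car: "carrier (R Quot J) = (+>) J ` carrier R" "carrier (R Quot J') = (+>) J' ` carrier R"
    by (simp_all only: carrier_quotient)
  have zero: "\<zero>\<^bsub>R Quot J\<^esub> = J" "\<zero>\<^bsub>R Quot J'\<^esub> = J'" by (rule zero_quotient)+
  have coset_J: "a \<in> J \<Longrightarrow> J +> a = \<zero>\<^bsub>R Quot J\<^esub>" for a
    unfolding zero using a_rcos_zero[OF J] by simp
  have vc: "v \<in> carrier R" using v(1) J'.a_subset by blast
  define h where "h C = J' +> (SOME x. x \<in> carrier R \<and> J +> x = C)" for C
  have h: "h (J +> x) = J' +> x" if x: "x \<in> carrier R" for x
  proof -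
    let ?y = "SOME y. y \<in> carrier R \<and> J +> y = J +> x"
    have y: "?y \<in> carrier R" "J +> ?y = J +> x"
      using someI[of "\<lambda>y. y \<in> carrier R \<and> J +> y = J +> x" x] x by auto
    have "?y \<ominus> x \<in> J" using quotient_eq_iff_same_a_r_cos[OF J y(1) x] y(2) by simp
    then have "?y \<ominus> x \<in> J'" using \<open>J \<subseteq> J'\<close> by blast
    then have "J' +> ?y = J' +> x" using quotient_eq_iff_same_a_r_cos[OF J' y(1) x] by simp
    then show ?thesis unfolding h_def .
  qed
  have hom: "h \<in> ring_hom (R Quot J) (R Quot J')"
  proof (rule ring_hom_memI)
    fix C assume "C \<in> carrier (R Quot J)"
    then obtain a where a: "a \<in> carrier R" "C = J +> a" unfolding car by blast
    then show "h C \<in> carrier (R Quot J')" unfolding car by (simp add: h)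
    fix C' assume "C' \<in> carrier (R Quot J)"
    then obtain b where b: "b \<in> carrier R" "C' = J +> b" unfolding car by blast
    have "h (J +> (a \<otimes> b)) = h (J +> a) \<otimes>\<^bsub>R Quot J'\<^esub> h (J +> b)"
      using a b by (simp only: h m_closed pr'.hom_mult)
    then show "h (C \<otimes>\<^bsub>R Quot J\<^esub> C') = h C \<otimes>\<^bsub>R Quot J'\<^esub> h C'"
      using a b by (simp only: pr.hom_mult)
    have "h (J +> (a \<oplus> b)) = h (J +> a) \<oplus>\<^bsub>R Quot J'\<^esub> h (J +> b)"
      using a b by (simp only: h a_closed pr'.hom_add)
    then show "h (C \<oplus>\<^bsub>R Quot J\<^esub> C') = h C \<oplus>\<^bsub>R Quot J'\<^esub> h C'"
      using a b by (simp only: pr.hom_add)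
  next
    have "h (J +> \<one>) = J' +> \<one>" by (rule h) simp
    then show "h \<one>\<^bsub>R Quot J\<^esub> = \<one>\<^bsub>R Quot J'\<^esub>" by (simp only: pr.hom_one pr'.hom_one)
  qed
  have "infinitesimal_extension (R Quot J) (R Quot J') h (J +> v) p"
  proof unfold_locales
    show "h \<in> ring_hom (R Quot J) (R Quot J')" by (rule hom)
    have "h ` (+>) J ` carrier R = (+>) J' ` carrier R"
      unfolding image_image by (rule image_cong) (simp_all add: h)
    then show "h ` carrier (R Quot J) = carrier (R Quot J')" unfolding car .
    show "J +> v \<in> carrier (R Quot J)" unfolding car using vc by blast
    show "(J +> v) \<otimes>\<^bsub>R Quot J\<^esub> (J +> v) = \<zero>\<^bsub>R Quot J\<^esub>"
      using coset_J[OF v(2)] vc by (simp only: pr.hom_mult)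
    show "Factorial_Ring.prime p" by (rule prime(1))
    have "J +> ([p] \<cdot> \<one> \<otimes> v) = [p] \<cdot>\<^bsub>R Quot J\<^esub> \<one>\<^bsub>R Quot J\<^esub> \<otimes>\<^bsub>R Quot J\<^esub> (J +> v)"
      using vc natural_closed[of p] by (simp only: pr.hom_mult pr.hom_natural)
    then show "[p] \<cdot>\<^bsub>R Quot J\<^esub> \<one>\<^bsub>R Quot J\<^esub> \<otimes>\<^bsub>R Quot J\<^esub> (J +> v) = \<zero>\<^bsub>R Quot J\<^esub>"
      using coset_J[OF prime(2)] by simp
    show "h (J +> v) = \<zero>\<^bsub>R Quot J'\<^esub>"
      unfolding zero h[OF vc] using a_rcos_zero[OF J' v(1)] .
    show "finitely_generated_ring (R Quot J)"
      by (rule pr.finitely_generated_image[OF fg car(1)[symmetric]])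
    fix C assume C: "C \<in> carrier (R Quot J)" "h C = \<zero>\<^bsub>R Quot J'\<^esub>"
    from C(1) obtain a where a0: "a \<in> carrier R" "C = J +> a" unfolding car by (rule imageE)
    have "J' +> a = J'" using C(2) unfolding a0(2) h[OF a0(1)] zero .
    note a = a0 this
    have "a \<in> J'" by (rule J'.rcos_const_imp_mem[OF a(1,3)])
    then obtain j b where jb: "j \<in> J" "b \<in> carrier R" "a = j \<oplus> b \<otimes> v" using J'_eq by blast
    have jc: "j \<in> carrier R" using jb(1) J.a_subset by blast
    have bvc: "b \<otimes> v \<in> carrier R" using jb(2) vc by simp
    have "C = (J +> j) \<oplus>\<^bsub>R Quot J\<^esub> ((J +> b) \<otimes>\<^bsub>R Quot J\<^esub> (J +> v))"
      unfolding a(2) jb(3) by (simp only: pr.hom_add[OF jc bvc] pr.hom_mult[OF jb(2) vc])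
    also have "\<dots> = (J +> b) \<otimes>\<^bsub>R Quot J\<^esub> (J +> v)"
      unfolding coset_J[OF jb(1)] using pr.hom_closed[OF jb(2)] pr.hom_closed[OF vc]
      by (simp only: Q.l_zero Q.m_closed)
    finally show "\<exists>b\<in>carrier (R Quot J). C = b \<otimes>\<^bsub>R Quot J\<^esub> (J +> v)"
      using pr.hom_closed[OF jb(2)] by blast
  qed
  from infinitesimal_extension.tame[OF this] have "tame_surjection (R Quot J) (R Quot J') h" .
  then show ?thesis by (intro exI[of _ h])
qed

text \<open>
  The last power \<open>u\<close> of \<open>x0\<close> outside \<open>J\<close> has its square in \<open>J\<close>. Among the multiples of \<open>u\<close>, let
  \<open>e u\<close> be the first one in \<open>J\<close>, and take \<open>v = (e / p) u\<close> for a prime divisor \<open>p\<close> of \<open>e\<close>.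
\<close>

lemma exists_small_element:
  assumes J: "ideal J R" and N: "x0 \<in> nilradical R" "x0 \<notin> J"
    and D: "D > 0" "\<And>x. x \<in> nilradical R \<Longrightarrow> [(D::nat)] \<cdot> \<one> \<otimes> x \<in> J"
  shows "\<exists>v p. v \<in> nilradical R \<and> v \<notin> J \<and> v \<otimes> v \<in> J \<and> Factorial_Ring.prime (p::nat) \<and>
    [p] \<cdot> \<one> \<otimes> v \<in> J"
proof -
  interpret J: ideal J R by fact
  interpret N: ideal "nilradical R" R by (rule nilradical_ideal)
  obtain n :: nat where n: "x0 \<in> carrier R" "x0 [^] n = \<zero>"
    using N(1) unfolding nilradical_def by blast
  define k where "k = (LEAST k::nat. x0 [^] k \<in> J)"
  have "x0 [^] n \<in> J" using n(2) by simp
  then have k: "x0 [^] k \<in> J" unfolding k_def by (rule LeastI)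
  have k_min: "x0 [^] i \<notin> J" if "i < k" for i :: nat
    using that not_less_Least unfolding k_def by blast
  have "k \<noteq> 0"
  proof
    assume "k = 0"
    then have "\<one> \<in> J" using k by simp
    then have "x0 \<otimes> \<one> \<in> J" using n(1) by (rule J.I_l_closed)
    then show False using N(2) n(1) by simp
  qed
  moreover have "k \<noteq> 1" using k N(2) n(1) by auto
  ultimately have k2: "k \<ge> 2" by simp
  define u where "u = x0 [^] (k - 1)"
  have u: "u \<in> nilradical R" "u \<notin> J" "u \<otimes> u \<in> J"
  proof -
    have "x0 [^] (k - 1) = x0 [^] (k - 2) \<otimes> x0"
    proof -
      have "k - 1 = Suc (k - 2)" using k2 by simp
      then show ?thesis by simp
    qed
    then show "u \<in> nilradical R" unfolding u_def using N.I_l_closed[OF N(1)] n(1) by simp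
    show "u \<notin> J" unfolding u_def by (rule k_min) (use k2 in simp)
    have "k - 1 + (k - 1) = k - 2 + k" using k2 by simp
    then have "u \<otimes> u = x0 [^] (k - 2 + k)"
      unfolding u_def nat_pow_mult[OF n(1)] by (rule arg_cong)
    also have "\<dots> = x0 [^] (k - 2) \<otimes> x0 [^] k" using n(1) by (simp add: nat_pow_mult)
    finally show "u \<otimes> u \<in> J" using J.I_l_closed[OF k] n(1) by simp
  qed
  have uc: "u \<in> carrier R" using u(1) N.a_subset by blast
  define e where "e = (LEAST e::nat. e > 0 \<and> [e] \<cdot> \<one> \<otimes> u \<in> J)"
  have "D > 0 \<and> [D] \<cdot> \<one> \<otimes> u \<in> J" using D u(1) by simp
  then have e: "e > 0 \<and> [e] \<cdot> \<one> \<otimes> u \<in> J" unfolding e_def by (rule LeastI)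
  have e_min: "\<not> (i > 0 \<and> [i] \<cdot> \<one> \<otimes> u \<in> J)" if "i < e" for i :: nat
    using that not_less_Least unfolding e_def by blast
  have "e \<noteq> 1" using e u(2) uc by auto
  then obtain p where p: "Factorial_Ring.prime p" "p dvd e" using prime_factor_nat by blast
  obtain c where c: "e = p * c" using p(2) by (rule dvdE)
  have c0: "c > 0" "c < e" using e c prime_gt_1_nat[OF p(1)] by auto
  let ?v = "[c] \<cdot> \<one> \<otimes> u"
  have "?v \<notin> J" using e_min[OF c0(2)] c0(1) by simp
  moreover have "?v \<in> nilradical R" by (rule N.I_l_closed[OF u(1)]) simp
  moreover have "?v \<otimes> ?v \<in> J"
  proof -
    have "?v \<otimes> ?v = ([c] \<cdot> \<one> \<otimes> [c] \<cdot> \<one>) \<otimes> (u \<otimes> u)"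
      using uc natural_closed[of c] by algebra
    then show ?thesis using J.I_l_closed[OF u(3)] by simp
  qed
  moreover have "[p] \<cdot> \<one> \<otimes> ?v \<in> J"
    using e uc unfolding c natural_mult by (simp add: m_assoc)
  ultimately show ?thesis using p(1) by blast
qed

text \<open>
  Noetherian induction, from \<open>J = N\<close> downwards: the quotient map by \<open>J\<close> factors through the one by
  \<open>J + (v)\<close>, for which the claim is already known.
\<close>

lemma tame_quotient_by_nilradical:
  assumes fg: "finitely_generated_ring R" and N: "N = nilradical R"
    and D: "D > 0" "\<And>x. x \<in> N \<Longrightarrow> [(D::nat)] \<cdot> \<one> \<otimes> x = \<zero>"
    and "ideal J R" "J \<subseteq> N"
  shows "\<exists>h. tame_surjection (R Quot J) (R Quot N) h"
  using assms(5,6)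
proof (induction J rule: wf_induct_rule[OF wf_ideals[OF noetherian_if_finitely_generated[OF fg]]])
  case (1 J)
  interpret J: ideal J R by fact
  interpret N: ideal N R unfolding N by (rule nilradical_ideal)
  show ?case
  proof (cases "J = N")
    case True
    interpret pr: ring_hom_cring R "R Quot N" "(+>) N" by (rule N.rcos_ring_hom_cring[OF is_cring])
    have car: "(+>) N ` carrier R = carrier (R Quot N)"
      by (simp_all only: carrier_quotient)
    have "tame_surjection (R Quot N) (R Quot N) id"
      by (rule tame_isomorphism)
        (use pr.S.is_cring pr.finitely_generated_image[OF fg car] in auto)
    then show ?thesis using True by blast
  next
    case False
    then obtain x0 where "x0 \<in> N" "x0 \<notin> J" using "1.prems" by blast
    then obtain v and p :: nat where v: "v \<in> N" "v \<notin> J" "v \<otimes> v \<in> J" 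
      and p: "Factorial_Ring.prime p" "[p] \<cdot> \<one> \<otimes> v \<in> J"
      using exists_small_element[OF "1.prems"(1), of x0 D] D unfolding N by auto
    have vc: "v \<in> carrier R" using v(1) N.a_subset by blast
    let ?J = "{j \<oplus> b \<otimes> v | j b. j \<in> J \<and> b \<in> carrier R}"
    have JI: "j \<oplus> b \<otimes> v \<in> ?J" if "j \<in> J" "b \<in> carrier R" for j b using that by blast
    have J': "ideal ?J R"
    proof (rule idealI_cring, unfold submodule_over_def, intro conjI ballI subsetI)
      fix a assume "a \<in> ?J"
      then show "a \<in> carrier R" using J.a_subset vc by auto
    next
      have "\<zero> \<oplus> \<zero> \<otimes> v = \<zero>" using vc by simp
      then show "\<zero> \<in> ?J" using JI[of \<zero> \<zero>] by simp
    next
      fix a a' assume "a \<in> ?J" "a' \<in> ?J"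
      then obtain j b j' b' where a: "a = j \<oplus> b \<otimes> v" "j \<in> J" "b \<in> carrier R"
        and a': "a' = j' \<oplus> b' \<otimes> v" "j' \<in> J" "b' \<in> carrier R" by auto
      have "j \<in> carrier R" "j' \<in> carrier R" using a(2) a'(2) J.a_subset by auto
      then have "a \<oplus> a' = (j \<oplus> j') \<oplus> (b \<oplus> b') \<otimes> v"
        unfolding a(1) a'(1) using a(3) a'(3) vc by algebra
      then show "a \<oplus> a' \<in> ?J" using JI[of "j \<oplus> j'" "b \<oplus> b'"] a a' by simp
    next
      fix s a assume s: "s \<in> carrier R" and "a \<in> ?J"
      then obtain j b where a: "a = j \<oplus> b \<otimes> v" "j \<in> J" "b \<in> carrier R" by auto
      have "j \<in> carrier R" using a(2) J.a_subset by auto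
      then have "s \<otimes> a = s \<otimes> j \<oplus> (s \<otimes> b) \<otimes> v"
        unfolding a(1) using a(3) s vc by algebra
      then show "s \<otimes> a \<in> ?J" using JI[of "s \<otimes> j" "s \<otimes> b"] a s J.I_l_closed by simp
    qed
    have sub: "J \<subseteq> ?J"
    proof
      fix j assume j: "j \<in> J"
      then have "j = j \<oplus> \<zero> \<otimes> v" using vc J.a_subset by auto
      then show "j \<in> ?J" using JI[OF j, of \<zero>] by simp
    qed
    have "v = \<zero> \<oplus> \<one> \<otimes> v" using vc by simp
    then have vJ: "v \<in> ?J" using JI[of \<zero> \<one>] by simp
    have "?J \<subseteq> N"
    proof
      fix a assume "a \<in> ?J"
      then obtain j b where a: "a = j \<oplus> b \<otimes> v" "j \<in> J" "b \<in> carrier R" by auto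
      then show "a \<in> N" using "1.prems"(2) N.I_l_closed[OF v(1)] by auto
    qed
    then obtain k where k: "tame_surjection (R Quot ?J) (R Quot N) k"
      using "1.IH"[of ?J] "1.prems"(1) J' sub vJ v(2) by auto
    obtain h where "tame_surjection (R Quot J) (R Quot ?J) h"
      using quotient_step[OF fg "1.prems"(1) J' sub vJ v(3) p] by blast
    from tame_surjection_comp[OF this k] show ?thesis by blast
  qed
qed

end

theorem theorem5p1:
  fixes B :: "('a, 'x) ring_scheme"
  assumes "cring B"
    and "finitely_generated_ring B"
    and "ann_int B (nilradical B) \<noteq> {0}"
  shows "bi_interpretable (B Quot (nilradical B)) B"
proof -
  interpret cring B by fact
  let ?N = "nilradical B"
  interpret N: ideal ?N B by (rule nilradical_ideal)
  have "0 \<in> ann_int B ?N" unfolding ann_int_def by (simp add: add_pow_zero_int)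
  then obtain d where d: "d \<noteq> 0" "d \<in> ann_int B ?N" using assms(3) by blast
  define D where "D = nat \<bar>d\<bar>"
  have D0: "D > 0" using d(1) unfolding D_def by simp
  have D: "[D] \<cdot>\<^bsub>B\<^esub> \<one>\<^bsub>B\<^esub> \<otimes>\<^bsub>B\<^esub> x = \<zero>\<^bsub>B\<^esub>" if "x \<in> ?N" for x
  proof -
    have x: "x \<in> carrier B" using that N.a_subset by blast
    have 0: "[d] \<cdot>\<^bsub>B\<^esub> x = \<zero>\<^bsub>B\<^esub>" using d(2) that unfolding ann_int_def by blast
    have "[D] \<cdot>\<^bsub>B\<^esub> x = \<zero>\<^bsub>B\<^esub>"
    proof (cases "d \<ge> 0")
      case True
      then show ?thesis using 0 add_pow_int_ge[OF True, of B x] unfolding D_def by simp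
    next
      case False
      then have "\<ominus>\<^bsub>B\<^esub> ([D] \<cdot>\<^bsub>B\<^esub> x) = \<zero>\<^bsub>B\<^esub>"
        using 0 add_pow_int_lt[of d B x] unfolding D_def by simp
      then have "\<ominus>\<^bsub>B\<^esub> (\<ominus>\<^bsub>B\<^esub> ([D] \<cdot>\<^bsub>B\<^esub> x)) = \<zero>\<^bsub>B\<^esub>" by simp
      then show ?thesis using x by simp
    qed
    then show ?thesis by (simp only: natural_scale[OF x])
  qed
  interpret Z: ideal "{\<zero>\<^bsub>B\<^esub>}" B by (rule zeroideal)
  interpret pr: ring_hom_cring B "B Quot {\<zero>\<^bsub>B\<^esub>}" "(+>\<^bsub>B\<^esub>) {\<zero>\<^bsub>B\<^esub>}"
    by (rule Z.rcos_ring_hom_cring[OF is_cring])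
  have car: "(+>\<^bsub>B\<^esub>) {\<zero>\<^bsub>B\<^esub>} ` carrier B = carrier (B Quot {\<zero>\<^bsub>B\<^esub>})"
    by (simp_all only: carrier_quotient)
  have "tame_surjection B (B Quot {\<zero>\<^bsub>B\<^esub>}) ((+>\<^bsub>B\<^esub>) {\<zero>\<^bsub>B\<^esub>})"
  proof (rule tame_isomorphism[OF assms(1) pr.S.is_cring assms(2) pr.homh car])
    fix x assume "x \<in> carrier B" "{\<zero>\<^bsub>B\<^esub>} +>\<^bsub>B\<^esub> x = \<zero>\<^bsub>B Quot {\<zero>\<^bsub>B\<^esub>}\<^esub>"
    then have "x \<in> {\<zero>\<^bsub>B\<^esub>}" unfolding zero_quotient by (rule Z.rcos_const_imp_mem)
    then show "x = \<zero>\<^bsub>B\<^esub>" by simp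
  qed
  moreover obtain h where "tame_surjection (B Quot {\<zero>\<^bsub>B\<^esub>}) (B Quot ?N) h"
    using tame_quotient_by_nilradical[OF assms(2) refl D0 D zeroideal] by auto
  ultimately have "tame_surjection B (B Quot ?N) (\<lambda>x. h ({\<zero>\<^bsub>B\<^esub>} +>\<^bsub>B\<^esub> x))"
    by (rule tame_surjection_comp)
  then show ?thesis by (rule tame_surjection.bi_interpretable_image)
qed

end
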